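(* Let $\mathbf{K}$ be an algebraically closed field of characteristic zero, let $f(Y)\in\mathbf{K}[[X_1,\dots,X_d]][Y]$ be an irreducible quasi-ordinary Weierstrass polynomial and let $h_1,h_2,\dots,h_g$ be the sequence of its characteristic exponents. Let $N_0=\mathbf{Z}^d$ and $N_i=\mathbf{Z}^d+\mathbf{Z}h_1+\cdots+\mathbf{Z}h_i$ for $i=1,\dots,g$. Then the tree model $T(f)$ is characterized by the following two properties (that is, $T(f)$ satisfies both of them, and they determine the tree model up to a bijection of bars preserving heights and the postbar relation): (i) the set of the heights of bars of $T(f)$ is $\{h_1,\dots,h_g,h_{g+1}\}$, where $h_{g+1}=\infty$; (ii) for $i=1,\dots,g$, every bar of height $h_i$ has $[N_i:N_{i-1}]$ postbars and all of them have height $h_{i+1}$.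
   Context: Write $\underline X=(X_1,\dots,X_d)$ and $\underline X^{\alpha}=X_1^{\alpha_1}\cdots X_d^{\alpha_d}$ for $\alpha\in\mathbf{Q}_{\ge 0}^d$. A polynomial $f(Y)=Y^n+a_1(\underline X)Y^{n-1}+\cdots+a_n(\underline X)\in\mathbf{K}[[\underline X]][Y]$ ($n\ge 1$) is a Weierstrass polynomial if $a_i(0)=0$ for all $i$. It is quasi-ordinary if its $Y$-discriminant equals $X_1^{\alpha_1}\cdots X_d^{\alpha_d}u(\underline X)$ with $\alpha_i\in\mathbf{N}$ (where $0\in\mathbf{N}$) and $u(0)\ne 0$. Irreducible means irreducible in $\mathbf{K}[[\underline X]][Y]$. Contacts: by the Abhyankar-Jung theorem there is a positive integer $k$ such that all roots $\mathrm{Zer} f=\{Y_1,\dots,Y_n\}$ of $f$ lie in $\mathbf{K}[[X_1^{1/k},\dots,X_d^{1/k}]]$, and for $i\ne j$ one has $Y_i-Y_j=\underline X^{\lambda_{ij}}u_{ij}$ with $\lambda_{ij}\in\frac1k\mathbf{N}^d$, $u_{ij}\in\mathbf{K}[[X_1^{1/k},\dots,X_d^{1/k}]]$, $u_{ij}(0)\neq 0$. The contact is $O(Y_i,Y_j):=\lambda_{ij}$, and $O(Y_i,Y_i)=+\infty$. $\mathbf{Q}^d$ is partially ordered componentwise ($\alpha<\beta$ means $\alpha\le\beta$, $\alpha\ne\beta$), and $\alpha<+\infty$ for all $\alpha\in\mathbf{Q}^d$. For every nonempty $A\subset\mathrm{Zer} f$ the set of contacts between elements of $A$ has a smallest element.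 Tree model $T(f)$: it is the collection of subsets of $\mathrm{Zer} f$, called bars, obtained recursively as follows. $\mathrm{Zer} f$ is a bar (the bar of lowest height). The height $h(B)$ of a bar $B$ is the minimal contact between elements of $B$ (it is $+\infty$ iff $B$ is a singleton). If $h(B)$ is finite, the equivalence classes of $B$ under the relation $O(Y_i,Y_j)>h(B)$ are again bars, called the postbars of $B$. Bars of infinite height have no postbars; they are counted as bars and as postbars. Characteristic exponents: if $f$ is irreducible, the set $\{O(Y_j,Y_i): j\ne i\}$ does not depend on the choice of $Y_i\in\mathrm{Zer} f$ and is totally ordered; writing it as $\{h_1,\dots,h_g\}$ with $h_1<h_2<\dots<h_g$, the sequence $h_1,\dots,h_g$ is called the sequence of characteristic exponents of $f$. *)

theory Defs
  imports
    "HOL-Library.Function_Algebras"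
    "HOL-Library.Lattice_Constructions"
    "HOL-Algebra.Coset"
    "Subresultants.Resultant_Prelim"
begin

section \<open>Power series with exponents in \<open>\<nat>\<^sup>d\<close> or with bounded denominators\<close>

text \<open>For \<^typ>\<open>rat\<close> this is \<open>(1/k)\<nat>\<^sup>d\<close> (if \<open>k > 0\<close>); for \<^typ>\<open>nat\<close> it is everything.\<close>

definition grid :: "nat \<Rightarrow> ('d \<Rightarrow> 'e::linordered_semidom) set" where
  "grid k = {\<alpha>. \<forall>i. of_nat k * \<alpha> i \<in> \<nat>}"

text \<open>
  The variables are indexed by the finite type \<open>'d\<close>, so \<open>d = CARD('d)\<close>. One type constructor
  serves two rings: for \<open>'e = nat\<close> the support condition is void and the type is
  \<open>K[[X\<^sub>1,\<dots>,X\<^sub>d]]\<close>; for \<open>'e = rat\<close> it is the union over all \<open>k > 0\<close> of the rings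
  \<open>K[[X\<^sub>1^(1/k),\<dots>,X\<^sub>d^(1/k)]]\<close> (the condition also forces the exponents to be nonnegative).
\<close>

typedef (overloaded) ('a, 'e, 'd) pser =
    "{f :: ('d::finite \<Rightarrow> 'e::linordered_semidom) \<Rightarrow> 'a::zero. \<exists>k>0. {\<alpha>. f \<alpha> \<noteq> 0} \<subseteq> grid k}"
  morphisms pcoeff Abs_pser
  by (rule exI[of _ "\<lambda>_. 0"]) auto

setup_lifting type_definition_pser

type_synonym ('a, 'd) mps = "('a, nat, 'd) pser"
type_synonym ('a, 'd) fracps = "('a, rat, 'd) pser"

lemma grid_nat: "grid 1 = (UNIV :: ('d \<Rightarrow> nat) set)"
  by (auto simp: grid_def Nats_def)

lemma pser_eqI: "(\<And>\<alpha>. pcoeff f \<alpha> = pcoeff g \<alpha>) \<Longrightarrow> f = g"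
  by transfer auto

lemma grid_mult_left: "grid k \<subseteq> grid (k * m)"
proof
  fix \<alpha> :: "'a \<Rightarrow> 'b" assume a: "\<alpha> \<in> grid k"
  have "of_nat (k * m) * \<alpha> i \<in> \<nat>" for i
  proof -
    have "of_nat (k * m) * \<alpha> i = of_nat m * (of_nat k * \<alpha> i)" by (simp add: mult_ac)
    moreover have "of_nat k * \<alpha> i \<in> \<nat>" using a by (simp add: grid_def)
    ultimately show ?thesis by (metis Nats_mult of_nat_in_Nats)
  qed
  thus "\<alpha> \<in> grid (k * m)" by (simp add: grid_def)
qed

lemma grid_mult_right: "grid k \<subseteq> grid (m * k)"
  using grid_mult_left[of k m] by (simp add: mult.commute)

lemma grid_zero [simp]: "0 \<in> grid k"
  by (simp add: grid_def)

lemma grid_add: "\<alpha> \<in> grid k \<Longrightarrow> \<beta> \<in> grid k \<Longrightarrow> \<alpha> + \<beta> \<in> grid k"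
  by (auto simp: grid_def distrib_left intro: Nats_add)

lemma gridD:
  assumes "\<alpha> \<in> grid k" obtains n where "of_nat k * \<alpha> i = of_nat n"
  using assms unfolding grid_def by (metis (mono_tags, lifting) Nats_cases mem_Collect_eq)

lemma finite_grid_below:
  assumes "k > 0"
  shows "finite {\<alpha> \<in> grid k. \<forall>i. \<alpha> i \<le> (\<gamma> :: 'd::finite \<Rightarrow> 'e::linordered_semidom) i \<and> \<gamma> \<in> grid k}"
proof -
  let ?S = "{\<alpha> \<in> grid k. \<forall>i. \<alpha> i \<le> \<gamma> i \<and> \<gamma> \<in> grid k}"
  define num :: "'e \<Rightarrow> nat" where "num x = (THE n. of_nat k * x = of_nat n)" for x
  have num: "of_nat k * \<alpha> i = of_nat (num (\<alpha> i))" if a: "\<alpha> \<in> grid k" for \<alpha> :: "'d \<Rightarrow> 'e" and i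
  proof -
    obtain n where "of_nat k * \<alpha> i = of_nat n" using gridD[OF a] by blast
    thus ?thesis unfolding num_def by (rule theI) (simp add: \<open>of_nat k * \<alpha> i = of_nat n\<close>)
  qed
  have "inj_on (\<lambda>\<alpha> i. num (\<alpha> i)) ?S"
  proof (rule inj_onI, rule ext)
    fix \<alpha> \<beta> :: "'d \<Rightarrow> 'e" and i
    assume h: "\<alpha> \<in> ?S" "\<beta> \<in> ?S" "(\<lambda>i. num (\<alpha> i)) = (\<lambda>i. num (\<beta> i))"
    from h(3) have "num (\<alpha> i) = num (\<beta> i)" by meson
    hence "of_nat k * \<alpha> i = of_nat k * \<beta> i" using num[of \<alpha> i] num[of \<beta> i] h by simp
    moreover have "(0 :: 'e) < of_nat k" using assms by simp
    ultimately show "\<alpha> i = \<beta> i"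
      by (metis linorder_neqE mult_strict_left_mono order_less_irrefl)
  qed
  moreover have "(\<lambda>\<alpha> i. num (\<alpha> i)) ` ?S \<subseteq> (\<Pi>\<^sub>E i\<in>UNIV. {..num (\<gamma> i)})"
  proof (intro image_subsetI PiE_I)
    fix \<alpha> i assume h: "\<alpha> \<in> ?S"
    hence "of_nat k * \<alpha> i \<le> of_nat k * \<gamma> i" by (intro mult_left_mono) auto
    hence "of_nat (num (\<alpha> i)) \<le> (of_nat (num (\<gamma> i)) :: 'e)"
      using num[of \<alpha> i] num[of \<gamma> i] h by simp
    thus "num (\<alpha> i) \<in> {..num (\<gamma> i)}" by simp
  qed auto
  moreover have "finite (\<Pi>\<^sub>E i\<in>(UNIV::'d set). {..num (\<gamma> i)})" by (intro finite_PiE) auto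
  ultimately show ?thesis by (meson finite_subset inj_on_finite)
qed

definition gpairs :: "nat \<Rightarrow> ('d \<Rightarrow> 'e::linordered_semidom) \<Rightarrow> (('d \<Rightarrow> 'e) \<times> ('d \<Rightarrow> 'e)) set" where
  "gpairs k \<gamma> = {(\<alpha>, \<beta>). \<alpha> \<in> grid k \<and> \<beta> \<in> grid k \<and> \<alpha> + \<beta> = \<gamma>}"

lemma grid_nonneg:
  assumes "k > 0" "\<alpha> \<in> grid k" shows "0 \<le> \<alpha> i"
proof -
  obtain n where "of_nat k * \<alpha> i = of_nat n" using gridD[OF assms(2)] by blast
  hence "0 \<le> of_nat k * \<alpha> i" by simp
  moreover have "(0 :: 'b) < of_nat k" using assms(1) by simp
  ultimately show ?thesis by (metis mult_pos_neg not_le)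
qed

lemma finite_gpairs:
  assumes "k > 0" shows "finite (gpairs k (\<gamma> :: 'd::finite \<Rightarrow> 'e::linordered_semidom))"
proof -
  let ?S = "{\<alpha> \<in> grid k. \<forall>i. \<alpha> i \<le> \<gamma> i \<and> \<gamma> \<in> grid k}"
  have "gpairs k \<gamma> \<subseteq> ?S \<times> ?S"
    using grid_nonneg[OF assms] by (auto simp: gpairs_def grid_add)
  thus ?thesis using finite_grid_below[OF assms, of \<gamma>] by (meson finite_SigmaI finite_subset)
qed

text \<open>The Cauchy product. For series supported in a \<^const>\<open>grid\<close> the sum is finite, see
  \<open>finite_gpairs\<close> and \<open>conv_eq\<close>.\<close>

definition conv :: "(('d \<Rightarrow> 'e::linordered_semidom) \<Rightarrow> 'a::semiring_0) \<Rightarrow> (('d \<Rightarrow> 'e) \<Rightarrow> 'a) \<Rightarrow> ('d \<Rightarrow> 'e) \<Rightarrow> 'a" where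
  "conv f g \<gamma> = (\<Sum>(\<alpha>, \<beta>) \<in> {(\<alpha>, \<beta>). \<alpha> + \<beta> = \<gamma> \<and> f \<alpha> \<noteq> 0 \<and> g \<beta> \<noteq> 0}. f \<alpha> * g \<beta>)"

lemma conv_eq:
  fixes f g :: "('d::finite \<Rightarrow> 'e::linordered_semidom) \<Rightarrow> 'a::semiring_0"
  assumes "k > 0" "{\<alpha>. f \<alpha> \<noteq> 0} \<subseteq> grid k" "{\<alpha>. g \<alpha> \<noteq> 0} \<subseteq> grid k"
  shows "conv f g \<gamma> = (\<Sum>(\<alpha>, \<beta>) \<in> gpairs k \<gamma>. f \<alpha> * g \<beta>)"
  unfolding conv_def
  by (rule sum.mono_neutral_left) (use assms finite_gpairs in \<open>auto simp: gpairs_def\<close>)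

lemma conv_supp:
  assumes "{\<alpha>. f \<alpha> \<noteq> 0} \<subseteq> grid k" "{\<alpha>. g \<alpha> \<noteq> 0} \<subseteq> grid k"
  shows "{\<alpha>. conv f g \<alpha> \<noteq> 0} \<subseteq> grid k"
proof clarify
  fix \<gamma> assume "conv f g \<gamma> \<noteq> 0"
  hence "{(\<alpha>, \<beta>). \<alpha> + \<beta> = \<gamma> \<and> f \<alpha> \<noteq> 0 \<and> g \<beta> \<noteq> 0} \<noteq> {}"
    unfolding conv_def by (rule contrapos_nn) (simp only: sum.empty)
  then obtain \<alpha> \<beta> where "\<alpha> + \<beta> = \<gamma>" "f \<alpha> \<noteq> 0" "g \<beta> \<noteq> 0"
    by auto
  thus "\<gamma> \<in> grid k" using assms grid_add by blast
qed

lemma conv_commute: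
  fixes f g :: "('d::finite \<Rightarrow> 'e::linordered_semidom) \<Rightarrow> 'a::comm_semiring_0"
  shows "conv f g = conv g f"
  unfolding conv_def fun_eq_iff
  by (intro allI sum.reindex_bij_witness[of _ prod.swap prod.swap]) (auto simp: add.commute mult.commute)

lemma sum_Sigma_gpairs:
  fixes \<delta> :: "'d::finite \<Rightarrow> 'e::linordered_semidom" and F :: "_ \<Rightarrow> 'd \<Rightarrow> 'e"
  assumes "k > 0"
  shows "(\<Sum>p \<in> gpairs k \<delta>. \<Sum>q \<in> gpairs k (F p). G p q)
       = (\<Sum>(p, q) \<in> Sigma (gpairs k \<delta>) (\<lambda>p. gpairs k (F p)). G p q)"
  by (rule sum.Sigma) (auto simp: finite_gpairs[OF assms])

lemma conv_assoc:
  fixes f g h :: "('d::finite \<Rightarrow> 'e::linordered_semidom) \<Rightarrow> 'a::semiring_0"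
  assumes k: "k > 0" and f: "{\<alpha>. f \<alpha> \<noteq> 0} \<subseteq> grid k" and g: "{\<alpha>. g \<alpha> \<noteq> 0} \<subseteq> grid k"
    and h: "{\<alpha>. h \<alpha> \<noteq> 0} \<subseteq> grid k"
  shows "conv (conv f g) h \<delta> = conv f (conv g h) \<delta>"
proof -
  have "conv (conv f g) h \<delta>
      = (\<Sum>(\<epsilon>, \<gamma>) \<in> gpairs k \<delta>. (\<Sum>(\<alpha>, \<beta>) \<in> gpairs k \<epsilon>. f \<alpha> * g \<beta> * h \<gamma>))"
    by (simp add: conv_eq[OF k conv_supp[OF f g] h] conv_eq[OF k f g] sum_distrib_right case_prod_unfold)
  also have "\<dots> = (\<Sum>((\<epsilon>, \<gamma>), (\<alpha>, \<beta>)) \<in> Sigma (gpairs k \<delta>) (\<lambda>(\<epsilon>, \<gamma>). gpairs k \<epsilon>). f \<alpha> * g \<beta> * h \<gamma>)"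
    by (simp add: sum_Sigma_gpairs[OF k] case_prod_unfold)
  also have "\<dots> = (\<Sum>((\<alpha>, \<epsilon>), (\<beta>, \<gamma>)) \<in> Sigma (gpairs k \<delta>) (\<lambda>(\<alpha>, \<epsilon>). gpairs k \<epsilon>). f \<alpha> * (g \<beta> * h \<gamma>))"
    by (rule sum.reindex_bij_witness[of _
          "\<lambda>((\<alpha>, \<epsilon>), (\<beta>, \<gamma>)). ((\<alpha> + \<beta>, \<gamma>), (\<alpha>, \<beta>))" "\<lambda>((\<epsilon>, \<gamma>), (\<alpha>, \<beta>)). ((\<alpha>, \<beta> + \<gamma>), (\<beta>, \<gamma>))"])
      (auto simp: gpairs_def grid_add add.assoc mult.assoc)
  also have "\<dots> = (\<Sum>(\<alpha>, \<epsilon>) \<in> gpairs k \<delta>. (\<Sum>(\<beta>, \<gamma>) \<in> gpairs k \<epsilon>. f \<alpha> * (g \<beta> * h \<gamma>)))"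
    by (simp add: sum_Sigma_gpairs[OF k] case_prod_unfold)
  also have "\<dots> = conv f (conv g h) \<delta>"
    by (simp add: conv_eq[OF k f conv_supp[OF g h]] conv_eq[OF k g h] sum_distrib_left case_prod_unfold)
  finally show ?thesis .
qed

lemma conv_one:
  "conv (\<lambda>\<alpha>. if \<alpha> = 0 then 1 else 0) f = (f :: ('d::finite \<Rightarrow> 'e::linordered_semidom) \<Rightarrow> 'a::comm_semiring_1)"
proof
  fix \<gamma>
  have "{(\<alpha>, \<beta>). \<alpha> + \<beta> = \<gamma> \<and> (if \<alpha> = 0 then 1 else 0) \<noteq> (0::'a) \<and> f \<beta> \<noteq> 0} = (if f \<gamma> = 0 then {} else {(0, \<gamma>)})"
    by (auto split: if_splits)
  thus "conv (\<lambda>\<alpha>. if \<alpha> = 0 then 1 else 0) f \<gamma> = f \<gamma>" by (simp add: conv_def del: split_paired_All)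
qed

lemma supp_binop:
  assumes "{\<alpha>. f \<alpha> \<noteq> 0} \<subseteq> grid k" "{\<alpha>. g \<alpha> \<noteq> 0} \<subseteq> grid k" "bop 0 0 = 0"
  shows "{\<alpha>. bop (f \<alpha>) (g \<alpha>) \<noteq> 0} \<subseteq> grid k"
proof clarify
  fix \<alpha> assume "bop (f \<alpha>) (g \<alpha>) \<noteq> 0"
  hence "f \<alpha> \<noteq> 0 \<or> g \<alpha> \<noteq> 0" using assms(3) by (cases "f \<alpha> = 0"; cases "g \<alpha> = 0") auto
  thus "\<alpha> \<in> grid k" using assms(1,2) by blast
qed

lemma conv_distrib:
  fixes f g h :: "('d::finite \<Rightarrow> 'e::linordered_semidom) \<Rightarrow> 'a::semiring_0"
  assumes k: "k > 0" and f: "{\<alpha>. f \<alpha> \<noteq> 0} \<subseteq> grid k" and g: "{\<alpha>. g \<alpha> \<noteq> 0} \<subseteq> grid k"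
    and h: "{\<alpha>. h \<alpha> \<noteq> 0} \<subseteq> grid k"
  shows "conv (\<lambda>\<alpha>. f \<alpha> + g \<alpha>) h \<delta> = conv f h \<delta> + conv g h \<delta>"
proof -
  have "{\<alpha>. f \<alpha> + g \<alpha> \<noteq> 0} \<subseteq> grid k" by (rule supp_binop[OF f g]) simp
  thus ?thesis
    by (simp add: conv_eq[OF k _ h] f g sum.distrib distrib_right case_prod_unfold)
qed

lemma common2:
  fixes A B :: "('d \<Rightarrow> 'e::linordered_semidom) set"
  assumes "\<exists>k>0. A \<subseteq> grid k" "\<exists>k>0. B \<subseteq> grid k"
  obtains k where "k > 0" "A \<subseteq> grid k" "B \<subseteq> grid k"
proof -
  obtain k l where "k > 0" "A \<subseteq> grid k" "l > 0" "B \<subseteq> grid l" using assms by blast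
  thus ?thesis using that[of "k * l"] grid_mult_left[of k l] grid_mult_right[of l k] by auto
qed

lemma common3:
  fixes A B C :: "('d \<Rightarrow> 'e::linordered_semidom) set"
  assumes "\<exists>k>0. A \<subseteq> grid k" "\<exists>k>0. B \<subseteq> grid k" "\<exists>k>0. C \<subseteq> grid k"
  obtains k where "k > 0" "A \<subseteq> grid k" "B \<subseteq> grid k" "C \<subseteq> grid k"
proof -
  obtain k where k: "k > 0" "A \<union> B \<subseteq> grid k" using common2[OF assms(1,2)] by (metis Un_least)
  hence "\<exists>k>0. A \<union> B \<subseteq> grid k" by blast
  from common2[OF this assms(3)] show ?thesis using that by (metis Un_subset_iff)
qed

instantiation pser :: (comm_ring_1, linordered_semidom, finite) comm_ring_1
begin

lift_definition zero_pser :: "('a, 'b, 'c) pser" is "\<lambda>_. 0"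
  by auto

lift_definition one_pser :: "('a, 'b, 'c) pser" is "\<lambda>\<alpha>. if \<alpha> = 0 then 1 else 0"
  by (auto intro!: exI[of _ "1::nat"])

lift_definition plus_pser :: "('a, 'b, 'c) pser \<Rightarrow> ('a, 'b, 'c) pser \<Rightarrow> ('a, 'b, 'c) pser"
  is "\<lambda>f g \<alpha>. f \<alpha> + g \<alpha>"
  subgoal for f g
    by (rule common2[of "{\<alpha>. f \<alpha> \<noteq> 0}" "{\<alpha>. g \<alpha> \<noteq> 0}"])
      (assumption | intro exI conjI supp_binop[where bop = "(+)"] | simp)+
  done

lift_definition uminus_pser :: "('a, 'b, 'c) pser \<Rightarrow> ('a, 'b, 'c) pser"
  is "\<lambda>f \<alpha>. - f \<alpha>" by simp

lift_definition minus_pser :: "('a, 'b, 'c) pser \<Rightarrow> ('a, 'b, 'c) pser \<Rightarrow> ('a, 'b, 'c) pser"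
  is "\<lambda>f g \<alpha>. f \<alpha> - g \<alpha>"
  subgoal for f g
    by (rule common2[of "{\<alpha>. f \<alpha> \<noteq> 0}" "{\<alpha>. g \<alpha> \<noteq> 0}"])
      (assumption | intro exI conjI supp_binop[where bop = "(-)"] | simp)+
  done

lift_definition times_pser :: "('a, 'b, 'c) pser \<Rightarrow> ('a, 'b, 'c) pser \<Rightarrow> ('a, 'b, 'c) pser"
  is conv
  subgoal for f g
    by (rule common2[of "{\<alpha>. f \<alpha> \<noteq> 0}" "{\<alpha>. g \<alpha> \<noteq> 0}"]) (use conv_supp in blast)+
  done

instance
proof
  fix f g h :: "('a, 'b, 'c) pser"
  show "f * g * h = f * (g * h)"
    apply transfer
    subgoal for f g h
      by (rule common3[of "{\<alpha>. f \<alpha> \<noteq> 0}" "{\<alpha>. g \<alpha> \<noteq> 0}" "{\<alpha>. h \<alpha> \<noteq> 0}"])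
        (auto intro!: ext conv_assoc)
    done
  show "(f + g) * h = f * h + g * h"
    apply transfer
    subgoal for f g h
      by (rule common3[of "{\<alpha>. f \<alpha> \<noteq> 0}" "{\<alpha>. g \<alpha> \<noteq> 0}" "{\<alpha>. h \<alpha> \<noteq> 0}"])
        (auto intro!: ext conv_distrib)
    done
  show "f * g = g * f" by transfer (rule conv_commute)
  show "1 * f = f" by transfer (rule conv_one)
  show "(0 :: ('a, 'b, 'c) pser) \<noteq> 1" by transfer (auto simp: fun_eq_iff)
qed (transfer; simp add: fun_eq_iff add_ac; fail)+

end

text \<open>For \<^const>\<open>pderiv\<close> the ring needs to be free of zero divisors: compare lexicographically
  smallest exponents.\<close>

definition lex_lt :: "'d list \<Rightarrow> ('d \<Rightarrow> 'e::linordered_semidom) \<Rightarrow> ('d \<Rightarrow> 'e) \<Rightarrow> bool" where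
  "lex_lt xs \<alpha> \<beta> \<longleftrightarrow> (\<exists>j < length xs. \<alpha> (xs ! j) < \<beta> (xs ! j) \<and> (\<forall>i<j. \<alpha> (xs ! i) = \<beta> (xs ! i)))"

lemma lex_min_exists:
  fixes S :: "('d \<Rightarrow> 'e::linordered_semidom) set"
  assumes k: "k > 0" and S: "S \<subseteq> grid k" "S \<noteq> {}"
  shows "\<exists>\<mu>\<in>S. \<forall>\<alpha>\<in>S. \<not> lex_lt xs \<alpha> \<mu>"
  using S
proof (induction xs arbitrary: S)
  case Nil
  thus ?case by (auto simp: lex_lt_def)
next
  case (Cons x xs)
  define T where "T = {n. \<exists>\<alpha>\<in>S. of_nat k * \<alpha> x = of_nat n}"
  have ex: "\<exists>n. of_nat k * \<alpha> x = of_nat n" if "\<alpha> \<in> S" for \<alpha>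
    using that Cons.prems by (auto simp: grid_def Nats_def)
  obtain \<alpha>0 where a0: "\<alpha>0 \<in> S" using Cons.prems by auto
  obtain n0 where "n0 \<in> T" using ex[OF a0] a0 by (auto simp: T_def)
  define m where "m = (LEAST n. n \<in> T)"
  have mT: "m \<in> T" unfolding m_def by (rule LeastI) fact
  have mle: "m \<le> n" if "n \<in> T" for n unfolding m_def by (rule Least_le) fact
  define S' where "S' = {\<alpha>\<in>S. of_nat k * \<alpha> x = of_nat m}"
  have "S' \<subseteq> grid k" "S' \<noteq> {}" using mT Cons.prems by (auto simp: S'_def T_def)
  from Cons.IH[OF this] obtain \<mu> where mu: "\<mu> \<in> S'" "\<forall>\<alpha>\<in>S'. \<not> lex_lt xs \<alpha> \<mu>" by blast
  have "\<not> lex_lt (x # xs) \<alpha> \<mu>" if aS: "\<alpha> \<in> S" for \<alpha>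
  proof
    assume "lex_lt (x # xs) \<alpha> \<mu>"
    then obtain j where j: "j < length (x # xs)" "\<alpha> ((x # xs) ! j) < \<mu> ((x # xs) ! j)"
      "\<forall>i<j. \<alpha> ((x # xs) ! i) = \<mu> ((x # xs) ! i)" by (auto simp: lex_lt_def)
    obtain n where n: "of_nat k * \<alpha> x = of_nat n" using ex[OF aS] by blast
    have mu_m: "of_nat k * \<mu> x = of_nat m" using mu by (simp add: S'_def)
    show False
    proof (cases j)
      case 0
      hence "of_nat k * \<alpha> x < of_nat k * \<mu> x" using j k by (intro mult_strict_left_mono) auto
      hence "n < m" using n mu_m by simp
      moreover have "n \<in> T" using n aS by (auto simp: T_def)
      ultimately show False using mle[of n] by simp
    next
      case (Suc j')
      have "\<alpha> x = \<mu> x" using j(3) Suc by force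
      hence "\<alpha> \<in> S'" using aS mu_m by (simp add: S'_def)
      moreover have "lex_lt xs \<alpha> \<mu>" unfolding lex_lt_def using j Suc by (intro exI[of _ j']) force
      ultimately show False using mu by blast
    qed
  qed
  thus ?case using mu by (auto simp: S'_def)
qed

lemma lex_lt_total:
  assumes "set xs = UNIV" "\<alpha> \<noteq> \<beta>" shows "lex_lt xs \<alpha> \<beta> \<or> lex_lt xs \<beta> \<alpha>"
proof -
  let ?P = "\<lambda>j. j < length xs \<and> \<alpha> (xs ! j) \<noteq> \<beta> (xs ! j)"
  obtain x where "\<alpha> x \<noteq> \<beta> x" using assms by auto
  then obtain j0 where "?P j0" using assms(1) by (metis UNIV_I in_set_conv_nth)
  hence "\<exists>j. ?P j" by blast
  then obtain j where j: "?P j" "\<forall>i<j. \<not> ?P i"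
    using exists_least_iff[of ?P] by blast
  hence eq: "\<forall>i<j. \<alpha> (xs ! i) = \<beta> (xs ! i)" by (meson order.strict_trans)
  show ?thesis
  proof (cases "\<alpha> (xs ! j) < \<beta> (xs ! j)")
    case True
    thus ?thesis using j eq by (auto simp: lex_lt_def)
  next
    case False
    hence "\<beta> (xs ! j) < \<alpha> (xs ! j)" using j by auto
    moreover have "\<forall>i<j. \<beta> (xs ! i) = \<alpha> (xs ! i)" using eq by simp
    ultimately show ?thesis using j by (auto simp: lex_lt_def)
  qed
qed

lemma lex_lt_add:
  assumes "lex_lt xs \<alpha> \<alpha>'" "lex_lt xs \<beta> \<beta>' \<or> \<beta> = \<beta>'" shows "\<alpha> + \<beta> \<noteq> \<alpha>' + \<beta>'"
proof -
  obtain j where j: "j < length xs" "\<alpha> (xs ! j) < \<alpha>' (xs ! j)" "\<forall>i<j. \<alpha> (xs ! i) = \<alpha>' (xs ! i)"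
    using assms(1) by (auto simp: lex_lt_def)
  show ?thesis
  proof (cases "\<beta> = \<beta>'")
    case True
    thus ?thesis using j by (auto simp: fun_eq_iff intro!: exI[of _ "xs ! j"])
  next
    case False
    then obtain l where l: "l < length xs" "\<beta> (xs ! l) < \<beta>' (xs ! l)" "\<forall>i<l. \<beta> (xs ! i) = \<beta>' (xs ! i)"
      using assms(2) by (auto simp: lex_lt_def)
    have "\<alpha> (xs ! min j l) + \<beta> (xs ! min j l) < \<alpha>' (xs ! min j l) + \<beta>' (xs ! min j l)"
    proof (cases j l rule: linorder_cases)
      case less
      thus ?thesis using j l by (simp add: min_def)
    next
      case equal
      thus ?thesis using j l by (simp add: add_strict_mono)
    next
      case greater
      thus ?thesis using j l by (simp add: min_def)
    qed
    hence "(\<alpha> + \<beta>) (xs ! min j l) \<noteq> (\<alpha>' + \<beta>') (xs ! min j l)" by simp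
    thus ?thesis by metis
  qed
qed

instance pser :: (idom, linordered_semidom, finite) idom
proof
  fix f g :: "('a, 'b, 'c) pser"
  assume "f \<noteq> 0" "g \<noteq> 0"
  thus "f * g \<noteq> 0"
  proof (transfer, goal_cases)
    case (1 f g)
    obtain k where k: "k > 0" "{\<alpha>. f \<alpha> \<noteq> 0} \<subseteq> grid k" "{\<alpha>. g \<alpha> \<noteq> 0} \<subseteq> grid k"
      using common2[OF 1(1,3)] by blast
    obtain xs :: "'c list" where xs: "set xs = UNIV" 
      using finite_list[OF finite[of "UNIV :: 'c set"]] by blast
    have ne: "{\<alpha>. f \<alpha> \<noteq> 0} \<noteq> {}" "{\<alpha>. g \<alpha> \<noteq> 0} \<noteq> {}"
      using 1(2,4) by (simp_all add: fun_eq_iff)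
    obtain \<mu> where mu: "f \<mu> \<noteq> 0" "\<And>\<alpha>. f \<alpha> \<noteq> 0 \<Longrightarrow> \<not> lex_lt xs \<alpha> \<mu>"
      using lex_min_exists[OF k(1,2) ne(1), of xs] by blast
    obtain \<nu> where nu: "g \<nu> \<noteq> 0" "\<And>\<alpha>. g \<alpha> \<noteq> 0 \<Longrightarrow> \<not> lex_lt xs \<alpha> \<nu>"
      using lex_min_exists[OF k(1,3) ne(2), of xs] by blast
    have "{(\<alpha>, \<beta>). \<alpha> + \<beta> = \<mu> + \<nu> \<and> f \<alpha> \<noteq> 0 \<and> g \<beta> \<noteq> 0} = {(\<mu>, \<nu>)}"
    proof -
      have "\<alpha> = \<mu> \<and> \<beta> = \<nu>" if h: "\<alpha> + \<beta> = \<mu> + \<nu>" "f \<alpha> \<noteq> 0" "g \<beta> \<noteq> 0" for \<alpha> \<beta>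
      proof -
        have a: "lex_lt xs \<mu> \<alpha> \<or> \<mu> = \<alpha>" and b: "lex_lt xs \<nu> \<beta> \<or> \<nu> = \<beta>"
          using lex_lt_total[OF xs] mu(2)[OF h(2)] nu(2)[OF h(3)] by blast+
        have "\<not> lex_lt xs \<mu> \<alpha>" using lex_lt_add[OF _ b, of \<mu> \<alpha>] h(1) by auto
        moreover have "\<not> lex_lt xs \<nu> \<beta>" using lex_lt_add[OF _ a, of \<nu> \<beta>] h(1) by (auto simp: add.commute)
        ultimately show ?thesis using a b by auto
      qed
      thus ?thesis using mu nu by auto
    qed
    hence "conv f g (\<mu> + \<nu>) = f \<mu> * g \<nu>" by (simp add: conv_def)
    thus ?case using mu nu by (metis mult_eq_0_iff)
  qed
qed

text \<open>The monomial \<open>X\<^sup>\<alpha>\<close>, for \<open>\<alpha>\<close> in some \<^const>\<open>grid\<close> with \<open>k > 0\<close>; for \<open>'e = nat\<close> this is no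
  restriction and for \<open>'e = rat\<close> it says \<open>\<alpha> \<ge> 0\<close>. Other exponents get the dummy value \<open>0\<close>.\<close>

lift_definition X_pow :: "('d::finite \<Rightarrow> 'e::linordered_semidom) \<Rightarrow> ('a::comm_ring_1, 'e, 'd) pser"
  is "\<lambda>\<alpha> \<beta>. if \<beta> = \<alpha> \<and> (\<exists>k>0. \<alpha> \<in> grid k) then 1 else 0"
  subgoal for \<alpha>
    by (cases "\<exists>k>0. \<alpha> \<in> grid k") (auto split: if_splits intro!: exI[of _ "1::nat"])
  done

abbreviation const_term :: "('a::comm_ring_1, 'e::linordered_semidom, 'd::finite) pser \<Rightarrow> 'a" where
  "const_term u \<equiv> pcoeff u 0"

text \<open>The inclusion of \<open>K[[X]]\<close> into the series with fractional exponents.\<close>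

lift_definition embed :: "('a::comm_ring_1, 'd::finite) mps \<Rightarrow> ('a, 'd) fracps"
  is "\<lambda>f \<alpha>. if \<forall>i. \<alpha> i \<in> \<nat> then f (\<lambda>i. nat \<lfloor>\<alpha> i\<rfloor>) else 0"
  by (rule exI[of _ 1]) (auto simp: grid_def)

section \<open>Quasi-ordinary Weierstrass polynomials\<close>

text \<open>\<open>(-1)^(n(n-1)/2) Res(f, f')\<close> is the discriminant for monic \<open>f\<close> of degree \<open>n\<close> in characteristic
  zero (where \<open>f'\<close> has degree \<open>n - 1\<close>), the only case used.\<close>

definition monic_discriminant :: "'a::idom poly \<Rightarrow> 'a" where
  "monic_discriminant f = (-1) ^ (degree f * (degree f - 1) div 2) * resultant f (pderiv f)"

definition weierstrass_poly :: "('a::field, 'd::finite) mps poly \<Rightarrow> bool" where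
  "weierstrass_poly f \<longleftrightarrow> degree f \<ge> 1 \<and> lead_coeff f = 1 \<and>
     (\<forall>i < degree f. const_term (Polynomial.coeff f i) = 0)"

definition quasi_ordinary :: "('a::field, 'd::finite) mps poly \<Rightarrow> bool" where
  "quasi_ordinary f \<longleftrightarrow> (\<exists>\<alpha> u. monic_discriminant f = X_pow \<alpha> * u \<and> const_term u \<noteq> 0)"

section \<open>Roots, contacts and the tree model\<close>

text \<open>
  Roots are taken in the union of all \<open>K[[X\<^sub>1^(1/k),\<dots>,X\<^sub>d^(1/k)]]\<close>; by the Abhyankar-Jung theorem a
  quasi-ordinary polynomial splits there, and they are pairwise distinct since the discriminant
  is nonzero. Contacts live in \<open>\<rat>\<^sup>d\<close> with the componentwise order of functions, extended by the
  largest element \<^const>\<open>top.Top\<close>, which plays the role of \<open>+\<infinity>\<close>.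
\<close>

definition Zer :: "('a::field, 'd::finite) mps poly \<Rightarrow> ('a, 'd) fracps set" where
  "Zer f = {y. poly (map_poly embed f) y = 0}"

definition contact :: "('a::field, 'd::finite) fracps \<Rightarrow> ('a, 'd) fracps \<Rightarrow> ('d \<Rightarrow> rat) top" where
  "contact y z = (if y = z then top.Top
     else top.Value (THE \<alpha>. 0 \<le> \<alpha> \<and> (\<exists>u. y - z = X_pow \<alpha> * u \<and> const_term u \<noteq> 0)))"

text \<open>The smallest contact, not merely a minimal one. Including the contacts \<open>O(y, y) = +\<infinity>\<close> only
  matters for singletons, whose height is thus \<open>+\<infinity>\<close>.\<close>

definition bar_height :: "('a::field, 'd::finite) fracps set \<Rightarrow> ('d \<Rightarrow> rat) top" where
  "bar_height B = (LEAST h. \<exists>y\<in>B. \<exists>z\<in>B. h = contact y z)"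

definition postbars :: "('a::field, 'd::finite) fracps set \<Rightarrow> ('a, 'd) fracps set set" where
  "postbars B = (if bar_height B = top.Top then {}
     else B // {(y, z). y \<in> B \<and> z \<in> B \<and> contact y z > bar_height B})"

inductive_set bars :: "('a::field, 'd::finite) mps poly \<Rightarrow> ('a, 'd) fracps set set"
  for f :: "('a, 'd) mps poly" where
  "Zer f \<in> bars f"
| "B \<in> bars f \<Longrightarrow> C \<in> postbars B \<Longrightarrow> C \<in> bars f"

text \<open>A bijection of bars preserving heights and the postbar relation.\<close>

definition tree_iso :: "('a::field, 'd::finite) mps poly \<Rightarrow> ('a, 'd) mps poly \<Rightarrow> bool" where
  "tree_iso f g \<longleftrightarrow> (\<exists>\<phi>. bij_betw \<phi> (bars f) (bars g) \<and>
     (\<forall>B\<in>bars f. bar_height (\<phi> B) = bar_height B) \<and>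
     (\<forall>B\<in>bars f. \<forall>C\<in>bars f. \<phi> C \<in> postbars (\<phi> B) \<longleftrightarrow> C \<in> postbars B))"

section \<open>Characteristic exponents\<close>

text \<open>The strictly increasing enumeration \<open>h\<^sub>1 < \<dots> < h\<^sub>g\<close> of the contacts of any root with the others;
  \<open>h\<^sub>i\<close> is the list entry of index \<open>i - 1\<close>. The list is empty if there is only one root.\<close>

definition char_exponents :: "('a::field, 'd::finite) mps poly \<Rightarrow> ('d \<Rightarrow> rat) list" where
  "char_exponents f = (THE hs. sorted_wrt (<) hs \<and>
     (\<forall>y\<in>Zer f. top.Value ` set hs = {contact z y | z. z \<in> Zer f \<and> z \<noteq> y}))"

text \<open>\<open>h\<^sub>i\<close> for \<open>1 \<le> i \<le> g\<close>, and \<open>h\<^sub>g\<^sub>+\<^sub>1 = \<infinity>\<close>.\<close>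

definition char_height :: "('d \<Rightarrow> rat) list \<Rightarrow> nat \<Rightarrow> ('d \<Rightarrow> rat) top" where
  "char_height hs i = (if i \<le> length hs then top.Value (hs ! (i - 1)) else top.Top)"

text \<open>\<open>N\<^sub>i = \<int>\<^sup>d + \<int>h\<^sub>1 + \<dots> + \<int>h\<^sub>i\<close>.\<close>

definition char_lattice :: "('d \<Rightarrow> rat) list \<Rightarrow> nat \<Rightarrow> ('d \<Rightarrow> rat) set" where
  "char_lattice hs i = {\<alpha>. \<exists>(z :: 'd \<Rightarrow> int) (c :: nat \<Rightarrow> int).
     \<alpha> = (\<lambda>j. of_int (z j) + (\<Sum>l=1..i. of_int (c l) * (hs ! (l - 1)) j))}"

text \<open>The index of a subgroup \<open>H\<close> of an additive group \<open>G\<close>, \<open>0\<close> if infinite.\<close>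

definition add_index :: "'b::ab_group_add set \<Rightarrow> 'b set \<Rightarrow> nat" where
  "add_index G H = card (rcosets\<^bsub>\<lparr>carrier = G, monoid.mult = (+), one = 0\<rparr>\<^esub> H)"

text \<open>The two characterizing properties of the tree model of \<open>f\<close>, relative to a sequence \<open>hs\<close>. A bar
  of finite height has finitely many postbars and at least one, so the equation for their number
  also says that the index is finite.\<close>

definition has_tree_type :: "('a::field, 'd::finite) mps poly \<Rightarrow> ('d \<Rightarrow> rat) list \<Rightarrow> bool" where
  "has_tree_type f hs \<longleftrightarrow>
     bar_height ` bars f = char_height hs ` {1..length hs + 1} \<and>
     (\<forall>i\<in>{1..length hs}. \<forall>B\<in>bars f. bar_height B = char_height hs i \<longrightarrow>
        card (postbars B) = add_index (char_lattice hs i) (char_lattice hs (i - 1)) \<and>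
        (\<forall>C\<in>postbars B. bar_height C = char_height hs (i + 1)))"

end

theory Submission
  imports Defs "Subresultants.Subresultant" "HOL-Analysis.Continuum_Not_Denumerable"
begin

text \<open>
  An irreducible quasi-ordinary polynomial has all its roots among the fractional power series, and
  the roots are conjugate under the characters of \<open>\<rat>\<^sup>d / \<int>\<^sup>d\<close>: a character \<open>\<chi>\<close> acts by multiplying
  the coefficient of \<open>X\<^sup>\<alpha>\<close> by \<open>\<chi>(\<alpha>)\<close>. The contact of a root with its conjugate under \<open>\<chi>\<close> is the
  first characteristic exponent \<open>h\<^sub>l\<close> with \<open>\<chi>(h\<^sub>l) \<noteq> 1\<close>. Hence a bar of height \<open>h\<^sub>i\<close> consists of the
  conjugates of one root under the characters trivial on \<open>N\<^sub>i\<^sub>-\<^sub>1\<close>, and two of these lie in the same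
  postbar iff the characters agree at \<open>h\<^sub>i\<close>. The values at \<open>h\<^sub>i\<close> of such characters are exactly the
  \<open>r\<close>-th roots of unity, where \<open>r\<close> is the order of \<open>h\<^sub>i\<close> modulo \<open>N\<^sub>i\<^sub>-\<^sub>1\<close>, and \<open>r = [N\<^sub>i : N\<^sub>i\<^sub>-\<^sub>1]\<close>
  (\<open>card_postbars_ball\<close>, with \<open>character_with_value\<close> and \<open>add_index_char_lattice\<close>). Conjugacy
  (\<open>galois_transitive\<close>) holds because the polynomial whose roots are the conjugates of one root has
  invariant coefficients, so it lies over \<open>K[[X]]\<close> and divides the irreducible polynomial.

  That the two properties determine the tree is a statement about finite ultrametric sets: contacts
  satisfy the ultrametric inequality, and if the numbers of postbars agree level by level, then
  isometries of postbars glue to isometries of bars (\<open>tree_type_determines_tree\<close>).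

  The existence of a fractional root is the Abhyankar-Jung theorem
  (\<open>quasi_ordinary_has_fractional_root\<close>), proved as follows. Substituting \<open>X\<^sub>i \<mapsto> t\<^bsup>w\<^sub>i\<^esup>\<close> for positive
  reals \<open>w\<^sub>i\<close> independent over \<open>\<rat>\<close> embeds \<open>K[[X]]\<close> into the generalized power series with
  well-ordered real exponents, where monic polynomials have roots by Newton's method. It remains to
  see that the exponents of such a root \<open>y\<close> are images of vectors in some \<open>(1/k)\<nat>\<^sup>d\<close>.

  Every additive map \<open>l\<close> from the reals to the rationals gives the derivation
  \<open>t\<^sup>a \<mapsto> l(a) t\<^sup>a\<close>. If \<open>l\<close> vanishes on the span of the weights, the derivation kills \<open>K[[X]]\<close> and so
  the simple root \<open>y\<close>; hence all exponents of \<open>y\<close> lie in the span. If \<open>l\<close> is the \<open>i\<close>-th coordinate on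
  the span, it extends \<open>X\<^sub>i \<partial>/\<partial>X\<^sub>i\<close>. Iterated derivatives of \<open>y\<close> are polynomials in \<open>y\<close>, a
  priori with powers of the discriminant in the denominator. But these derivations do not lower the
  order, for any weight, so Lagrange interpolation at all roots shows that, up to a unit, the
  discriminant itself is a sufficient denominator. The iterated derivatives thus lie in a finitely generated
  module over the Noetherian ring \<open>K[[X]]\<close>, and \<open>y\<close> satisfies a linear differential equation in
  \<open>X\<^sub>i \<partial>/\<partial>X\<^sub>i\<close> with coefficients in \<open>K[[X]]\<close> and leading coefficient a unit. Its indicial polynomial
  leaves finitely many possibilities for the \<open>i\<close>-th coordinates of exponents up to adding natural
  numbers, which bounds denominators. Finally the coordinates are nonnegative because after any other
  weighted substitution the same series is a root of a monic polynomial, so it has nonnegative order.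
\<close>

section \<open>Generalized power series with well-ordered real exponents\<close>

definition well_ordered_set :: "real set \<Rightarrow> bool" where
  "well_ordered_set S \<longleftrightarrow> (\<forall>T\<subseteq>S. T \<noteq> {} \<longrightarrow> (\<exists>m\<in>T. \<forall>x\<in>T. m \<le> x))"

lemma well_ordered_set_subset: "well_ordered_set S \<Longrightarrow> T \<subseteq> S \<Longrightarrow> well_ordered_set T"
  by (auto simp: well_ordered_set_def)

lemma well_ordered_set_empty [simp]: "well_ordered_set {}"
  by (auto simp: well_ordered_set_def)

lemma well_ordered_set_singleton: "well_ordered_set {a}"
  by (auto simp: well_ordered_set_def subset_singleton_iff)

lemma well_ordered_setD:
  "well_ordered_set S \<Longrightarrow> T \<subseteq> S \<Longrightarrow> T \<noteq> {} \<Longrightarrow> \<exists>m\<in>T. \<forall>x\<in>T. m \<le> x"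
  by (simp add: well_ordered_set_def)

text \<open>The form in which well-orderedness is preserved by unions and sumsets: pass to
  nondecreasing subsequences.\<close>

lemma well_ordered_set_iff_no_descent:
  "well_ordered_set S \<longleftrightarrow> \<not> (\<exists>s::nat \<Rightarrow> real. range s \<subseteq> S \<and> (\<forall>n. s (Suc n) < s n))"
proof
  assume wo: "well_ordered_set S"
  show "\<not> (\<exists>s::nat \<Rightarrow> real. range s \<subseteq> S \<and> (\<forall>n. s (Suc n) < s n))"
  proof clarify
    fix s :: "nat \<Rightarrow> real" assume s: "range s \<subseteq> S" "\<forall>n. s (Suc n) < s n"
    have "\<exists>m\<in>range s. \<forall>x\<in>range s. m \<le> x" using wo s(1) by (rule well_ordered_setD) simp
    then obtain n where "s n \<le> s (Suc n)" by auto
    thus False using s(2)[rule_format, of n] by simp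
  qed
next
  assume no: "\<not> (\<exists>s::nat \<Rightarrow> real. range s \<subseteq> S \<and> (\<forall>n. s (Suc n) < s n))"
  show "well_ordered_set S"
    unfolding well_ordered_set_def
  proof (intro allI impI, rule ccontr)
    fix T assume T: "T \<subseteq> S" "T \<noteq> {}" and "\<not> (\<exists>m\<in>T. \<forall>x\<in>T. m \<le> x)"
    hence "\<forall>m\<in>T. \<exists>x\<in>T. x < m" by (meson not_le)
    then obtain g where g: "\<And>m. m \<in> T \<Longrightarrow> g m \<in> T \<and> g m < m" by metis
    obtain t where t: "t \<in> T" using T by blast
    define s where "s n = (g ^^ n) t" for n
    have sT: "s n \<in> T" for n by (induction n) (auto simp: s_def t g)
    have "s (Suc n) < s n" for n using g[OF sT[of n]] by (simp add: s_def)
    thus False using no sT T by (metis image_subset_iff subset_iff)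
  qed
qed

lemma well_ordered_set_incseq_subseq:
  assumes "well_ordered_set S" "range s \<subseteq> S"
  obtains r :: "nat \<Rightarrow> nat" where "strict_mono r" "incseq (\<lambda>n. s (r n))"
proof -
  obtain f where f: "strict_mono f" "monoseq (\<lambda>n. s (f n))"
    using seq_monosub by blast
  show ?thesis
  proof (cases "incseq (\<lambda>n. s (f n))")
    case True
    thus ?thesis using that f by blast
  next
    case False
    hence dec: "decseq (\<lambda>n. s (f n))" using f by (simp add: monoseq_iff)
    have "range (\<lambda>n. s (f n)) \<subseteq> S" "range (\<lambda>n. s (f n)) \<noteq> {}" using assms(2) by auto
    then obtain m where m: "m \<in> range (\<lambda>n. s (f n))" "\<forall>x\<in>range (\<lambda>n. s (f n)). m \<le> x"
      using well_ordered_setD[OF assms(1)] by meson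
    then obtain N where N: "m = s (f N)" by blast
    have "s (f (N + n)) = m" for n
      using dec m(2) N unfolding decseq_def by (metis le_add1 antisym rangeI)
    hence "incseq (\<lambda>n. s (f (N + n)))" by (simp add: incseq_def)
    moreover have "strict_mono (\<lambda>n. f (N + n))" using f(1) by (simp add: strict_mono_def)
    ultimately show ?thesis using that[of "\<lambda>n. f (N + n)"] by blast
  qed
qed

lemma well_ordered_set_Un:
  assumes "well_ordered_set A" "well_ordered_set B"
  shows "well_ordered_set (A \<union> B)"
  unfolding well_ordered_set_def
proof (intro allI impI)
  fix T assume T: "T \<subseteq> A \<union> B" "T \<noteq> {}"
  show "\<exists>m\<in>T. \<forall>x\<in>T. m \<le> x"
  proof (cases "T \<subseteq> A \<or> T \<subseteq> B")
    case True
    thus ?thesis using T(2) well_ordered_setD[OF assms(1)] well_ordered_setD[OF assms(2)] by metis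
  next
    case False
    hence ne: "T \<inter> A \<noteq> {}" "T \<inter> B \<noteq> {}" using T by blast+
    obtain a where a: "a \<in> T \<inter> A" "\<forall>x\<in>T \<inter> A. a \<le> x"
      using well_ordered_setD[OF assms(1) inf_le2 ne(1)] by blast
    obtain b where b: "b \<in> T \<inter> B" "\<forall>x\<in>T \<inter> B. b \<le> x"
      using well_ordered_setD[OF assms(2) inf_le2 ne(2)] by blast
    have "min a b \<in> T" using a b by (simp add: min_def)
    moreover have "\<forall>x\<in>T. min a b \<le> x" 
    proof
      fix x assume "x \<in> T"
      hence "x \<in> T \<inter> A \<or> x \<in> T \<inter> B" using T by blast
      hence "a \<le> x \<or> b \<le> x" using a b by blast
      thus "min a b \<le> x" by linarith
    qed
    ultimately show ?thesis by blast
  qed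
qed

definition sumset :: "real set \<Rightarrow> real set \<Rightarrow> real set" where
  "sumset A B = {a + b | a b. a \<in> A \<and> b \<in> B}"

lemma well_ordered_set_sumset:
  assumes "well_ordered_set A" "well_ordered_set B"
  shows "well_ordered_set (sumset A B)"
  unfolding well_ordered_set_iff_no_descent
proof clarify
  fix s :: "nat \<Rightarrow> real" assume s: "range s \<subseteq> sumset A B" "\<forall>n. s (Suc n) < s n"
  have "\<forall>n. \<exists>a b. a \<in> A \<and> b \<in> B \<and> s n = a + b" using s(1) unfolding sumset_def by blast
  then obtain a b where ab: "\<And>n. a n \<in> A" "\<And>n. b n \<in> B" "\<And>n. s n = a n + b n" by metis
  obtain r where r: "strict_mono r" "incseq (\<lambda>n. a (r n))"
    using well_ordered_set_incseq_subseq[OF assms(1), of a] ab by blast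
  have "s n < s m" if "m < n" for m n using s(2) that
    by (metis lift_Suc_mono_less[of "\<lambda>n. - s n"] neg_less_iff_less)
  hence "s (r (Suc n)) < s (r n)" for n using r(1) by (simp add: strict_mono_Suc_iff)
  moreover have "a (r n) \<le> a (r (Suc n))" for n using r(2) by (rule incseq_SucD)
  ultimately have "b (r (Suc n)) < b (r n)" for n unfolding ab(3) by (smt (verit))
  moreover have "range (\<lambda>n. b (r n)) \<subseteq> B" using ab by blast
  ultimately show False using assms(2) unfolding well_ordered_set_iff_no_descent by blast
qed

definition sum_pairs :: "real set \<Rightarrow> real set \<Rightarrow> real \<Rightarrow> (real \<times> real) set" where
  "sum_pairs A B c = {(a, b). a \<in> A \<and> b \<in> B \<and> a + b = c}"

lemma finite_if_well_ordered_both_ways: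
  assumes "well_ordered_set P" "well_ordered_set (uminus ` P)"
  shows "finite P"
proof (rule ccontr)
  assume inf: "infinite P"
  have max: "\<exists>m\<in>T. \<forall>x\<in>T. x \<le> m" if T: "T \<subseteq> P" "T \<noteq> {}" for T
  proof -
    have "uminus ` T \<subseteq> uminus ` P" "uminus ` T \<noteq> {}" using T by auto
    then obtain m where "m \<in> uminus ` T" "\<forall>x\<in>uminus ` T. m \<le> x"
      using well_ordered_setD[OF assms(2)] by meson
    thus ?thesis by (intro bexI[of _ "- m"]) auto
  qed
  define T where "T = {x \<in> P. infinite {y \<in> P. y \<le> x}}"
  obtain M where M: "M \<in> P" "\<forall>x\<in>P. x \<le> M" using max[of P] inf by auto
  hence "{y \<in> P. y \<le> M} = P" by auto
  hence "M \<in> T" using M inf by (simp add: T_def)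
  moreover have "T \<subseteq> P" by (auto simp: T_def)
  ultimately obtain t where t: "t \<in> T" "\<forall>x\<in>T. t \<le> x"
    using well_ordered_setD[OF assms(1), of T] by blast
  have "{y \<in> P. y \<le> t} = insert t {y \<in> P. y < t}" using t by (auto simp: T_def)
  hence inf2: "infinite {y \<in> P. y < t}" using t by (auto simp: T_def)
  then obtain s where s: "s \<in> {y \<in> P. y < t}" "\<forall>x\<in>{y \<in> P. y < t}. x \<le> s"
    using max[of "{y \<in> P. y < t}"] by (metis (no_types, lifting) finite.emptyI mem_Collect_eq subsetI)
  have "{y \<in> P. y < t} \<subseteq> {y \<in> P. y \<le> s}" using s by blast
  hence "s \<in> T" using s inf2 finite_subset by (auto simp: T_def)
  thus False using t s by force
qed

lemma finite_sum_pairs: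
  assumes "well_ordered_set A" "well_ordered_set B"
  shows "finite (sum_pairs A B c)"
proof -
  define P where "P = {a \<in> A. c - a \<in> B}"
  have "well_ordered_set P" using assms(1) by (rule well_ordered_set_subset) (auto simp: P_def)
  moreover have "well_ordered_set (uminus ` P)"
    unfolding well_ordered_set_iff_no_descent
  proof clarify
    fix s :: "nat \<Rightarrow> real" assume s: "range s \<subseteq> uminus ` P" "\<forall>n. s (Suc n) < s n"
    have "range (\<lambda>n. c + s n) \<subseteq> B"
    proof clarify
      fix n
      have "s n \<in> uminus ` P" using s(1) by blast
      thus "c + s n \<in> B" by (auto simp: P_def)
    qed
    moreover have "\<forall>n. c + s (Suc n) < c + s n" using s(2) by simp
    ultimately show False using assms(2) unfolding well_ordered_set_iff_no_descent
      by (metis (mono_tags, lifting))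
  qed
  ultimately have "finite P" by (rule finite_if_well_ordered_both_ways)
  moreover have "sum_pairs A B c \<subseteq> (\<lambda>a. (a, c - a)) ` P" by (auto simp: sum_pairs_def P_def image_iff)
  ultimately show ?thesis by (meson finite_imageI finite_subset)
qed

typedef (overloaded) 'a hahn = "{f :: real \<Rightarrow> 'a::zero. well_ordered_set {a. f a \<noteq> 0}}"
  morphisms hcoeff Abs_hahn
  by (rule exI[of _ "\<lambda>_. 0"]) simp

setup_lifting type_definition_hahn

lemma hahn_eqI: "(\<And>a. hcoeff x a = hcoeff y a) \<Longrightarrow> x = y"
  by transfer auto

definition hconv :: "(real \<Rightarrow> 'a::semiring_0) \<Rightarrow> (real \<Rightarrow> 'a) \<Rightarrow> real \<Rightarrow> 'a" where
  "hconv f g c = (\<Sum>(a, b) \<in> sum_pairs {a. f a \<noteq> 0} {b. g b \<noteq> 0} c. f a * g b)"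

lemma hconv_eq:
  assumes "well_ordered_set A" "well_ordered_set B" "{a. f a \<noteq> 0} \<subseteq> A" "{a. g a \<noteq> 0} \<subseteq> B"
  shows "hconv f g c = (\<Sum>(a, b) \<in> sum_pairs A B c. f a * g b)"
  unfolding hconv_def
  by (rule sum.mono_neutral_left) (use assms finite_sum_pairs in \<open>auto simp: sum_pairs_def\<close>)

lemma hconv_supp: "{c. hconv f g c \<noteq> 0} \<subseteq> sumset {a. f a \<noteq> 0} {a. g a \<noteq> 0}"
proof clarify
  fix c assume "hconv f g c \<noteq> 0"
  hence "sum_pairs {a. f a \<noteq> 0} {b. g b \<noteq> 0} c \<noteq> {}"
    unfolding hconv_def by (rule contrapos_nn) (simp only: sum.empty)
  thus "c \<in> sumset {a. f a \<noteq> 0} {a. g a \<noteq> 0}" by (auto simp: sum_pairs_def sumset_def)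
qed

lemma well_ordered_supp_hconv:
  assumes "well_ordered_set {a. f a \<noteq> 0}" "well_ordered_set {a. g a \<noteq> 0}"
  shows "well_ordered_set {a. hconv f g a \<noteq> 0}"
  by (rule well_ordered_set_subset[OF well_ordered_set_sumset[OF assms] hconv_supp])

lemma hconv_commute: "hconv f g = hconv g (f :: real \<Rightarrow> 'a::comm_semiring_0)"
  unfolding hconv_def fun_eq_iff
  by (intro allI sum.reindex_bij_witness[of _ prod.swap prod.swap])
    (auto simp: sum_pairs_def add.commute mult.commute)

lemma hconv_assoc:
  fixes f g h :: "real \<Rightarrow> 'a::semiring_0"
  assumes f: "well_ordered_set {a. f a \<noteq> 0}" and g: "well_ordered_set {a. g a \<noteq> 0}"
    and h: "well_ordered_set {a. h a \<noteq> 0}"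
  shows "hconv (hconv f g) h d = hconv f (hconv g h) d"
proof -
  let ?A = "{a. f a \<noteq> 0}" let ?B = "{a. g a \<noteq> 0}" let ?C = "{a. h a \<noteq> 0}"
  have fin1: "finite (sum_pairs (sumset ?A ?B) ?C d)" "\<And>e. finite (sum_pairs ?A ?B e)"
    using f g h by (auto intro!: finite_sum_pairs well_ordered_set_sumset)
  have fin2: "finite (sum_pairs ?A (sumset ?B ?C) d)" "\<And>e. finite (sum_pairs ?B ?C e)"
    using f g h by (auto intro!: finite_sum_pairs well_ordered_set_sumset)
  have "hconv (hconv f g) h d
      = (\<Sum>(e, c) \<in> sum_pairs (sumset ?A ?B) ?C d. (\<Sum>(a, b) \<in> sum_pairs ?A ?B e. f a * g b * h c))"
    by (subst hconv_eq[OF well_ordered_set_sumset[OF f g] h hconv_supp subset_refl])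
      (simp add: hconv_def sum_distrib_right case_prod_unfold)
  also have "\<dots> = (\<Sum>((e, c), (a, b)) \<in> Sigma (sum_pairs (sumset ?A ?B) ?C d) (\<lambda>(e, c). sum_pairs ?A ?B e). f a * g b * h c)"
    by (subst sum.Sigma[symmetric]) (use fin1 in \<open>auto simp: case_prod_unfold\<close>)
  also have "\<dots> = (\<Sum>((a, e), (b, c)) \<in> Sigma (sum_pairs ?A (sumset ?B ?C) d) (\<lambda>(a, e). sum_pairs ?B ?C e). f a * (g b * h c))"
    by (rule sum.reindex_bij_witness[of _
          "\<lambda>((a, e), (b, c)). ((a + b, c), (a, b))" "\<lambda>((e, c), (a, b)). ((a, b + c), (b, c))"])
      (auto simp: sum_pairs_def sumset_def add.assoc mult.assoc)
  also have "\<dots> = (\<Sum>(a, e) \<in> sum_pairs ?A (sumset ?B ?C) d. (\<Sum>(b, c) \<in> sum_pairs ?B ?C e. f a * (g b * h c)))"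
    by (subst sum.Sigma[symmetric]) (use fin2 in \<open>auto simp: case_prod_unfold\<close>)
  also have "\<dots> = hconv f (hconv g h) d"
    by (subst hconv_eq[OF f well_ordered_set_sumset[OF g h] subset_refl hconv_supp])
      (simp add: hconv_def sum_distrib_left case_prod_unfold)
  finally show ?thesis .
qed

lemma hconv_monom_left:
  "hconv (\<lambda>b. if b = a then k else 0) f c = k * (f :: real \<Rightarrow> 'a::comm_semiring_1) (c - a)"
proof -
  have "sum_pairs {b. (if b = a then k else 0) \<noteq> 0} {b. f b \<noteq> 0} c
      = (if k = 0 \<or> f (c - a) = 0 then {} else {(a, c - a)})"
    by (auto simp: sum_pairs_def split: if_splits)
  thus ?thesis by (simp add: hconv_def)
qed

lemma well_ordered_supp_binop:
  assumes "well_ordered_set {a. f a \<noteq> 0}" "well_ordered_set {a. g a \<noteq> 0}" "bop 0 0 = 0"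
  shows "well_ordered_set {a. bop (f a) (g a) \<noteq> 0}"
proof (rule well_ordered_set_subset[OF well_ordered_set_Un[OF assms(1,2)]])
  show "{a. bop (f a) (g a) \<noteq> 0} \<subseteq> {a. f a \<noteq> 0} \<union> {a. g a \<noteq> 0}"
    using assms(3) by auto
qed

lemma hconv_distrib:
  fixes f g h :: "real \<Rightarrow> 'a::semiring_0"
  assumes f: "well_ordered_set {a. f a \<noteq> 0}" and g: "well_ordered_set {a. g a \<noteq> 0}"
    and h: "well_ordered_set {a. h a \<noteq> 0}"
  shows "hconv (\<lambda>a. f a + g a) h c = hconv f h c + hconv g h c"
proof -
  let ?A = "{a. f a \<noteq> 0} \<union> {a. g a \<noteq> 0}"
  have A: "well_ordered_set ?A" using f g by (rule well_ordered_set_Un)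
  have "hconv (\<lambda>a. f a + g a) h c = (\<Sum>(a, b) \<in> sum_pairs ?A {a. h a \<noteq> 0} c. (f a + g a) * h b)"
    by (rule hconv_eq[OF A h]) auto
  moreover have "hconv f h c = (\<Sum>(a, b) \<in> sum_pairs ?A {a. h a \<noteq> 0} c. f a * h b)"
    by (rule hconv_eq[OF A h]) auto
  moreover have "hconv g h c = (\<Sum>(a, b) \<in> sum_pairs ?A {a. h a \<noteq> 0} c. g a * h b)"
    by (rule hconv_eq[OF A h]) auto
  ultimately show ?thesis by (simp add: sum.distrib distrib_right case_prod_unfold)
qed

instantiation hahn :: (comm_ring_1) comm_ring_1
begin

lift_definition zero_hahn :: "'a hahn" is "\<lambda>_. 0" by simp

lift_definition one_hahn :: "'a hahn" is "\<lambda>a. if a = 0 then 1 else 0"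
  by (rule well_ordered_set_subset[OF well_ordered_set_singleton]) (auto split: if_splits)

lift_definition plus_hahn :: "'a hahn \<Rightarrow> 'a hahn \<Rightarrow> 'a hahn" is "\<lambda>f g a. f a + g a"
  by (rule well_ordered_supp_binop) auto

lift_definition uminus_hahn :: "'a hahn \<Rightarrow> 'a hahn" is "\<lambda>f a. - f a" by simp

lift_definition minus_hahn :: "'a hahn \<Rightarrow> 'a hahn \<Rightarrow> 'a hahn" is "\<lambda>f g a. f a - g a"
  by (rule well_ordered_supp_binop) auto

lift_definition times_hahn :: "'a hahn \<Rightarrow> 'a hahn \<Rightarrow> 'a hahn" is hconv
  by (rule well_ordered_supp_hconv)

instance
proof
  fix f g h :: "'a hahn"
  show "f * g * h = f * (g * h)" by transfer (rule ext, rule hconv_assoc)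
  show "(f + g) * h = f * h + g * h" by transfer (rule ext, rule hconv_distrib)
  show "f * g = g * f" by transfer (rule hconv_commute)
  show "1 * f = f" by transfer (simp add: hconv_monom_left fun_eq_iff)
  show "(0 :: 'a hahn) \<noteq> 1" by transfer (auto simp: fun_eq_iff)
qed (transfer; simp add: fun_eq_iff add_ac; fail)+

end

lemma hcoeff_simps [simp]:
  "hcoeff 0 a = 0" "hcoeff (x + y) a = hcoeff x a + hcoeff y a"
  "hcoeff (x - y) a = hcoeff x a - hcoeff y a" "hcoeff (- x) a = - hcoeff x a"
  by (transfer; simp)+

lemma hcoeff_1: "hcoeff 1 a = (if a = 0 then 1 else 0)"
  by transfer simp

lemma hcoeff_sum: "hcoeff (sum f A) a = (\<Sum>i\<in>A. hcoeff (f i) a)"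
  by (induction A rule: infinite_finite_induct) auto

definition supp_ge :: "real \<Rightarrow> 'a::zero hahn \<Rightarrow> bool" where
  "supp_ge r x \<longleftrightarrow> (\<forall>a. hcoeff x a \<noteq> 0 \<longrightarrow> r \<le> a)"

lemma supp_geD: "supp_ge r x \<Longrightarrow> a < r \<Longrightarrow> hcoeff x a = 0"
  by (force simp: supp_ge_def)

lemma supp_ge_0 [simp]: "supp_ge r 0"
  by (simp add: supp_ge_def zero_hahn.rep_eq)

lemma supp_ge_add: "supp_ge r x \<Longrightarrow> supp_ge r y \<Longrightarrow> supp_ge r (x + (y :: 'a::comm_ring_1 hahn))"
  by (force simp: supp_ge_def)

lemma supp_ge_sum: "(\<And>i. i \<in> A \<Longrightarrow> supp_ge r (f i)) \<Longrightarrow> supp_ge r (sum f A :: 'a::comm_ring_1 hahn)"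
  by (induction A rule: infinite_finite_induct) (auto intro: supp_ge_add)

lemma supp_ge_mono: "supp_ge r x \<Longrightarrow> s \<le> r \<Longrightarrow> supp_ge s x"
  by (force simp: supp_ge_def)

lemma supp_ge_mult:
  fixes x y :: "'a::comm_ring_1 hahn"
  assumes "supp_ge r x" "supp_ge s y"
  shows "supp_ge (r + s) (x * y)"
  unfolding supp_ge_def
proof (intro allI impI)
  fix c assume "hcoeff (x * y) c \<noteq> 0"
  hence "c \<in> sumset {a. hcoeff x a \<noteq> 0} {a. hcoeff y a \<noteq> 0}"
    using hconv_supp[of "hcoeff x" "hcoeff y"] by (auto simp: times_hahn.rep_eq)
  thus "r + s \<le> c" using assms by (force simp: sumset_def supp_ge_def)
qed

lemma hcoeff_mult_lowest:
  fixes x y :: "'a::comm_ring_1 hahn"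
  assumes "supp_ge r x" "supp_ge s y"
  shows "hcoeff (x * y) (r + s) = hcoeff x r * hcoeff y s"
proof -
  have "a = r \<and> b = s" if "a + b = r + s" "hcoeff x a \<noteq> 0" "hcoeff y b \<noteq> 0" for a b
  proof -
    have "r \<le> a" "s \<le> b" using assms that by (auto simp: supp_ge_def)
    thus ?thesis using that by linarith
  qed
  hence "sum_pairs {a. hcoeff x a \<noteq> 0} {a. hcoeff y a \<noteq> 0} (r + s)
      = (if hcoeff x r = 0 \<or> hcoeff y s = 0 then {} else {(r, s)})"
    unfolding sum_pairs_def by auto
  thus ?thesis by (simp add: times_hahn.rep_eq hconv_def)
qed

lemma supp_ge_power: "supp_ge r x \<Longrightarrow> supp_ge (real n * r) ((x :: 'a::comm_ring_1 hahn) ^ n)"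
proof (induction n)
  case (Suc n)
  thus ?case using supp_ge_mult[of r x "real n * r" "x ^ n"] by (simp add: distrib_right)
qed (simp add: supp_ge_def hcoeff_1)

lemma hcoeff_power_lowest:
  "supp_ge r x \<Longrightarrow> hcoeff ((x :: 'a::comm_ring_1 hahn) ^ n) (real n * r) = hcoeff x r ^ n"
proof (induction n)
  case (Suc n)
  thus ?case using hcoeff_mult_lowest[of r x "real n * r" "x ^ n"] supp_ge_power[of r x n]
    by (simp add: distrib_right)
qed (simp add: hcoeff_1)

lemma hahn_lowest_exponent:
  assumes "x \<noteq> (0 :: 'a::comm_ring_1 hahn)"
  obtains m where "hcoeff x m \<noteq> 0" "supp_ge m x"
proof -
  have wo: "well_ordered_set {a. hcoeff x a \<noteq> 0}" using hcoeff[of x] by simp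
  have ne: "{a. hcoeff x a \<noteq> 0} \<noteq> {}"
    using assms hahn_eqI[of x 0] by auto
  from wo ne obtain m where "m \<in> {a. hcoeff x a \<noteq> 0}" "\<forall>a\<in>{a. hcoeff x a \<noteq> 0}. m \<le> a"
    using well_ordered_setD[OF wo subset_refl ne] by blast
  thus ?thesis using that unfolding supp_ge_def by blast
qed

instance hahn :: (idom) idom
proof
  fix x y :: "'a hahn" assume "x \<noteq> 0" "y \<noteq> 0"
  obtain r where r: "hcoeff x r \<noteq> 0" "supp_ge r x" by (rule hahn_lowest_exponent[OF \<open>x \<noteq> 0\<close>])
  obtain s where s: "hcoeff y s \<noteq> 0" "supp_ge s y" by (rule hahn_lowest_exponent[OF \<open>y \<noteq> 0\<close>])
  have "hcoeff (x * y) (r + s) = hcoeff x r * hcoeff y s" using r s by (intro hcoeff_mult_lowest)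
  hence "hcoeff (x * y) (r + s) \<noteq> 0" using r s by simp
  thus "x * y \<noteq> 0" by (metis hcoeff_simps(1))
qed

lift_definition hmonom :: "'a::zero \<Rightarrow> real \<Rightarrow> 'a hahn" is "\<lambda>k a b. if b = a then k else 0"
  by (rule well_ordered_set_subset[OF well_ordered_set_singleton]) (auto split: if_splits)

lemma hcoeff_hmonom: "hcoeff (hmonom k a) b = (if b = a then k else 0)"
  by transfer simp

lemma hcoeff_hmonom_mult: "hcoeff (hmonom k a * x) b = k * hcoeff (x :: 'a::comm_ring_1 hahn) (b - a)"
  by transfer (rule hconv_monom_left)

section \<open>Roots of polynomials over generalized power series\<close>

text \<open>The weight of the monomial \<open>t\<^sup>e T\<^sup>i\<close> is \<open>e + i a\<close>.\<close>

definition poly_supp_ge :: "real \<Rightarrow> real \<Rightarrow> 'a::comm_ring_1 hahn poly \<Rightarrow> bool" where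
  "poly_supp_ge a m p \<longleftrightarrow> (\<forall>i. supp_ge (m - real i * a) (coeff p i))"

lift_definition initial_poly :: "real \<Rightarrow> real \<Rightarrow> 'a::comm_ring_1 hahn poly \<Rightarrow> 'a poly"
  is "\<lambda>a m p i. hcoeff (p i) (m - real i * a)"
  by (auto simp: MOST_nat elim!: all_forward ex_forward)

lemma poly_supp_ge_pCons:
  "poly_supp_ge a m (pCons e p) \<longleftrightarrow> supp_ge m e \<and> poly_supp_ge a (m - a) p"
proof
  assume h: "poly_supp_ge a m (pCons e p)"
  have "supp_ge (m - a - real i * a) (coeff p i)" for i
    using h[unfolded poly_supp_ge_def, rule_format, of "Suc i"] by (simp add: algebra_simps)
  thus "supp_ge m e \<and> poly_supp_ge a (m - a) p"
    using h[unfolded poly_supp_ge_def, rule_format, of 0] by (simp add: poly_supp_ge_def)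
next
  assume h: "supp_ge m e \<and> poly_supp_ge a (m - a) p"
  show "poly_supp_ge a m (pCons e p)" unfolding poly_supp_ge_def
  proof
    fix i
    show "supp_ge (m - real i * a) (coeff (pCons e p) i)"
      using h by (cases i) (auto simp: poly_supp_ge_def algebra_simps)
  qed
qed

lemma initial_poly_pCons:
  "initial_poly a m (pCons e p) = pCons (hcoeff e m) (initial_poly a (m - a) p)"
  by (rule poly_eqI) (auto simp: initial_poly.rep_eq coeff_pCons algebra_simps split: nat.splits)

lemma initial_poly_0 [simp]: "initial_poly a m 0 = 0"
  by (rule poly_eqI) (simp add: initial_poly.rep_eq)

lemma poly_supp_ge_0 [simp]: "poly_supp_ge a m 0"
  by (simp add: poly_supp_ge_def)

lemma initial_poly_add: "initial_poly a m (p + q) = initial_poly a m p + initial_poly a m q"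
  by (rule poly_eqI) (simp add: initial_poly.rep_eq)

lemma poly_supp_ge_add: "poly_supp_ge a m p \<Longrightarrow> poly_supp_ge a m q \<Longrightarrow> poly_supp_ge a m (p + q)"
  by (simp add: poly_supp_ge_def supp_ge_add)

lemma poly_supp_ge_smult:
  assumes "supp_ge a d" "poly_supp_ge a (m - a) p"
  shows "poly_supp_ge a m (smult d p)"
  unfolding poly_supp_ge_def
proof
  fix i
  have "supp_ge (a + (m - a - real i * a)) (d * coeff p i)"
    using assms by (intro supp_ge_mult) (auto simp: poly_supp_ge_def)
  thus "supp_ge (m - real i * a) (coeff (smult d p) i)" by simp
qed

lemma initial_poly_smult:
  assumes "supp_ge a d" "poly_supp_ge a (m - a) p"
  shows "initial_poly a m (smult d p) = smult (hcoeff d a) (initial_poly a (m - a) p)"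
proof (rule poly_eqI)
  fix i
  have "hcoeff (d * coeff p i) (a + (m - a - real i * a)) = hcoeff d a * hcoeff (coeff p i) (m - a - real i * a)"
    using assms by (intro hcoeff_mult_lowest) (auto simp: poly_supp_ge_def)
  thus "coeff (initial_poly a m (smult d p)) i = coeff (smult (hcoeff d a) (initial_poly a (m - a) p)) i"
    by (simp add: initial_poly.rep_eq)
qed

text \<open>Translating the variable by a series of order at least \<open>a\<close> respects the grading, and acts on
  initial polynomials as the translation by the coefficient at \<open>a\<close>.\<close>

lemma initial_poly_shift:
  assumes "supp_ge a d" "poly_supp_ge a m p"
  shows "poly_supp_ge a m (pcompose p [:d, 1:]) \<and>
    initial_poly a m (pcompose p [:d, 1:]) = pcompose (initial_poly a m p) [:hcoeff d a, 1:]"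
  using assms(2)
proof (induction p arbitrary: m)
  case (pCons e p)
  define s where "s = pcompose p [:d, 1:]"
  have e: "supp_ge m e" and p: "poly_supp_ge a (m - a) p" using pCons(3) by (simp_all add: poly_supp_ge_pCons)
  have IH: "poly_supp_ge a (m - a) s"
    "initial_poly a (m - a) s = pcompose (initial_poly a (m - a) p) [:hcoeff d a, 1:]"
    unfolding s_def using pCons(2)[OF p] by (rule conjunct1, rule conjunct2)
  have eq: "pcompose (pCons e p) [:d, 1:] = [:e:] + (smult d s + pCons 0 s)"
    unfolding s_def by (simp add: pcompose_pCons)
  have 1: "poly_supp_ge a m [:e:]" "poly_supp_ge a m (smult d s)" "poly_supp_ge a m (pCons 0 s)"
    using e IH assms(1) by (auto simp: poly_supp_ge_pCons intro: poly_supp_ge_smult)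
  show ?case unfolding eq
    using 1 by (auto simp: poly_supp_ge_add initial_poly_add initial_poly_smult[OF assms(1) IH(1)] IH(2)
        initial_poly_pCons pcompose_pCons)
qed simp

text \<open>Newton's criterion: \<open>a\<close> is an admissible exponent for the next term after \<open>z\<close>. The two
  nonvanishing conditions say that \<open>a\<close> is a slope of the Newton polygon of \<open>p(z + T)\<close>, with the
  constant term strictly above it.\<close>

definition newton_step :: "'a::comm_ring_1 hahn poly \<Rightarrow> 'a hahn \<Rightarrow> real \<Rightarrow> bool" where
  "newton_step p z a \<longleftrightarrow> (\<exists>m. poly_supp_ge a m (pcompose p [:z, 1:]) \<and>
     initial_poly a m (pcompose p [:z, 1:]) \<noteq> 0 \<and> poly (initial_poly a m (pcompose p [:z, 1:])) 0 = 0)"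

lemma pcompose_shift_shift:
  "pcompose (pcompose p [:z, 1:]) [:d, 1:] = pcompose p [:z + d, 1 :: 'a::comm_ring_1:]"
  by (simp add: pcompose_assoc[symmetric] pcompose_pCons)

lemma newton_step_cong:
  assumes "newton_step p z a" "\<And>b. b \<le> a \<Longrightarrow> hcoeff z b = hcoeff z' b"
  shows "newton_step p z' a"
proof -
  obtain m where m: "poly_supp_ge a m (pcompose p [:z, 1:])"
    "initial_poly a m (pcompose p [:z, 1:]) \<noteq> 0" "poly (initial_poly a m (pcompose p [:z, 1:])) 0 = 0"
    using assms(1) unfolding newton_step_def by blast
  have d: "supp_ge a (z' - z)" "hcoeff (z' - z) a = 0"
    using assms(2) by (auto simp: supp_ge_def) (metis linorder_le_cases)
  have "pcompose (pcompose p [:z, 1:]) [:z' - z, 1:] = pcompose p [:z', 1:]"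
    unfolding pcompose_shift_shift by simp
  moreover have "pcompose q [:0, 1:] = q" for q :: "'a poly" by (induction q) (simp_all add: pcompose_pCons)
  ultimately show ?thesis
    using initial_poly_shift[OF d(1) m(1)] m(2,3) unfolding newton_step_def d(2) by metis
qed

text \<open>\<open>z\<close> is an initial segment of \<open>z'\<close>.\<close>

definition truncation :: "'a::zero hahn \<Rightarrow> 'a hahn \<Rightarrow> bool" where
  "truncation z z' \<longleftrightarrow> (\<forall>a. hcoeff z a \<noteq> 0 \<longrightarrow> (\<forall>b\<le>a. hcoeff z' b = hcoeff z b))"

lemma truncation_refl: "truncation z z"
  by (simp add: truncation_def)

lemma truncation_trans: "truncation x y \<Longrightarrow> truncation y z \<Longrightarrow> truncation x z"
  unfolding truncation_def by (metis order.refl)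

lemma truncation_antisym: "truncation x y \<Longrightarrow> truncation y x \<Longrightarrow> x = y"
  by (rule hahn_eqI) (metis order.refl truncation_def)

text \<open>The union of the chain has a well-ordered support, because a descending sequence in it stays
  in the series that contains its first exponent.\<close>

lemma truncation_chain_limit:
  fixes C :: "'a::zero hahn set"
  assumes chain: "\<And>x y. x \<in> C \<Longrightarrow> y \<in> C \<Longrightarrow> truncation x y \<or> truncation y x"
  obtains u where "\<And>x. x \<in> C \<Longrightarrow> truncation x u"
    "\<And>a. hcoeff u a \<noteq> 0 \<Longrightarrow> \<exists>x\<in>C. hcoeff x a \<noteq> 0"
proof -
  define f where "f a = (if \<exists>x\<in>C. hcoeff x a \<noteq> 0 then hcoeff (SOME x. x \<in> C \<and> hcoeff x a \<noteq> 0) a else 0)" for a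
  have f_eq: "f b = hcoeff x b" if x: "x \<in> C" "hcoeff x a \<noteq> 0" "b \<le> a" for x a b
  proof (cases "\<exists>y\<in>C. hcoeff y b \<noteq> 0")
    case False
    thus ?thesis using x by (auto simp: f_def)
  next
    case True
    define y where "y = (SOME y. y \<in> C \<and> hcoeff y b \<noteq> 0)"
    have y: "y \<in> C" "hcoeff y b \<noteq> 0" using someI_ex[of "\<lambda>y. y \<in> C \<and> hcoeff y b \<noteq> 0"] True
      by (auto simp: y_def)
    have "hcoeff y b = hcoeff x b"
      using chain[OF x(1) y(1)] x(2,3) y(2) unfolding truncation_def by (metis order.refl)
    thus ?thesis using True by (simp add: f_def y_def)
  qed
  have wo: "well_ordered_set {a. f a \<noteq> 0}"
    unfolding well_ordered_set_def
  proof (intro allI impI)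
    fix T assume T: "T \<subseteq> {a. f a \<noteq> 0}" "T \<noteq> {}"
    then obtain a where a: "a \<in> T" "f a \<noteq> 0" by blast
    obtain x where x: "x \<in> C" "hcoeff x a \<noteq> 0" using a(2) by (auto simp: f_def split: if_splits)
    define S where "S = {b \<in> T. b \<le> a}"
    have "S \<subseteq> {b. hcoeff x b \<noteq> 0}" using T(1) f_eq[OF x] by (auto simp: S_def)
    moreover have "S \<noteq> {}" using a by (auto simp: S_def)
    moreover have "well_ordered_set {b. hcoeff x b \<noteq> 0}" using hcoeff[of x] by simp
    ultimately obtain m where m: "m \<in> S" "\<forall>b\<in>S. m \<le> b" using well_ordered_setD by metis
    have "m \<le> b" if "b \<in> T" for b
      using m that by (cases "b \<le> a") (auto simp: S_def)
    thus "\<exists>m\<in>T. \<forall>b\<in>T. m \<le> b" using m by (auto simp: S_def)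
  qed
  define u where "u = Abs_hahn f"
  have u: "hcoeff u = f" unfolding u_def using wo by (simp add: Abs_hahn_inverse)
  show ?thesis
  proof (rule that)
    fix x assume "x \<in> C"
    thus "truncation x u" unfolding truncation_def u using f_eq by blast
  next
    fix a assume "hcoeff u a \<noteq> 0"
    thus "\<exists>x\<in>C. hcoeff x a \<noteq> 0" by (auto simp: u f_def split: if_splits)
  qed
qed

text \<open>The number \<open>a\<close> is the largest slope from a vertex of the Newton polygon to the vertex of the
  constant term. The initial polynomial has positive degree and a nonzero constant term, so it has
  a nonzero root \<open>c\<close>, the coefficient of the next term.\<close>

lemma lowest_exponent_of_nonroot:
  fixes p :: "'a::{alg_closed_field} hahn poly"
  assumes deg: "degree p > 0" and lc: "lead_coeff p = 1" and nz: "coeff p 0 \<noteq> 0"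
  obtains a m c where "poly_supp_ge a m p" "c \<noteq> 0" "hcoeff (coeff p 0) m \<noteq> 0" "supp_ge m (coeff p 0)"
    "initial_poly a m p \<noteq> 0" "poly (initial_poly a m p) c = 0"
    "\<And>i e b. i > 0 \<Longrightarrow> hcoeff (coeff p i) e \<noteq> 0 \<Longrightarrow> e + real i * b < m \<Longrightarrow> b < a"
proof -
  define ord where "ord x = (SOME e. hcoeff x e \<noteq> 0 \<and> supp_ge e x)" for x :: "'a hahn"
  have ord: "hcoeff x (ord x) \<noteq> 0" "supp_ge (ord x) x" if "x \<noteq> 0" for x
    using someI_ex[of "\<lambda>e. hcoeff x e \<noteq> 0 \<and> supp_ge e x"] hahn_lowest_exponent[OF that]
    unfolding ord_def by blast+
  define m where "m = ord (coeff p 0)"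
  define I where "I = {i. i > 0 \<and> i \<le> degree p \<and> coeff p i \<noteq> 0}"
  define s where "s i = (m - ord (coeff p i)) / real i" for i
  have I: "finite I" "I \<noteq> {}" using deg lc by (auto simp: I_def intro!: exI[of _ "degree p"])
  define a where "a = Max (s ` I)"
  have sa: "s i \<le> a" if "i \<in> I" for i using that I by (simp add: a_def)
  have "a \<in> s ` I" unfolding a_def using I by (intro Max_in) auto
  then obtain j where j: "j \<in> I" "s j = a" by blast
  have ordI: "m - real i * a \<le> ord (coeff p i)" if "i > 0" "coeff p i \<noteq> 0" for i
  proof -
    have "i \<in> I" using that le_degree by (auto simp: I_def)
    hence "(m - ord (coeff p i)) / real i \<le> a" using sa[of i] by (simp add: s_def)
    hence "m - ord (coeff p i) \<le> a * real i" using that(1) by (simp add: divide_le_eq)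
    thus ?thesis by (simp add: mult.commute)
  qed
  have ge: "poly_supp_ge a m p"
    unfolding poly_supp_ge_def
  proof
    fix i
    show "supp_ge (m - real i * a) (coeff p i)"
    proof (cases "coeff p i = 0 \<or> i = 0")
      case True
      thus ?thesis using ord(2)[OF nz] by (auto simp: m_def)
    next
      case False
      thus ?thesis using supp_ge_mono[OF ord(2)[of "coeff p i"] ordI[of i]] by simp
    qed
  qed
  have "j > 0" "coeff p j \<noteq> 0" using j by (auto simp: I_def)
  hence "m - real j * a = ord (coeff p j)" using j(2) by (auto simp: s_def field_simps)
  hence cj: "coeff (initial_poly a m p) j \<noteq> 0"
    using ord(1)[OF \<open>coeff p j \<noteq> 0\<close>] by (simp add: initial_poly.rep_eq)
  hence "degree (initial_poly a m p) > 0" using \<open>j > 0\<close> le_degree by fastforce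
  then obtain c where c: "poly (initial_poly a m p) c = 0" using alg_closed_imp_poly_has_root by blast
  have "coeff (initial_poly a m p) 0 \<noteq> 0" using ord(1)[OF nz] by (simp add: initial_poly.rep_eq m_def)
  hence "c \<noteq> 0" using c by (metis poly_0_coeff_0)
  show ?thesis
  proof (rule that[OF ge \<open>c \<noteq> 0\<close> _ _ _ c])
    fix i e b assume h: "i > 0" "hcoeff (coeff p i) e \<noteq> 0" "e + real i * b < m"
    hence nzi: "coeff p i \<noteq> 0" by auto
    have "m - real i * a \<le> e" using ordI[OF h(1) nzi] ord(2)[OF nzi] h(2) by (auto simp: supp_ge_def)
    hence "real i * b < real i * a" using h(3) by linarith
    thus "b < a" using h(1) by simp
  qed (use ord[OF nz] cj in \<open>auto simp: m_def\<close>)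
qed

text \<open>With the preceding lemma this places the exponent of the next term above all earlier ones.\<close>

lemma newton_step_exponent_less:
  fixes p :: "'a::{comm_ring_1} hahn poly"
  assumes "newton_step p z b"
  obtains i e m where "i > 0" "hcoeff (coeff (pcompose p [:z, 1:]) i) e \<noteq> 0" "e + real i * b = m"
    "\<And>a. a \<le> m \<Longrightarrow> hcoeff (coeff (pcompose p [:z, 1:]) 0) a = 0"
proof -
  let ?p = "pcompose p [:z, 1:]"
  obtain m where m: "poly_supp_ge b m ?p" "initial_poly b m ?p \<noteq> 0" "poly (initial_poly b m ?p) 0 = 0"
    using assms unfolding newton_step_def by blast
  obtain i where i: "coeff (initial_poly b m ?p) i \<noteq> 0" using m(2) by (meson leading_coeff_0_iff)
  have c0: "coeff (initial_poly b m ?p) 0 = 0" using m(3) by (simp add: poly_0_coeff_0)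
  hence "i > 0" using i by (cases i) auto
  show ?thesis
  proof (rule that[OF \<open>i > 0\<close>])
    show "hcoeff (coeff ?p i) (m - real i * b) \<noteq> 0" using i by (simp add: initial_poly.rep_eq)
    show "m - real i * b + real i * b = m" by simp
    fix a assume "a \<le> m"
    moreover have "hcoeff (coeff ?p 0) m = 0" using c0 by (simp add: initial_poly.rep_eq)
    moreover have "supp_ge m (coeff ?p 0)" using m(1) unfolding poly_supp_ge_def by (metis diff_zero mult_zero_left of_nat_0)
    ultimately show "hcoeff (coeff ?p 0) a = 0" by (metis order_le_less supp_geD)
  qed
qed

text \<open>A series all of whose exponents are Newton steps, maximal under truncation, is a root: otherwise
  one more term could be appended.\<close>

theorem hahn_poly_has_root:
  fixes p :: "'a::{alg_closed_field} hahn poly"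
  assumes deg: "degree p > 0" and lc: "lead_coeff p = 1"
  shows "\<exists>z. poly p z = 0"
proof -
  define A where "A = {z. \<forall>a. hcoeff z a \<noteq> 0 \<longrightarrow> newton_step p z a}"
  have "\<exists>z\<in>A. \<forall>x\<in>A. truncation z x \<longrightarrow> x = z"
  proof (rule predicate_Zorn)
    show "partial_order_on A (relation_of truncation A)"
      by (rule partial_order_on_relation_ofI) (use truncation_refl truncation_trans truncation_antisym in blast)+
    fix C assume C: "C \<in> Chains (relation_of truncation A)"
    have chain: "truncation x y \<or> truncation y x" if "x \<in> C" "y \<in> C" for x y
      using that C by (auto simp: Chains_def relation_of_def)
    have CA: "C \<subseteq> A" using C by (auto simp: Chains_def relation_of_def)
    obtain u where u: "\<And>x. x \<in> C \<Longrightarrow> truncation x u" "\<And>a. hcoeff u a \<noteq> 0 \<Longrightarrow> \<exists>x\<in>C. hcoeff x a \<noteq> 0"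
      using truncation_chain_limit[OF chain] by metis
    have "newton_step p u a" if ua: "hcoeff u a \<noteq> 0" for a
    proof -
      obtain x where x: "x \<in> C" "hcoeff x a \<noteq> 0" using u(2)[OF ua] by blast
      hence "newton_step p x a" using CA by (auto simp: A_def)
      thus ?thesis using u(1)[OF x(1)] x(2) by (elim newton_step_cong) (auto simp: truncation_def)
    qed
    thus "\<exists>u\<in>A. \<forall>a\<in>C. truncation a u" using u(1) by (auto simp: A_def)
  qed
  then obtain z where z: "z \<in> A" and max: "\<And>x. x \<in> A \<Longrightarrow> truncation z x \<Longrightarrow> x = z" by blast
  show ?thesis
  proof (rule ccontr)
    assume no: "\<nexists>z. poly p z = 0"
    let ?p = "pcompose p [:z, 1:]"
    have deg': "degree ?p = degree p" by (simp add: degree_pcompose)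
    have c0: "coeff ?p 0 = poly p z" by (simp add: poly_0_coeff_0[symmetric] poly_pcompose)
    have "lead_coeff ?p = 1" using lc deg by (subst lead_coeff_comp) auto
    then obtain a m c where am: "poly_supp_ge a m ?p" "c \<noteq> 0" "hcoeff (coeff ?p 0) m \<noteq> 0"
      "supp_ge m (coeff ?p 0)" "initial_poly a m ?p \<noteq> 0" "poly (initial_poly a m ?p) c = 0"
      "\<And>i e b. i > 0 \<Longrightarrow> hcoeff (coeff ?p i) e \<noteq> 0 \<Longrightarrow> e + real i * b < m \<Longrightarrow> b < a"
      using lowest_exponent_of_nonroot[of ?p] deg deg' no c0 by metis
    have less: "b < a" if "hcoeff z b \<noteq> 0" for b
    proof -
      have "newton_step p z b" using z that by (simp add: A_def)
      then obtain i e m' where i: "i > 0" "hcoeff (coeff ?p i) e \<noteq> 0" "e + real i * b = m'"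
        "\<And>a. a \<le> m' \<Longrightarrow> hcoeff (coeff ?p 0) a = 0"
        by (rule newton_step_exponent_less) blast
      have "m' < m" using i(4)[of m] am(3) by linarith
      thus ?thesis using am(7)[OF i(1,2)] i(3) by simp
    qed
    define z' where "z' = z + hmonom c a"
    have z': "hcoeff z' b = hcoeff z b" if "b < a" for b
      using that by (simp add: z'_def hcoeff_hmonom)
    have ext: "truncation z z'" unfolding truncation_def using less z' by force
    have "newton_step p z' b" if b: "hcoeff z' b \<noteq> 0" for b
    proof (cases "b = a")
      case True
      have d: "supp_ge a (hmonom c a)" "hcoeff (hmonom c a) a = c"
        by (auto simp: supp_ge_def hcoeff_hmonom)
      have eq: "pcompose ?p [:hmonom c a, 1:] = pcompose p [:z', 1:]"
        unfolding pcompose_shift_shift z'_def ..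
      have "initial_poly a m (pcompose p [:z', 1:]) = pcompose (initial_poly a m ?p) [:c, 1:]"
        "poly_supp_ge a m (pcompose p [:z', 1:])"
        using initial_poly_shift[OF d(1) am(1)] d(2) eq by auto
      moreover have "pcompose (initial_poly a m ?p) [:c, 1:] \<noteq> 0"
        using am(5) by (simp add: pcompose_eq_0_iff)
      ultimately show ?thesis using am(6) True unfolding newton_step_def
        by (intro exI[of _ m]) (simp add: poly_pcompose)
    next
      case False
      hence "hcoeff z b \<noteq> 0" using b by (simp add: z'_def hcoeff_hmonom)
      hence "newton_step p z b" "b < a" using z less by (auto simp: A_def)
      thus ?thesis using z' by (elim newton_step_cong) simp
    qed
    hence "z' = z" using max ext by (simp add: A_def)
    hence "hcoeff (hmonom c a) a = 0" by (simp add: z'_def)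
    thus False using am(2) by (simp add: hcoeff_hmonom)
  qed
qed

lemma monic_splits_if_roots:
  fixes p :: "'a::idom poly"
  assumes root: "\<And>q :: 'a poly. degree q > 0 \<Longrightarrow> lead_coeff q = 1 \<Longrightarrow> \<exists>z. poly q z = 0"
    and "lead_coeff p = 1"
  shows "\<exists>ys. length ys = degree p \<and> p = (\<Prod>y\<leftarrow>ys. [:- y, 1:])"
  using assms(2)
proof (induction "degree p" arbitrary: p)
  case 0
  then obtain c where "p = [:c:]" by (metis degree_eq_zeroE)
  thus ?case using 0 by (intro exI[of _ "[]"]) auto
next
  case (Suc n)
  obtain z where "poly p z = 0" using root[of p] Suc by auto
  then obtain q where q: "p = [:- z, 1:] * q" using poly_eq_0_iff_dvd by (metis dvdE)
  have "q \<noteq> 0" using q Suc.hyps(2) by auto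
  hence deg: "degree p = Suc (degree q)" unfolding q by (subst degree_mult_eq) auto
  moreover have "lead_coeff q = 1" using Suc.prems unfolding q lead_coeff_mult by simp
  ultimately obtain ys where "length ys = degree q" "q = (\<Prod>y\<leftarrow>ys. [:- y, 1:])"
    using Suc.hyps(1)[of q] Suc.hyps(2) by auto
  thus ?case using q deg by (intro exI[of _ "z # ys"]) auto
qed

text \<open>If \<open>y\<close> had negative order, \<open>y\<^sup>n\<close> would be the only summand of \<open>p(y)\<close> of lowest order.\<close>

lemma hahn_root_supp_ge_0:
  fixes p :: "'a::idom hahn poly"
  assumes lc: "lead_coeff p = 1" and ge: "\<And>i. supp_ge 0 (coeff p i)" and y: "poly p y = 0"
  shows "supp_ge 0 y"
proof (rule ccontr)
  assume not: "\<not> supp_ge 0 y"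
  hence "y \<noteq> 0" by auto
  then obtain m where m: "hcoeff y m \<noteq> 0" "supp_ge m y" by (rule hahn_lowest_exponent)
  have "m < 0" using not m supp_ge_mono by (meson not_less)
  let ?n = "degree p"
  have low: "hcoeff (coeff p i * y ^ i) (real ?n * m) = 0" if "i < ?n" for i
  proof -
    have "supp_ge (0 + real i * m) (coeff p i * y ^ i)"
      by (intro supp_ge_mult ge supp_ge_power m)
    moreover have "real ?n * m < 0 + real i * m" using that \<open>m < 0\<close> by simp
    ultimately show ?thesis by (rule supp_geD)
  qed
  have "hcoeff (poly p y) (real ?n * m) = (\<Sum>i\<le>?n. hcoeff (coeff p i * y ^ i) (real ?n * m))"
    by (simp add: poly_altdef hcoeff_sum)
  also have "\<dots> = hcoeff (coeff p ?n * y ^ ?n) (real ?n * m)"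
    by (rule sum.remove[where x = ?n, THEN trans]) (auto simp: low)
  also have "\<dots> = hcoeff y m ^ ?n" using lc m by (simp add: hcoeff_power_lowest)
  finally show False using y m by simp
qed

section \<open>Derivations\<close>

definition additive_fun :: "('a::ab_group_add \<Rightarrow> 'b::ab_group_add) \<Rightarrow> bool" where
  "additive_fun l \<longleftrightarrow> (\<forall>x y. l (x + y) = l x + l y)"

lemma additive_fun_0: "additive_fun l \<Longrightarrow> l 0 = 0"
  unfolding additive_fun_def by (metis add_cancel_right_left add_0)

text \<open>The derivation \<open>t\<^sup>a \<mapsto> l(a) t\<^sup>a\<close>; the Leibniz rule is additivity of \<open>l\<close>.\<close>

lift_definition hderiv :: "(real \<Rightarrow> rat) \<Rightarrow> 'a::field_char_0 hahn \<Rightarrow> 'a hahn"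
  is "\<lambda>l f a. of_rat (l a) * f a"
  by (erule well_ordered_set_subset) auto

lemma hcoeff_hderiv [simp]: "hcoeff (hderiv l x) a = of_rat (l a) * hcoeff x a"
  by transfer simp

lemma hderiv_add: "hderiv l (x + y) = hderiv l x + hderiv l y"
  by (rule hahn_eqI) (simp add: algebra_simps)

lemma hderiv_0 [simp]: "hderiv l 0 = 0"
  by (rule hahn_eqI) simp

lemma supp_ge_hderiv: "supp_ge r x \<Longrightarrow> supp_ge r (hderiv l x)"
  by (auto simp: supp_ge_def)

lemma hderiv_mult:
  assumes "additive_fun l"
  shows "hderiv l (x * y) = hderiv l x * y + x * hderiv l y"
proof (rule hahn_eqI)
  fix c
  let ?A = "{a. hcoeff x a \<noteq> 0}" let ?B = "{a. hcoeff y a \<noteq> 0}"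
  have wo: "well_ordered_set ?A" "well_ordered_set ?B" using hcoeff[of x] hcoeff[of y] by auto
  have 1: "hcoeff (x * y) c = (\<Sum>(a, b)\<in>sum_pairs ?A ?B c. hcoeff x a * hcoeff y b)"
    by (simp add: times_hahn.rep_eq hconv_def)
  have 2: "hcoeff (hderiv l x * y) c = (\<Sum>(a, b)\<in>sum_pairs ?A ?B c. hcoeff (hderiv l x) a * hcoeff y b)"
    unfolding times_hahn.rep_eq by (rule hconv_eq[OF wo]) auto
  have 3: "hcoeff (x * hderiv l y) c = (\<Sum>(a, b)\<in>sum_pairs ?A ?B c. hcoeff x a * hcoeff (hderiv l y) b)"
    unfolding times_hahn.rep_eq by (rule hconv_eq[OF wo]) auto
  have "of_rat (l c) * (\<Sum>(a, b)\<in>sum_pairs ?A ?B c. hcoeff x a * hcoeff y b) =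
      (\<Sum>(a, b)\<in>sum_pairs ?A ?B c. hcoeff (hderiv l x) a * hcoeff y b + hcoeff x a * hcoeff (hderiv l y) b)"
    unfolding sum_distrib_left
  proof (rule sum.cong[OF refl], clarify)
    fix a b assume "(a, b) \<in> sum_pairs ?A ?B c"
    hence "l c = l a + l b" using assms by (auto simp: sum_pairs_def additive_fun_def)
    thus "of_rat (l c) * (hcoeff x a * hcoeff y b) =
      hcoeff (hderiv l x) a * hcoeff y b + hcoeff x a * hcoeff (hderiv l y) b"
      by (simp add: of_rat_add algebra_simps)
  qed
  thus "hcoeff (hderiv l (x * y)) c = hcoeff (hderiv l x * y + x * hderiv l y) c"
    by (simp add: 1 2 3 sum.distrib case_prod_unfold)
qed

lemma hderiv_poly:
  assumes "additive_fun l"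
  shows "hderiv l (poly p y) = poly (map_poly (hderiv l) p) y + poly (pderiv p) y * hderiv l y"
proof (induction p)
  case (pCons a p)
  have "map_poly (hderiv l) (pCons a p) = pCons (hderiv l a) (map_poly (hderiv l) p)"
    by (rule poly_eqI) (auto simp: coeff_map_poly coeff_pCons split: nat.splits)
  thus ?case
    by (simp add: pderiv_pCons hderiv_add hderiv_mult[OF assms] pCons.IH algebra_simps)
qed simp

section \<open>Weights\<close>

definition wdot :: "('d::finite \<Rightarrow> real) \<Rightarrow> ('d \<Rightarrow> rat) \<Rightarrow> real" where
  "wdot w \<alpha> = (\<Sum>i\<in>UNIV. of_rat (\<alpha> i) * w i)"

lemma wdot_add: "wdot w (\<alpha> + \<beta>) = wdot w \<alpha> + wdot w \<beta>"
  by (simp add: wdot_def of_rat_add distrib_right sum.distrib)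

lemma wdot_diff: "wdot w (\<alpha> - \<beta>) = wdot w \<alpha> - wdot w \<beta>"
  by (simp add: wdot_def of_rat_diff left_diff_distrib sum_subtractf)

lemma wdot_0 [simp]: "wdot w 0 = 0" "wdot w (\<lambda>_. 0) = 0"
  by (simp_all add: wdot_def)

definition weight :: "('d::finite \<Rightarrow> real) \<Rightarrow> bool" where
  "weight w \<longleftrightarrow> (\<forall>i. w i > 0) \<and> (\<forall>\<alpha>. wdot w \<alpha> = 0 \<longrightarrow> \<alpha> = 0)"

lemma weightD: "weight w \<Longrightarrow> w i > 0" "weight w \<Longrightarrow> wdot w \<alpha> = wdot w \<beta> \<Longrightarrow> \<alpha> = \<beta>"
  unfolding weight_def using wdot_diff[of w \<alpha> \<beta>] by (auto simp: fun_eq_iff)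

lemma wdot_nonneg:
  assumes "weight w" "\<And>i. 0 \<le> \<alpha> i" shows "0 \<le> wdot w \<alpha>"
  unfolding wdot_def by (intro sum_nonneg mult_nonneg_nonneg) (use assms weightD(1)[of w] in \<open>auto intro: less_imp_le\<close>)

lemma wdot_mono:
  assumes "weight w" "\<alpha> \<le> \<beta>" shows "wdot w \<alpha> \<le> wdot w \<beta>"
  using wdot_nonneg[OF assms(1), of "\<beta> - \<alpha>"] assms(2) by (simp add: wdot_diff le_fun_def)

text \<open>Choose the weights one at a time, each outside the countable rational span of the others.\<close>

lemma weight_exists: "\<exists>w :: 'd::finite \<Rightarrow> real. weight w"
proof -
  have "\<exists>w :: 'd \<Rightarrow> real. (\<forall>i. w i > 0) \<and> (\<forall>\<alpha>. (\<forall>i. i \<notin> A \<longrightarrow> \<alpha> i = 0) \<longrightarrow> wdot w \<alpha> = 0 \<longrightarrow> \<alpha> = 0)"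
    if "finite A" for A :: "'d set"
    using that
  proof (induction A)
    case empty
    thus ?case by (intro exI[of _ "\<lambda>_. 1"]) (auto simp: fun_eq_iff)
  next
    case (insert x A)
    then obtain w where w: "\<And>i. w i > 0"
      "\<And>\<alpha>. (\<forall>i. i \<notin> A \<longrightarrow> \<alpha> i = 0) \<Longrightarrow> wdot w \<alpha> = 0 \<Longrightarrow> \<alpha> = 0" by metis
    have "countable (range (wdot w))" by (rule countable_image) simp
    moreover have "uncountable {0<..<(1::real)}" by (simp add: uncountable_open_interval)
    ultimately obtain r where r: "r \<in> {0<..<1}" "r \<notin> range (wdot w)"
      by (meson countable_subset subsetI)
    define v where "v = w(x := r)"
    have "\<alpha> = 0" if \<alpha>: "\<forall>i. i \<notin> insert x A \<longrightarrow> \<alpha> i = 0" "wdot v \<alpha> = 0" for \<alpha>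
    proof -
      define \<beta> where "\<beta> = \<alpha>(x := 0)"
      have "wdot v \<alpha> = of_rat (\<alpha> x) * r + (\<Sum>i\<in>UNIV - {x}. of_rat (\<alpha> i) * v i)"
        unfolding wdot_def by (subst sum.remove[of _ x]) (auto simp: v_def)
      also have "(\<Sum>i\<in>UNIV - {x}. of_rat (\<alpha> i) * v i) = (\<Sum>i\<in>UNIV - {x}. of_rat (\<beta> i) * w i)"
        by (rule sum.cong) (auto simp: v_def \<beta>_def)
      also have "\<dots> = wdot w \<beta>"
        unfolding wdot_def by (subst sum.remove[of UNIV x]) (auto simp: \<beta>_def)
      finally have eq: "of_rat (\<alpha> x) * r + wdot w \<beta> = 0" using \<alpha> by simp
      have "\<alpha> x = 0"
      proof (rule ccontr)
        assume nz: "\<alpha> x \<noteq> 0"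
        have "r = of_rat (- 1 / \<alpha> x) * wdot w \<beta>"
          using eq nz by (simp add: of_rat_divide of_rat_minus field_simps)
        also have "\<dots> = wdot w (\<lambda>i. - 1 / \<alpha> x * \<beta> i)"
          unfolding wdot_def sum_distrib_left of_rat_mult by (simp add: mult.assoc)
        finally show False using r(2) by blast
      qed
      hence "\<alpha> = \<beta>" "wdot w \<beta> = 0" using eq by (auto simp: \<beta>_def)
      moreover have "\<forall>i. i \<notin> A \<longrightarrow> \<beta> i = 0" using \<alpha>(1) by (auto simp: \<beta>_def)
      ultimately show ?thesis using w(2) by metis
    qed
    moreover have "\<forall>i. v i > 0" using w(1) r(1) by (auto simp: v_def)
    ultimately show ?case by blast
  qed
  from this[of UNIV] show ?thesis by (auto simp: weight_def)
qed

lemma weight_scale: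
  assumes "weight w" "\<And>i. q i > 0"
  shows "weight (\<lambda>i. of_rat (q i) * w i)"
  unfolding weight_def
proof (intro conjI allI impI)
  fix i show "0 < of_rat (q i) * w i" using assms weightD(1)[of w i] by simp
next
  fix \<alpha> assume "wdot (\<lambda>i. of_rat (q i) * w i) \<alpha> = 0"
  hence "wdot w (\<lambda>i. \<alpha> i * q i) = 0" by (simp add: wdot_def of_rat_mult mult.assoc)
  hence "(\<lambda>i. \<alpha> i * q i) = 0" using assms(1) by (simp add: weight_def)
  moreover have "q i \<noteq> 0" for i using assms(2)[of i] by simp
  ultimately show "\<alpha> = 0" by (auto simp: fun_eq_iff)
qed

text \<open>Componentwise comparison is comparison with respect to all weights: let one weight grow.\<close>

lemma le_if_wdot_le:
  fixes \<alpha> \<beta> :: "'d::finite \<Rightarrow> rat"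
  assumes "\<And>w. weight w \<Longrightarrow> wdot w \<alpha> \<le> wdot w \<beta>"
  shows "\<alpha> \<le> \<beta>"
proof (rule le_funI, rule ccontr)
  fix i assume "\<not> \<alpha> i \<le> \<beta> i"
  hence neg: "\<beta> i - \<alpha> i < 0" by simp
  obtain w :: "'d \<Rightarrow> real" where w: "weight w" using weight_exists by blast
  define \<gamma> where "\<gamma> = \<beta> - \<alpha>"
  define R where "R = (\<Sum>j\<in>UNIV - {i}. of_rat (\<gamma> j) * w j)"
  define c where "c = real_of_rat (- \<gamma> i) * w i"
  have "c > 0" using neg weightD(1)[OF w, of i] by (simp add: c_def \<gamma>_def)
  then obtain N :: nat where N: "R < real N * c" using ex_less_of_nat_mult by blast
  define q where "q j = (if j = i then of_nat (Suc N) else 1 :: rat)" for j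
  have wt: "weight (\<lambda>j. of_rat (q j) * w j)" by (rule weight_scale[OF w]) (simp add: q_def)
  have "0 \<le> wdot (\<lambda>j. of_rat (q j) * w j) \<gamma>"
    using assms[OF wt] by (simp add: \<gamma>_def wdot_diff)
  also have "\<dots> = of_rat (\<gamma> i) * (real (Suc N) * w i) + (\<Sum>j\<in>UNIV - {i}. of_rat (\<gamma> j) * (of_rat (q j) * w j))"
    unfolding wdot_def by (subst sum.remove[of _ i]) (auto simp: q_def of_rat_add)
  also have "(\<Sum>j\<in>UNIV - {i}. of_rat (\<gamma> j) * (of_rat (q j) * w j)) = R"
    unfolding R_def by (rule sum.cong) (auto simp: q_def)
  also have "of_rat (\<gamma> i) * (real (Suc N) * w i) = - real (Suc N) * c"
    by (simp add: c_def of_rat_minus algebra_simps)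
  finally show False using N \<open>c > 0\<close> by (simp add: algebra_simps)
qed

interpretation real_over_rat: vector_space "\<lambda>q x. real_of_rat q * x"
  by unfold_locales (auto simp: algebra_simps of_rat_add of_rat_mult)

interpretation rat_over_rat: vector_space "(*) :: rat \<Rightarrow> rat \<Rightarrow> rat"
  by unfold_locales (auto simp: algebra_simps)

interpretation real_rat_pair: vector_space_pair "\<lambda>q x. real_of_rat q * x" "(*) :: rat \<Rightarrow> rat \<Rightarrow> rat"
  by unfold_locales

lemma rational_functional_exists:
  assumes fin: "finite B" and ind: "\<And>u. (\<Sum>b\<in>B. real_of_rat (u b) * b) = 0 \<Longrightarrow> \<forall>b\<in>B. u b = 0"
  shows "\<exists>l :: real \<Rightarrow> rat. additive_fun l \<and> (\<forall>q x. l (real_of_rat q * x) = q * l x) \<and> (\<forall>b\<in>B. l b = g b)"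
proof -
  have "real_over_rat.independent B"
    using ind by (auto simp: real_over_rat.dependent_finite[OF fin])
  then obtain l where l: "Vector_Spaces.linear (\<lambda>q x. real_of_rat q * x) (*) l" "\<forall>b\<in>B. l b = g b"
    using real_rat_pair.linear_independent_extend[of B g] by blast
  interpret Vector_Spaces.linear "\<lambda>q x. real_of_rat q * x" "(*) :: rat \<Rightarrow> rat \<Rightarrow> rat" l by (rule l(1))
  show ?thesis using l(2) add scale by (auto simp: additive_fun_def intro!: exI[of _ l])
qed

lemma additive_fun_sum:
  "additive_fun l \<Longrightarrow> l (sum f A) = (\<Sum>i\<in>A. l (f i))"
  by (induction A rule: infinite_finite_induct) (auto simp: additive_fun_0 additive_fun_def)

lemma inj_weight: "weight w \<Longrightarrow> inj w"
proof (rule injI, rule ccontr)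
  fix i j assume w: "weight w" and eq: "w i = w j" and ne: "i \<noteq> j"
  define \<alpha> where "\<alpha> = (\<lambda>k. if k = i then 1 else 0 :: rat)"
  define \<beta> where "\<beta> = (\<lambda>k. if k = j then 1 else 0 :: rat)"
  have d: "(\<Sum>k\<in>UNIV. real_of_rat (if k = m then 1 else 0) * w k) = w m" for m
    by (subst sum.remove[of _ m]) (auto intro!: sum.neutral)
  have "wdot w \<alpha> = wdot w \<beta>" unfolding wdot_def \<alpha>_def \<beta>_def d by (rule eq)
  hence "\<alpha> = \<beta>" using w weightD(2) by blast
  thus False using ne unfolding \<alpha>_def \<beta>_def by (metis zero_neq_one)
qed

lemma coordinate_functional:
  assumes w: "weight w"
  obtains l where "additive_fun l" "\<And>\<alpha>. l (wdot w \<alpha>) = \<alpha> i"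
proof -
  have inj: "inj w" by (rule inj_weight[OF w])
  have ind: "\<forall>b\<in>range w. u b = 0" if "(\<Sum>b\<in>range w. real_of_rat (u b) * b) = 0" for u
  proof -
    have "wdot w (\<lambda>i. u (w i)) = 0" using that inj by (simp add: wdot_def sum.reindex)
    hence "(\<lambda>i. u (w i)) = 0" using w by (simp add: weight_def)
    thus ?thesis by (auto simp: fun_eq_iff)
  qed
  obtain l :: "real \<Rightarrow> rat" where l: "additive_fun l" "\<And>q x. l (real_of_rat q * x) = q * l x"
    "\<And>b. b \<in> range w \<Longrightarrow> l b = (if b = w i then 1 else 0)"
    using rational_functional_exists[OF _ ind, of "\<lambda>b. if b = w i then 1 else 0"] by auto
  have "l (wdot w \<alpha>) = \<alpha> i" for \<alpha>
  proof -
    have "l (wdot w \<alpha>) = (\<Sum>j\<in>UNIV. \<alpha> j * (if j = i then 1 else 0))"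
      using inj by (simp add: wdot_def additive_fun_sum[OF l(1)] l(2,3) inj_eq)
    also have "\<dots> = \<alpha> i" by (subst sum.remove[of _ i]) (auto intro!: sum.neutral)
    finally show ?thesis .
  qed
  thus ?thesis using that l(1) by blast
qed

lemma separating_functional:
  assumes w: "weight w" and a: "a \<notin> range (wdot w)"
  obtains l :: "real \<Rightarrow> rat" where "additive_fun l" "\<And>\<alpha>. l (wdot w \<alpha>) = 0" "l a \<noteq> 0"
proof -
  have inj: "inj w" by (rule inj_weight[OF w])
  have aw: "a \<notin> range w"
  proof
    assume "a \<in> range w"
    then obtain j where j: "a = w j" by blast
    have "wdot w (\<lambda>k. if k = j then 1 else 0) = w j"
      unfolding wdot_def by (subst sum.remove[of _ j]) (auto intro!: sum.neutral)
    thus False using a j by (metis rangeI)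
  qed
  have ind: "\<forall>b\<in>insert a (range w). u b = 0"
    if "(\<Sum>b\<in>insert a (range w). real_of_rat (u b) * b) = 0" for u
  proof -
    have eq: "real_of_rat (u a) * a + wdot w (\<lambda>i. u (w i)) = 0"
      using that inj aw by (simp add: wdot_def sum.reindex)
    have ua: "u a = 0"
    proof (rule ccontr)
      assume nz: "u a \<noteq> 0"
      have "a = of_rat (- 1 / u a) * wdot w (\<lambda>i. u (w i))"
        using eq nz by (simp add: of_rat_divide of_rat_minus field_simps)
      also have "\<dots> = wdot w (\<lambda>i. - 1 / u a * u (w i))"
        unfolding wdot_def sum_distrib_left of_rat_mult by (simp add: mult.assoc)
      finally show False using a by blast
    qed
    hence "wdot w (\<lambda>i. u (w i)) = 0" using eq by simp
    hence "(\<lambda>i. u (w i)) = 0" using w by (simp add: weight_def)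
    thus ?thesis using ua by (auto simp: fun_eq_iff)
  qed
  obtain l :: "real \<Rightarrow> rat" where l: "additive_fun l" "\<And>q x. l (real_of_rat q * x) = q * l x"
    "\<And>b. b \<in> insert a (range w) \<Longrightarrow> l b = (if b = a then 1 else 0)"
    using rational_functional_exists[OF _ ind, of "\<lambda>b. if b = a then 1 else 0"]
    by (metis finite finite_imageI finite_insert)
  have "w i \<noteq> a" for i using aw by blast
  hence "l (wdot w \<alpha>) = 0" for \<alpha>
    using l by (simp add: wdot_def additive_fun_sum[OF l(1)])
  moreover have "l a \<noteq> 0" using l(3)[of a] by simp
  ultimately show ?thesis by (rule that[OF l(1)])
qed

section \<open>Weighted substitution\<close>

lemma pcoeff_simps [simp]:
  "pcoeff 0 \<alpha> = 0" "pcoeff (f + g) \<alpha> = pcoeff f \<alpha> + pcoeff g \<alpha>"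
  "pcoeff (f - g) \<alpha> = pcoeff f \<alpha> - pcoeff g \<alpha>" "pcoeff (- f) \<alpha> = - pcoeff f \<alpha>"
  by (transfer; simp)+

lemma pcoeff_1: "pcoeff 1 \<alpha> = (if \<alpha> = 0 then 1 else 0)"
  by transfer simp

lemma pser_supp_grid:
  obtains k where "k > 0" "\<And>\<alpha>. pcoeff f \<alpha> \<noteq> 0 \<Longrightarrow> \<alpha> \<in> grid k"
  using pcoeff[of f] by blast

lemma fracps_supp_nonneg: "pcoeff f \<alpha> \<noteq> 0 \<Longrightarrow> 0 \<le> \<alpha>"
  by (rule pser_supp_grid[of f]) (auto simp: le_fun_def intro: grid_nonneg)

lemma finite_wdot_grid_le:
  fixes w :: "'d::finite \<Rightarrow> real"
  assumes w: "\<And>i. w i > 0" and k: "k > 0"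
  shows "finite {\<alpha> \<in> grid k. wdot w \<alpha> \<le> t}"
proof -
  define c where "c = Min (range w)"
  have c: "c > 0" "c \<le> w i" for i using w by (auto simp: c_def)
  obtain M :: nat where M: "t / c < real M" using reals_Archimedean2 by blast
  define \<gamma> where "\<gamma> = (\<lambda>_ :: 'd. of_nat M :: rat)"
  have \<gamma>: "\<gamma> \<in> grid k" by (auto simp: \<gamma>_def grid_def simp flip: of_nat_mult)
  have "{\<alpha> \<in> grid k. wdot w \<alpha> \<le> t} \<subseteq> {\<alpha> \<in> grid k. \<forall>i. \<alpha> i \<le> \<gamma> i \<and> \<gamma> \<in> grid k}"
  proof
    fix \<alpha> assume "\<alpha> \<in> {\<alpha> \<in> grid k. wdot w \<alpha> \<le> t}"
    hence \<alpha>: "\<alpha> \<in> grid k" "wdot w \<alpha> \<le> t" by simp_all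
    have nn: "0 \<le> \<alpha> i" for i using grid_nonneg[OF k \<alpha>(1)] by simp
    have "\<alpha> i \<le> \<gamma> i" for i
    proof -
      have "of_rat (\<alpha> i) * w i \<le> wdot w \<alpha>" unfolding wdot_def
        by (rule member_le_sum) (use nn w in \<open>auto intro!: mult_nonneg_nonneg simp: less_imp_le\<close>)
      also note \<alpha>(2)
      also have "t < real M * c" using M c(1) by (simp add: divide_less_eq)
      also have "real M * c \<le> real M * w i" using c(2)[of i] by (simp add: mult_left_mono)
      finally have "real_of_rat (\<alpha> i) < real M" using w[of i] by simp
      also have "real M = real_of_rat (of_nat M)" by simp
      finally have "\<alpha> i < of_nat M" by (simp only: of_rat_less)
      thus ?thesis by (simp add: \<gamma>_def)
    qed
    thus "\<alpha> \<in> {\<alpha> \<in> grid k. \<forall>i. \<alpha> i \<le> \<gamma> i \<and> \<gamma> \<in> grid k}" using \<alpha> \<gamma> by simp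
  qed
  thus ?thesis using finite_grid_below[OF k, of \<gamma>] by (rule finite_subset)
qed

lemma well_ordered_wdot_grid:
  fixes w :: "'d::finite \<Rightarrow> real"
  assumes w: "\<And>i. w i > 0" and k: "k > 0"
  shows "well_ordered_set (wdot w ` grid k)"
  unfolding well_ordered_set_def
proof (intro allI impI)
  fix T assume T: "T \<subseteq> wdot w ` grid k" "T \<noteq> {}"
  then obtain t where t: "t \<in> T" by blast
  have "T \<inter> {..t} \<subseteq> wdot w ` {\<alpha> \<in> grid k. wdot w \<alpha> \<le> t}" using T by blast
  hence fin: "finite (T \<inter> {..t})"
    by (rule finite_subset) (rule finite_imageI[OF finite_wdot_grid_le[OF w k]])
  have ne: "T \<inter> {..t} \<noteq> {}" using t by blast
  have "Min (T \<inter> {..t}) \<in> T" using Min_in[OF fin ne] by blast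
  moreover have "Min (T \<inter> {..t}) \<le> x" if "x \<in> T" for x
  proof (cases "x \<le> t")
    case True
    thus ?thesis using that fin by simp
  next
    case False
    have "Min (T \<inter> {..t}) \<le> t" using t fin by simp
    thus ?thesis using False by linarith
  qed
  ultimately show "\<exists>m\<in>T. \<forall>x\<in>T. m \<le> x" by blast
qed

text \<open>The substitution \<open>X\<^sub>i \<mapsto> t\<^bsup>w i\<^esup>\<close>, injective because the weights are independent over the
  rationals.\<close>

definition wsubst :: "('d::finite \<Rightarrow> real) \<Rightarrow> ('a::comm_ring_1, 'd) fracps \<Rightarrow> 'a hahn" where
  "wsubst w f = Abs_hahn (\<lambda>a. if a \<in> range (wdot w) then pcoeff f (inv_into UNIV (wdot w) a) else 0)"

lemma hcoeff_wsubst: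
  assumes w: "weight w"
  shows "hcoeff (wsubst w f) a = (if a \<in> range (wdot w) then pcoeff f (inv_into UNIV (wdot w) a) else 0)"
proof -
  obtain k where k: "k > 0" "\<And>\<alpha>. pcoeff f \<alpha> \<noteq> 0 \<Longrightarrow> \<alpha> \<in> grid k" using pser_supp_grid by blast
  have "{a. (if a \<in> range (wdot w) then pcoeff f (inv_into UNIV (wdot w) a) else 0) \<noteq> 0} \<subseteq> wdot w ` grid k"
  proof
    fix a assume "a \<in> {a. (if a \<in> range (wdot w) then pcoeff f (inv_into UNIV (wdot w) a) else 0) \<noteq> 0}"
    hence a: "a \<in> range (wdot w)" "pcoeff f (inv_into UNIV (wdot w) a) \<noteq> 0"
      by (simp_all split: if_split_asm)
    have "inv_into UNIV (wdot w) a \<in> grid k" by (rule k(2)[OF a(2)])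
    moreover have "a = wdot w (inv_into UNIV (wdot w) a)" by (rule f_inv_into_f[OF a(1), symmetric])
    ultimately show "a \<in> wdot w ` grid k" unfolding image_def by blast
  qed
  hence "well_ordered_set {a. (if a \<in> range (wdot w) then pcoeff f (inv_into UNIV (wdot w) a) else 0) \<noteq> 0}"
    by (rule well_ordered_set_subset[OF well_ordered_wdot_grid[OF weightD(1)[OF w] k(1)]])
  thus ?thesis unfolding wsubst_def by (subst Abs_hahn_inverse) simp_all
qed

lemma inj_wdot: "weight w \<Longrightarrow> inj (wdot w)"
  by (rule injI) (rule weightD(2))

lemma hcoeff_wsubst_wdot [simp]: "weight w \<Longrightarrow> hcoeff (wsubst w f) (wdot w \<alpha>) = pcoeff f \<alpha>"
  by (simp add: hcoeff_wsubst inj_wdot inv_f_f)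

lemma hcoeff_wsubst_outside: "weight w \<Longrightarrow> a \<notin> range (wdot w) \<Longrightarrow> hcoeff (wsubst w f) a = 0"
  by (simp add: hcoeff_wsubst)

lemma hcoeff_wsubst_nonzero:
  assumes "weight w" "hcoeff (wsubst w f) a \<noteq> 0"
  obtains \<alpha> where "a = wdot w \<alpha>" "pcoeff f \<alpha> \<noteq> 0"
proof -
  have "a \<in> range (wdot w)" using assms hcoeff_wsubst_outside by blast
  then obtain \<alpha> where "a = wdot w \<alpha>" by (rule imageE)
  thus ?thesis using assms that[of \<alpha>] by simp
qed

lemma hahn_eq_wsubstI:
  assumes "weight w" "\<And>\<alpha>. hcoeff x (wdot w \<alpha>) = pcoeff f \<alpha>" "\<And>a. a \<notin> range (wdot w) \<Longrightarrow> hcoeff x a = 0"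
  shows "x = wsubst w f"
proof (rule hahn_eqI)
  fix a show "hcoeff x a = hcoeff (wsubst w f) a"
  proof (cases "a \<in> range (wdot w)")
    case True
    thus ?thesis using assms by auto
  next
    case False
    thus ?thesis using assms by (simp add: hcoeff_wsubst)
  qed
qed

lemma wsubst_eq_iff: "weight w \<Longrightarrow> wsubst w f = wsubst w g \<longleftrightarrow> f = g"
  by (metis hcoeff_wsubst_wdot pser_eqI)

lemma wsubst_0 [simp]: "weight w \<Longrightarrow> wsubst w 0 = 0"
  by (rule hahn_eq_wsubstI[symmetric]) auto

lemma wsubst_1 [simp]: "weight w \<Longrightarrow> wsubst w 1 = 1"
  by (rule hahn_eq_wsubstI[symmetric])
    (auto simp: hcoeff_1 pcoeff_1 weight_def, metis rangeI wdot_0(1))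

lemma wsubst_add: "weight w \<Longrightarrow> wsubst w (f + g) = wsubst w f + wsubst w g"
  by (rule hahn_eq_wsubstI[symmetric]) (simp_all add: hcoeff_wsubst_outside)

lemma wsubst_mult:
  assumes w: "weight w"
  shows "wsubst w (f * g) = wsubst w f * wsubst w g"
proof (rule hahn_eq_wsubstI[OF w, symmetric])
  fix \<gamma>
  let ?S = "{(\<alpha>, \<beta>). \<alpha> + \<beta> = \<gamma> \<and> pcoeff f \<alpha> \<noteq> 0 \<and> pcoeff g \<beta> \<noteq> 0}"
  let ?P = "sum_pairs {a. hcoeff (wsubst w f) a \<noteq> 0} {b. hcoeff (wsubst w g) b \<noteq> 0} (wdot w \<gamma>)"
  have P: "?P = (\<lambda>(\<alpha>, \<beta>). (wdot w \<alpha>, wdot w \<beta>)) ` ?S"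
  proof (intro equalityI subsetI)
    fix p assume "p \<in> ?P"
    then obtain a b where p: "p = (a, b)" "hcoeff (wsubst w f) a \<noteq> 0" "hcoeff (wsubst w g) b \<noteq> 0"
      "a + b = wdot w \<gamma>" by (auto simp: sum_pairs_def)
    obtain \<alpha> \<beta> where "a = wdot w \<alpha>" "pcoeff f \<alpha> \<noteq> 0" "b = wdot w \<beta>" "pcoeff g \<beta> \<noteq> 0"
      using hcoeff_wsubst_nonzero[OF w p(2)] hcoeff_wsubst_nonzero[OF w p(3)] by metis
    moreover from this have "\<alpha> + \<beta> = \<gamma>" using p(4) weightD(2)[OF w] by (metis wdot_add)
    ultimately show "p \<in> (\<lambda>(\<alpha>, \<beta>). (wdot w \<alpha>, wdot w \<beta>)) ` ?S" using p(1) by auto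
  qed (auto simp: sum_pairs_def wdot_add w)
  have inj: "inj_on (\<lambda>(\<alpha>, \<beta>). (wdot w \<alpha>, wdot w \<beta>)) ?S"
    using weightD(2)[OF w] by (auto simp: inj_on_def)
  have "hcoeff (wsubst w f * wsubst w g) (wdot w \<gamma>)
      = (\<Sum>(a, b)\<in>?P. hcoeff (wsubst w f) a * hcoeff (wsubst w g) b)"
    by (simp add: times_hahn.rep_eq hconv_def)
  also have "\<dots> = (\<Sum>(\<alpha>, \<beta>)\<in>?S. pcoeff f \<alpha> * pcoeff g \<beta>)"
    unfolding P by (subst sum.reindex[OF inj]) (simp add: case_prod_unfold w)
  also have "\<dots> = pcoeff (f * g) \<gamma>" by (simp add: times_pser.rep_eq conv_def)
  finally show "hcoeff (wsubst w f * wsubst w g) (wdot w \<gamma>) = pcoeff (f * g) \<gamma>" .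
next
  fix a assume a: "a \<notin> range (wdot w)"
  show "hcoeff (wsubst w f * wsubst w g) a = 0"
  proof (rule ccontr)
    assume "hcoeff (wsubst w f * wsubst w g) a \<noteq> 0"
    hence "a \<in> sumset {a. hcoeff (wsubst w f) a \<noteq> 0} {b. hcoeff (wsubst w g) b \<noteq> 0}"
      using hconv_supp[of "hcoeff (wsubst w f)" "hcoeff (wsubst w g)"] by (auto simp: times_hahn.rep_eq)
    then obtain b c where bc: "a = b + c" "hcoeff (wsubst w f) b \<noteq> 0" "hcoeff (wsubst w g) c \<noteq> 0"
      by (auto simp: sumset_def)
    obtain \<alpha> \<beta> where "b = wdot w \<alpha>" "c = wdot w \<beta>"
      using hcoeff_wsubst_nonzero[OF w bc(2)] hcoeff_wsubst_nonzero[OF w bc(3)] by metis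
    hence "a = wdot w (\<alpha> + \<beta>)" using bc(1) by (simp add: wdot_add)
    thus False using a by blast
  qed
qed

lemma supp_ge_wsubst_iff:
  "weight w \<Longrightarrow> supp_ge r (wsubst w f) \<longleftrightarrow> (\<forall>\<alpha>. pcoeff f \<alpha> \<noteq> 0 \<longrightarrow> r \<le> wdot w \<alpha>)"
  unfolding supp_ge_def by (metis hcoeff_wsubst_nonzero hcoeff_wsubst_wdot)

lemma supp_ge_0_wsubst: "weight w \<Longrightarrow> supp_ge 0 (wsubst w f)"
  by (auto simp: supp_ge_wsubst_iff intro!: wdot_nonneg dest!: fracps_supp_nonneg simp: le_fun_def)

section \<open>Integral exponents\<close>

definition rat_exp :: "('d \<Rightarrow> nat) \<Rightarrow> 'd \<Rightarrow> rat" where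
  "rat_exp \<beta> = (\<lambda>i. of_nat (\<beta> i))"

lemma rat_exp_add: "rat_exp (\<alpha> + \<beta>) = rat_exp \<alpha> + rat_exp \<beta>"
  by (auto simp: rat_exp_def)

lemma rat_exp_0 [simp]: "rat_exp 0 = 0"
  by (auto simp: rat_exp_def)

lemma rat_exp_inject [simp]: "rat_exp \<alpha> = rat_exp \<beta> \<longleftrightarrow> \<alpha> = \<beta>"
  by (auto simp: rat_exp_def fun_eq_iff)

lemma rat_exp_le_iff [simp]: "rat_exp \<alpha> \<le> rat_exp \<beta> \<longleftrightarrow> \<alpha> \<le> \<beta>"
  by (auto simp: rat_exp_def le_fun_def)

lemma pcoeff_embed:
  "pcoeff (embed f) \<alpha> = (if \<forall>i. \<alpha> i \<in> \<nat> then pcoeff f (\<lambda>i. nat \<lfloor>\<alpha> i\<rfloor>) else 0)"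
  by (simp only: embed.rep_eq)

lemma pcoeff_embed_rat_exp [simp]: "pcoeff (embed f) (rat_exp \<beta>) = pcoeff f \<beta>"
  by (simp add: pcoeff_embed rat_exp_def)

lemma Nats_eq_of_nat_floor:
  assumes "(x :: rat) \<in> \<nat>" shows "x = of_nat (nat \<lfloor>x\<rfloor>)"
  using assms by (cases rule: Nats_cases) simp

lemma pcoeff_embed_nonzero:
  assumes "pcoeff (embed f) \<alpha> \<noteq> 0"
  obtains \<beta> where "\<alpha> = rat_exp \<beta>" "pcoeff f \<beta> \<noteq> 0"
proof (rule that)
  have N: "\<forall>i. \<alpha> i \<in> \<nat>" and nz: "pcoeff f (\<lambda>i. nat \<lfloor>\<alpha> i\<rfloor>) \<noteq> 0"
    using assms unfolding pcoeff_embed by (simp_all split: if_split_asm)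
  show "\<alpha> = rat_exp (\<lambda>i. nat \<lfloor>\<alpha> i\<rfloor>)"
    unfolding rat_exp_def by (rule ext, rule Nats_eq_of_nat_floor) (rule N[rule_format])
  show "pcoeff f (\<lambda>i. nat \<lfloor>\<alpha> i\<rfloor>) \<noteq> 0" by (rule nz)
qed

lemma pcoeff_embed_not_range: "\<alpha> \<notin> range rat_exp \<Longrightarrow> pcoeff (embed f) \<alpha> = 0"
  by (rule ccontr, erule pcoeff_embed_nonzero) simp

lemma pser_eq_embedI:
  assumes "\<And>\<beta>. pcoeff x (rat_exp \<beta>) = pcoeff f \<beta>" "\<And>\<alpha>. \<alpha> \<notin> range rat_exp \<Longrightarrow> pcoeff x \<alpha> = 0"
  shows "x = embed f"
proof (rule pser_eqI)
  fix \<alpha> show "pcoeff x \<alpha> = pcoeff (embed f) \<alpha>"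
  proof (cases "\<alpha> \<in> range rat_exp")
    case True
    thus ?thesis using assms(1) by auto
  next
    case False
    thus ?thesis by (simp add: assms(2) pcoeff_embed_not_range)
  qed
qed

lemma embed_0 [simp]: "embed 0 = 0"
  by (rule pser_eq_embedI[symmetric]) auto

lemma embed_1 [simp]: "embed (1 :: ('a::comm_ring_1, 'd::finite) mps) = 1"
proof (rule pser_eq_embedI[symmetric])
  show "pcoeff 1 (rat_exp \<beta>) = pcoeff (1 :: ('a, 'd) mps) \<beta>" for \<beta>
    using rat_exp_inject[of \<beta> 0] by (simp add: pcoeff_1 del: rat_exp_inject)
  show "pcoeff (1 :: ('a, 'd) fracps) \<alpha> = 0" if "\<alpha> \<notin> range rat_exp" for \<alpha>
  proof -
    have "\<alpha> \<noteq> 0" using that rat_exp_0 by (metis rangeI)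
    thus ?thesis by (simp add: pcoeff_1)
  qed
qed

lemma embed_add: "embed (f + g) = embed f + embed g"
  by (rule pser_eq_embedI[symmetric]) (auto simp: pcoeff_embed_not_range)

lemma embed_eq_iff: "embed f = embed g \<longleftrightarrow> f = g"
  by (metis pcoeff_embed_rat_exp pser_eqI)

lemma embed_mult: "embed (f * g) = embed f * embed g"
proof (rule pser_eq_embedI[symmetric])
  fix \<gamma>
  let ?S = "{(\<alpha>, \<beta>). \<alpha> + \<beta> = \<gamma> \<and> pcoeff f \<alpha> \<noteq> 0 \<and> pcoeff g \<beta> \<noteq> 0}"
  let ?P = "{(\<alpha>, \<beta>). \<alpha> + \<beta> = rat_exp \<gamma> \<and> pcoeff (embed f) \<alpha> \<noteq> 0 \<and> pcoeff (embed g) \<beta> \<noteq> 0}"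
  have P: "?P = (\<lambda>(\<alpha>, \<beta>). (rat_exp \<alpha>, rat_exp \<beta>)) ` ?S"
  proof (intro equalityI subsetI)
    fix p assume "p \<in> ?P"
    then obtain a b where p: "p = (a, b)" "pcoeff (embed f) a \<noteq> 0" "pcoeff (embed g) b \<noteq> 0"
      "a + b = rat_exp \<gamma>" by auto
    obtain \<alpha> \<beta> where "a = rat_exp \<alpha>" "pcoeff f \<alpha> \<noteq> 0" "b = rat_exp \<beta>" "pcoeff g \<beta> \<noteq> 0"
      using pcoeff_embed_nonzero[OF p(2)] pcoeff_embed_nonzero[OF p(3)] by metis
    moreover from this have "\<alpha> + \<beta> = \<gamma>" using p(4) by (metis rat_exp_add rat_exp_inject)
    ultimately show "p \<in> (\<lambda>(\<alpha>, \<beta>). (rat_exp \<alpha>, rat_exp \<beta>)) ` ?S" using p(1) by auto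
  qed (auto simp: rat_exp_add)
  have inj: "inj_on (\<lambda>(\<alpha>, \<beta>). (rat_exp \<alpha>, rat_exp \<beta>)) ?S" by (auto simp: inj_on_def)
  have "pcoeff (embed f * embed g) (rat_exp \<gamma>) = (\<Sum>(a, b)\<in>?P. pcoeff (embed f) a * pcoeff (embed g) b)"
    by (simp add: times_pser.rep_eq conv_def)
  also have "\<dots> = (\<Sum>(\<alpha>, \<beta>)\<in>?S. pcoeff f \<alpha> * pcoeff g \<beta>)"
    unfolding P by (subst sum.reindex[OF inj]) (simp add: case_prod_unfold)
  also have "\<dots> = pcoeff (f * g) \<gamma>" by (simp add: times_pser.rep_eq conv_def)
  finally show "pcoeff (embed f * embed g) (rat_exp \<gamma>) = pcoeff (f * g) \<gamma>" .
next
  fix \<gamma> :: "'b \<Rightarrow> rat" assume \<gamma>: "\<gamma> \<notin> range rat_exp"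
  have E: "{(\<alpha>, \<beta>). \<alpha> + \<beta> = \<gamma> \<and> pcoeff (embed f) \<alpha> \<noteq> 0 \<and> pcoeff (embed g) \<beta> \<noteq> 0} = {}"
  proof (intro equals0I)
    fix p assume "p \<in> {(\<alpha>, \<beta>). \<alpha> + \<beta> = \<gamma> \<and> pcoeff (embed f) \<alpha> \<noteq> 0 \<and> pcoeff (embed g) \<beta> \<noteq> 0}"
    then obtain \<alpha> \<beta> where h: "pcoeff (embed f) \<alpha> \<noteq> 0" "pcoeff (embed g) \<beta> \<noteq> 0" "\<gamma> = \<alpha> + \<beta>" by auto
    obtain a b where "\<alpha> = rat_exp a" "\<beta> = rat_exp b"
      using pcoeff_embed_nonzero[OF h(1)] pcoeff_embed_nonzero[OF h(2)] by metis
    hence "\<gamma> = rat_exp (a + b)" using h(3) by (simp add: rat_exp_add)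
    thus False using \<gamma> by simp
  qed
  show "pcoeff (embed f * embed g) \<gamma> = 0" unfolding times_pser.rep_eq conv_def E by (rule sum.empty)
qed

abbreviation wser :: "('d::finite \<Rightarrow> real) \<Rightarrow> ('a::comm_ring_1, 'd) mps \<Rightarrow> 'a hahn" where
  "wser w f \<equiv> wsubst w (embed f)"

definition euler_deriv :: "'d \<Rightarrow> ('a::comm_ring_1, 'd::finite) mps \<Rightarrow> ('a, 'd) mps" where
  "euler_deriv i f = Abs_pser (\<lambda>\<beta>. of_nat (\<beta> i) * pcoeff f \<beta>)"

lemma pcoeff_Abs_mps: "pcoeff (Abs_pser f :: ('a::comm_ring_1, 'd::finite) mps) = f"
proof (rule Abs_pser_inverse, rule CollectI, intro exI conjI)
  show "(0::nat) < 1" by simp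
  show "{\<alpha>. f \<alpha> \<noteq> 0} \<subseteq> grid 1" unfolding grid_nat by (rule subset_UNIV)
qed

lemma hderiv_wser:
  fixes f :: "('a::field_char_0, 'd::finite) mps"
  assumes w: "weight w" and l: "\<And>\<alpha>. l (wdot w \<alpha>) = \<alpha> i"
  shows "hderiv l (wser w f) = wser w (euler_deriv i f)"
proof (rule hahn_eq_wsubstI[OF w])
  fix \<alpha> :: "'d \<Rightarrow> rat"
  show "hcoeff (hderiv l (wser w f)) (wdot w \<alpha>) = pcoeff (embed (euler_deriv i f)) \<alpha>"
  proof (cases "\<alpha> \<in> range rat_exp")
    case True
    then obtain \<beta> where "\<alpha> = rat_exp \<beta>" by (rule imageE)
    thus ?thesis by (simp add: w l euler_deriv_def pcoeff_Abs_mps) (simp add: rat_exp_def)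
  qed (simp add: w pcoeff_embed_not_range)
qed (simp add: hcoeff_wsubst_outside[OF w])

lemma hderiv_wser_0:
  fixes f :: "('a::field_char_0, 'd::finite) mps"
  assumes w: "weight w" and l: "\<And>\<alpha>. l (wdot w \<alpha>) = 0"
  shows "hderiv l (wser w f) = 0"
proof (rule hahn_eqI)
  fix a show "hcoeff (hderiv l (wser w f)) a = hcoeff 0 a"
    by (cases "a \<in> range (wdot w)") (auto simp: l hcoeff_wsubst_outside[OF w])
qed

section \<open>Monomials and their divisors\<close>

text \<open>The characterization of \<open>X\<^sup>\<mu>\<close> times a unit by the support.\<close>

definition monomial_unit :: "('a::zero, 'e::linordered_semidom, 'd::finite) pser \<Rightarrow> ('d \<Rightarrow> 'e) \<Rightarrow> bool" where
  "monomial_unit a \<mu> \<longleftrightarrow> pcoeff a \<mu> \<noteq> 0 \<and> (\<forall>\<beta>. pcoeff a \<beta> \<noteq> 0 \<longrightarrow> \<mu> \<le> \<beta>)"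

lemma monomial_unit_unique: "monomial_unit a \<mu> \<Longrightarrow> monomial_unit a \<nu> \<Longrightarrow> \<mu> = \<nu>"
  by (rule order.antisym) (simp_all add: monomial_unit_def)

lemma wsubst_monomial_unit:
  assumes "weight w" "monomial_unit a \<mu>"
  shows "supp_ge (wdot w \<mu>) (wsubst w a)"
  using assms by (auto simp: supp_ge_wsubst_iff monomial_unit_def intro: wdot_mono)

text \<open>All weighted orders are additive, and together they see the componentwise order.\<close>

lemma monomial_unit_factor:
  fixes a b :: "('a::idom, 'd::finite) fracps"
  assumes ab: "monomial_unit (a * b) \<gamma>"
  shows "\<exists>\<mu>. monomial_unit a \<mu>"
proof -
  have le: "\<gamma> \<le> \<alpha> + \<beta>" if \<alpha>: "pcoeff a \<alpha> \<noteq> 0" and \<beta>: "pcoeff b \<beta> \<noteq> 0" for \<alpha> \<beta>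
  proof (rule le_if_wdot_le)
    fix w :: "'d \<Rightarrow> real" assume w: "weight w"
    have nz: "wsubst w a \<noteq> 0" "wsubst w b \<noteq> 0"
      using \<alpha> \<beta> hcoeff_wsubst_wdot[OF w, of a \<alpha>] hcoeff_wsubst_wdot[OF w, of b \<beta>] by auto
    obtain r where r: "hcoeff (wsubst w a) r \<noteq> 0" "supp_ge r (wsubst w a)"
      by (rule hahn_lowest_exponent[OF nz(1)])
    obtain s where s: "hcoeff (wsubst w b) s \<noteq> 0" "supp_ge s (wsubst w b)"
      by (rule hahn_lowest_exponent[OF nz(2)])
    have "hcoeff (wsubst w (a * b)) (r + s) \<noteq> 0"
      using r s by (simp add: wsubst_mult[OF w] hcoeff_mult_lowest)
    hence "wdot w \<gamma> \<le> r + s" using wsubst_monomial_unit[OF w ab] by (simp add: supp_ge_def)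
    moreover have "r \<le> wdot w \<alpha>" "s \<le> wdot w \<beta>" using r(2) s(2) \<alpha> \<beta> w by (auto simp: supp_ge_wsubst_iff)
    ultimately show "wdot w \<gamma> \<le> wdot w (\<alpha> + \<beta>)" by (simp add: wdot_add)
  qed
  have "pcoeff (a * b) \<gamma> \<noteq> 0" using ab by (simp add: monomial_unit_def)
  hence "{(\<alpha>, \<beta>). \<alpha> + \<beta> = \<gamma> \<and> pcoeff a \<alpha> \<noteq> 0 \<and> pcoeff b \<beta> \<noteq> 0} \<noteq> {}"
    unfolding times_pser.rep_eq conv_def by (rule contrapos_nn) (simp only: sum.empty)
  then obtain p where "p \<in> {(\<alpha>, \<beta>). \<alpha> + \<beta> = \<gamma> \<and> pcoeff a \<alpha> \<noteq> 0 \<and> pcoeff b \<beta> \<noteq> 0}"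
    unfolding ex_in_conv[symmetric] by (rule exE)
  then obtain \<mu> \<nu> where mn: "\<mu> + \<nu> = \<gamma>" "pcoeff a \<mu> \<noteq> 0" "pcoeff b \<nu> \<noteq> 0"
    by (cases p) auto
  have "\<mu> \<le> \<beta>" if "pcoeff a \<beta> \<noteq> 0" for \<beta>
    using le[OF that mn(3)] mn(1) by (auto simp: le_fun_def)
  thus ?thesis using mn(2) by (auto simp: monomial_unit_def)
qed

lemma pcoeff_X_pow_mult:
  assumes "\<mu> \<in> grid k" "k > 0"
  shows "pcoeff (X_pow \<mu> * u) (\<mu> + \<beta>) = pcoeff u \<beta>"
    and "pcoeff (X_pow \<mu> * u) \<gamma> \<noteq> 0 \<Longrightarrow> \<exists>\<beta>. \<gamma> = \<mu> + \<beta> \<and> pcoeff u \<beta> \<noteq> 0"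
proof -
  have ex: "\<exists>k>0. \<mu> \<in> grid k" using assms by blast
  have X: "pcoeff (X_pow \<mu>) \<alpha> = (if \<alpha> = \<mu> then 1 else 0)" for \<alpha>
    by (simp add: X_pow.rep_eq ex)
  have prod: "pcoeff (X_pow \<mu> * u) \<gamma> =
      (\<Sum>(\<alpha>, \<beta>)\<in>{(\<alpha>, \<beta>). \<alpha> + \<beta> = \<gamma> \<and> \<alpha> = \<mu> \<and> pcoeff u \<beta> \<noteq> 0}. pcoeff u \<beta>)" for \<gamma>
    unfolding times_pser.rep_eq conv_def by (rule sum.cong) (auto simp: X split: if_splits)
  have "{(\<alpha>, \<beta>'). \<alpha> + \<beta>' = \<mu> + \<beta> \<and> \<alpha> = \<mu> \<and> pcoeff u \<beta>' \<noteq> 0}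
      = (if pcoeff u \<beta> = 0 then {} else {(\<mu>, \<beta>)})"
    by auto
  thus "pcoeff (X_pow \<mu> * u) (\<mu> + \<beta>) = pcoeff u \<beta>"
    unfolding prod by simp
  show "\<exists>\<beta>. \<gamma> = \<mu> + \<beta> \<and> pcoeff u \<beta> \<noteq> 0" if nz: "pcoeff (X_pow \<mu> * u) \<gamma> \<noteq> 0"
  proof (rule ccontr)
    assume no: "\<nexists>\<beta>. \<gamma> = \<mu> + \<beta> \<and> pcoeff u \<beta> \<noteq> 0"
    have E: "{(\<alpha>, \<beta>). \<alpha> + \<beta> = \<gamma> \<and> \<alpha> = \<mu> \<and> pcoeff u \<beta> \<noteq> 0} = {}" using no by auto
    show False using nz unfolding prod E by simp
  qed
qed

lemma monomial_unit_X_pow: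
  assumes "\<mu> \<in> grid k" "k > 0" "const_term u \<noteq> 0"
  shows "monomial_unit (X_pow \<mu> * u) \<mu>"
  unfolding monomial_unit_def
proof (intro conjI allI impI)
  show "pcoeff (X_pow \<mu> * u) \<mu> \<noteq> 0"
    using pcoeff_X_pow_mult(1)[OF assms(1,2), of u 0] assms(3) by simp
  fix \<beta> assume "pcoeff (X_pow \<mu> * u) \<beta> \<noteq> 0"
  then obtain \<delta> where \<delta>: "\<beta> = \<mu> + \<delta>" "pcoeff u \<delta> \<noteq> 0" using pcoeff_X_pow_mult(2)[OF assms(1,2)] by blast
  obtain l where l: "l > 0" "\<And>\<alpha>. pcoeff u \<alpha> \<noteq> 0 \<Longrightarrow> \<alpha> \<in> grid l" using pser_supp_grid by blast
  have "0 \<le> \<delta> i" for i by (rule grid_nonneg[OF l(1) l(2)[OF \<delta>(2)]])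
  thus "\<mu> \<le> \<beta>" by (simp add: \<delta>(1) le_fun_def)
qed

lemma rat_multiple_in_Nats:
  fixes q :: rat
  assumes "0 \<le> q" shows "\<exists>k>0. of_nat k * q \<in> \<nat>"
proof -
  obtain a b where q: "quotient_of q = (a, b)" by (cases "quotient_of q")
  have ab: "q = of_int a / of_int b" "b > 0"
    by (rule quotient_of_div[OF q], rule quotient_of_denom_pos[OF q])
  hence eq: "of_int b * q = of_int a" by simp
  have "0 \<le> (of_int a :: rat)" unfolding eq[symmetric] using ab(2) assms by (intro mult_nonneg_nonneg) auto
  hence a: "(of_nat (nat a) :: rat) = of_int a" by simp
  have b: "(of_nat (nat b) :: rat) = of_int b" using ab(2) by simp
  have "of_nat (nat b) * q = of_nat (nat a)" unfolding a b by (rule eq)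
  hence "of_nat (nat b) * q \<in> \<nat>" by (simp only: of_nat_in_Nats)
  thus ?thesis using ab(2) by (intro exI[of _ "nat b"]) simp
qed

lemma rat_nonneg_in_grid:
  fixes \<mu> :: "'d::finite \<Rightarrow> rat"
  assumes "0 \<le> \<mu>" shows "\<exists>k>0. \<mu> \<in> grid k"
proof -
  have "\<exists>k. k > 0 \<and> of_nat k * \<mu> i \<in> \<nat>" for i
    using assms by (intro rat_multiple_in_Nats) (simp add: le_fun_def)
  then obtain k where k: "\<And>i. k i > 0" "\<And>i. of_nat (k i) * \<mu> i \<in> \<nat>" by metis
  have "of_nat (prod k UNIV) * \<mu> i \<in> \<nat>" for i
  proof -
    have "prod k UNIV = prod k (UNIV - {i}) * k i"
      by (subst prod.remove[of UNIV i]) (simp_all add: mult.commute)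
    hence "of_nat (prod k UNIV) * \<mu> i = of_nat (prod k (UNIV - {i})) * (of_nat (k i) * \<mu> i)"
      by (simp only: of_nat_mult mult.assoc)
    also have "\<dots> \<in> \<nat>" by (rule Nats_mult[OF of_nat_in_Nats k(2)])
    finally show ?thesis .
  qed
  hence "\<mu> \<in> grid (prod k UNIV)" by (simp add: grid_def)
  moreover have "prod k UNIV > 0" using k(1) by (simp add: prod_pos)
  ultimately show ?thesis by blast
qed

lemma grid_rat_diff:
  fixes \<mu> \<beta> :: "'d::finite \<Rightarrow> rat"
  assumes "\<mu> \<in> grid k" "\<beta> \<in> grid k" "\<mu> \<le> \<beta>"
  shows "\<beta> - \<mu> \<in> grid k"
proof -
  have "of_nat k * (\<beta> i - \<mu> i) \<in> \<nat>" for i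
  proof -
    obtain m where m: "of_nat k * \<mu> i = of_nat m" by (rule gridD[OF assms(1), of i])
    obtain n where n: "of_nat k * \<beta> i = of_nat n" by (rule gridD[OF assms(2), of i])
    have "of_nat k * \<mu> i \<le> of_nat k * \<beta> i" using assms(3) by (simp add: le_fun_def mult_left_mono)
    hence "m \<le> n" using m n by simp
    hence "of_nat k * (\<beta> i - \<mu> i) = of_nat (n - m)" using m n by (simp add: right_diff_distrib of_nat_diff)
    thus ?thesis by simp
  qed
  thus ?thesis by (simp add: grid_def)
qed

lemma monomial_unit_iff:
  fixes a :: "('a::comm_ring_1, 'd::finite) fracps"
  shows "monomial_unit a \<mu> \<longleftrightarrow> 0 \<le> \<mu> \<and> (\<exists>u. a = X_pow \<mu> * u \<and> const_term u \<noteq> 0)"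
proof
  assume m: "monomial_unit a \<mu>"
  hence pos: "0 \<le> \<mu>" using fracps_supp_nonneg by (auto simp: monomial_unit_def)
  obtain k where k: "k > 0" "\<And>\<alpha>. pcoeff a \<alpha> \<noteq> 0 \<Longrightarrow> \<alpha> \<in> grid k" using pser_supp_grid by blast
  have \<mu>: "\<mu> \<in> grid k" using m by (intro k(2)) (simp add: monomial_unit_def)
  define u where "u = (Abs_pser (\<lambda>\<beta>. pcoeff a (\<mu> + \<beta>)) :: ('a, 'd) fracps)"
  have "{\<beta>. pcoeff a (\<mu> + \<beta>) \<noteq> 0} \<subseteq> grid k"
  proof clarify
    fix \<beta> assume nz: "pcoeff a (\<mu> + \<beta>) \<noteq> 0"
    have "\<mu> \<le> \<mu> + \<beta>" using m[unfolded monomial_unit_def] nz by (elim conjE allE impE)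
    from grid_rat_diff[OF \<mu> k(2)[OF nz] this] show "\<beta> \<in> grid k" by simp
  qed
  hence u: "pcoeff u \<beta> = pcoeff a (\<mu> + \<beta>)" for \<beta>
    unfolding u_def using k(1) by (subst Abs_pser_inverse) auto
  have "a = X_pow \<mu> * u"
  proof (rule pser_eqI)
    fix \<gamma>
    have "pcoeff (X_pow \<mu> * u) (\<mu> + (\<gamma> - \<mu>)) = pcoeff u (\<gamma> - \<mu>)" using \<mu> k(1) by (rule pcoeff_X_pow_mult)
    thus "pcoeff a \<gamma> = pcoeff (X_pow \<mu> * u) \<gamma>" by (simp add: u)
  qed
  moreover have "const_term u \<noteq> 0" using m by (simp add: u monomial_unit_def)
  ultimately show "0 \<le> \<mu> \<and> (\<exists>u. a = X_pow \<mu> * u \<and> const_term u \<noteq> 0)" using pos by blast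
next
  assume "0 \<le> \<mu> \<and> (\<exists>u. a = X_pow \<mu> * u \<and> const_term u \<noteq> 0)"
  thus "monomial_unit a \<mu>" using rat_nonneg_in_grid monomial_unit_X_pow by metis
qed

lemma monomial_unit_embed: "monomial_unit a \<mu> \<Longrightarrow> monomial_unit (embed a) (rat_exp \<mu>)"
  unfolding monomial_unit_def by (metis pcoeff_embed_nonzero pcoeff_embed_rat_exp rat_exp_le_iff)

section \<open>The resultant as a linear combination\<close>

text \<open>Expand the determinant whose last row consists of multiples of the two polynomials.\<close>

lemma resultant_as_combination:
  fixes f g :: "'a::idom poly"
  assumes "degree f > 0"
  shows "\<exists>a b. [:resultant f g:] = a * f + b * g"
proof -
  let ?n = "degree f + degree g"
  let ?M = "subresultant_mat 0 f g"
  let ?I = "{p. \<exists>a b. p = a * f + b * g}"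
  have M: "?M \<in> carrier_mat ?n ?n" by (rule carrier_matI) simp_all
  have last: "?n - 1 < ?n" using assms by simp
  have "det ?M = (\<Sum>j<?n. ?M $$ (?n - 1, j) * cofactor ?M (?n - 1) j)"
    by (rule laplace_expansion_row[OF M last])
  also have "\<dots> \<in> ?I"
  proof -
    have sum: "(\<Sum>j\<in>J. F j) \<in> ?I" if "\<And>j. j \<in> J \<Longrightarrow> F j \<in> ?I" for J :: "nat set" and F
      using that
    proof (induction J rule: infinite_finite_induct)
      case (insert x J)
      obtain a b where 1: "F x = a * f + b * g" using insert.prems by blast
      obtain c d where 2: "sum F J = c * f + d * g" using insert by blast
      have "F x + sum F J = (a + c) * f + (b + d) * g" by (simp add: 1 2 algebra_simps)
      thus ?case using insert.hyps by auto
    qed (auto intro!: exI[of _ 0])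
    show ?thesis
    proof (rule sum)
      fix j assume "j \<in> {..<?n}"
      hence j: "j < ?n" by simp
      let ?c = "cofactor ?M (?n - 1) j"
      show "?M $$ (?n - 1, j) * ?c \<in> ?I"
      proof (cases "j < degree g")
        case True
        hence "?M $$ (?n - 1, j) = monom 1 (degree g - 1 - j) * f"
          using last j by (subst subresultant_index_mat) auto
        hence "?M $$ (?n - 1, j) * ?c = (monom 1 (degree g - 1 - j) * ?c) * f + 0 * g" by (simp add: mult_ac)
        thus ?thesis by blast
      next
        case False
        hence "?M $$ (?n - 1, j) = monom 1 (degree f - 1 - (j - degree g)) * g"
          using last j by (subst subresultant_index_mat) auto
        hence "?M $$ (?n - 1, j) * ?c = 0 * f + (monom 1 (degree f - 1 - (j - degree g)) * ?c) * g" by (simp add: mult_ac)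
        thus ?thesis by blast
      qed
    qed
  qed
  finally show ?thesis
    using subresultant_resultant[of f g] by (simp add: subresultant_def)
qed

section \<open>Finite generation over the power series ring\<close>

lemma nat_vectors_incseq_subseq:
  fixes s :: "nat \<Rightarrow> 'd \<Rightarrow> nat"
  assumes "finite A"
  shows "\<exists>r::nat \<Rightarrow> nat. strict_mono r \<and> (\<forall>i\<in>A. incseq (\<lambda>n. s (r n) i))"
  using assms
proof (induction A)
  case empty
  show ?case by (intro exI[of _ id]) (simp add: strict_mono_def)
next
  case (insert x A)
  then obtain r :: "nat \<Rightarrow> nat" where r: "strict_mono r" "\<forall>i\<in>A. incseq (\<lambda>n. s (r n) i)" by blast
  have wo: "well_ordered_set (range real)"
    unfolding well_ordered_set_def
  proof (intro allI impI)
    fix T assume T: "T \<subseteq> range real" "T \<noteq> {}"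
    then obtain n where n: "real n \<in> T" by blast
    define m where "m = (LEAST n. real n \<in> T)"
    have "real m \<in> T" unfolding m_def by (rule LeastI[of _ n]) (rule n)
    moreover have "real m \<le> x" if x: "x \<in> T" for x
    proof -
      obtain l where l: "x = real l" using x T by blast
      have "m \<le> l" unfolding m_def by (rule Least_le) (use x l in simp)
      thus ?thesis using l by simp
    qed
    ultimately show "\<exists>m\<in>T. \<forall>x\<in>T. m \<le> x" by blast
  qed
  have "range (\<lambda>n. real (s (r n) x)) \<subseteq> range real" by auto
  from well_ordered_set_incseq_subseq[OF wo this] obtain q :: "nat \<Rightarrow> nat"
    where q: "strict_mono q" "incseq (\<lambda>n. real (s (r (q n)) x))" .
  have "incseq (\<lambda>n. s (r (q n)) i)" if "i \<in> insert x A" for i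
  proof (cases "i = x")
    case True
    thus ?thesis using q(2) by (simp add: incseq_def)
  next
    case False
    hence "incseq (\<lambda>n. s (r n) i)" using r(2) that by simp
    moreover have "mono q" using q(1) by (rule strict_mono_mono)
    ultimately show ?thesis unfolding incseq_def mono_def by simp
  qed
  moreover have "strict_mono (\<lambda>n. r (q n))" using r(1) q(1) by (simp add: strict_mono_def)
  ultimately show ?case by (intro exI[of _ "\<lambda>n. r (q n)"]) simp
qed

text \<open>Dickson's lemma.\<close>

lemma finite_basis_of_exponents:
  fixes E :: "('d::finite \<Rightarrow> nat) set"
  shows "\<exists>F\<subseteq>E. finite F \<and> (\<forall>\<alpha>\<in>E. \<exists>\<phi>\<in>F. \<phi> \<le> \<alpha>)"
proof -
  define F where "F = {\<phi> \<in> E. \<forall>\<alpha>\<in>E. \<alpha> \<le> \<phi> \<longrightarrow> \<alpha> = \<phi>}"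
  have "finite F"
  proof (rule ccontr)
    assume "infinite F"
    then obtain s :: "nat \<Rightarrow> 'd \<Rightarrow> nat" where s: "inj s" "range s \<subseteq> F"
      using infinite_countable_subset by blast
    obtain r :: "nat \<Rightarrow> nat" where r: "strict_mono r" "\<forall>i\<in>UNIV. incseq (\<lambda>n. s (r n) i)"
      using nat_vectors_incseq_subseq[of UNIV s] by auto
    have "s (r 0) \<le> s (r 1)" using r(2) by (simp add: le_fun_def incseq_def)
    moreover have "s (r 0) \<in> F" "s (r 1) \<in> F" using s(2) by auto
    ultimately have "s (r 0) = s (r 1)" unfolding F_def by simp
    hence "r 0 = r 1" using s(1) by (simp add: inj_eq)
    thus False using r(1) by (simp add: strict_mono_eq)
  qed
  moreover have "\<exists>\<phi>\<in>F. \<phi> \<le> \<alpha>" if "\<alpha> \<in> E" for \<alpha>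
    using that
  proof (induction "sum \<alpha> UNIV" arbitrary: \<alpha> rule: less_induct)
    case less
    show ?case
    proof (cases "\<alpha> \<in> F")
      case False
      then obtain \<beta> where \<beta>: "\<beta> \<in> E" "\<beta> \<le> \<alpha>" "\<beta> \<noteq> \<alpha>" using less.prems by (auto simp: F_def)
      obtain i where "\<beta> i \<noteq> \<alpha> i" using \<beta>(3) by (auto simp: fun_eq_iff)
      hence "\<beta> i < \<alpha> i" using \<beta>(2) by (simp add: le_fun_def order.not_eq_order_implies_strict)
      hence "sum \<beta> UNIV < sum \<alpha> UNIV"
        using \<beta>(2) by (intro sum_strict_mono_ex1) (auto simp: le_fun_def)
      then obtain \<phi> where "\<phi> \<in> F" "\<phi> \<le> \<beta>" using less.hyps \<beta>(1) by blast
      thus ?thesis using \<beta>(2) order.trans by blast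
    qed auto
  qed
  moreover have "F \<subseteq> E" by (auto simp: F_def)
  ultimately show ?thesis by blast
qed

lemma finite_exponents_le: "finite {\<gamma>. \<gamma> \<le> (\<beta> :: 'd::finite \<Rightarrow> nat)}"
proof -
  have "{\<gamma>. \<gamma> \<le> \<beta>} \<subseteq> (\<Pi>\<^sub>E i\<in>UNIV. {..\<beta> i})" by (auto simp: le_fun_def)
  thus ?thesis by (rule finite_subset) (auto intro: finite_PiE)
qed

lemma pcoeff_mult_mps:
  fixes f g :: "('a::comm_ring_1, 'd::finite) mps"
  shows "pcoeff (f * g) \<beta> = (\<Sum>\<gamma>\<in>{\<gamma>. \<gamma> \<le> \<beta>}. pcoeff f \<gamma> * pcoeff g (\<beta> - \<gamma>))"
proof -
  have "conv (pcoeff f) (pcoeff g) \<beta> = (\<Sum>(\<alpha>, \<delta>)\<in>gpairs 1 \<beta>. pcoeff f \<alpha> * pcoeff g \<delta>)"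
    by (rule conv_eq) (simp_all only: zero_less_one grid_nat subset_UNIV)
  also have "gpairs 1 \<beta> = {(\<alpha>, \<delta>). \<alpha> + \<delta> = \<beta>}" unfolding gpairs_def grid_nat by simp
  also have "(\<Sum>(\<alpha>, \<delta>)\<in>{(\<alpha>, \<delta>). \<alpha> + \<delta> = \<beta>}. pcoeff f \<alpha> * pcoeff g \<delta>)
      = (\<Sum>\<gamma>\<in>{\<gamma>. \<gamma> \<le> \<beta>}. pcoeff f \<gamma> * pcoeff g (\<beta> - \<gamma>))"
  proof -
    have 1: "\<beta> - a = b" "a \<le> \<beta>" if "a + b = \<beta>" for a b :: "'d \<Rightarrow> nat"
      unfolding that[symmetric] by (simp_all add: fun_eq_iff le_fun_def)
    have 2: "a + (\<beta> - a) = \<beta>" if "a \<le> \<beta>" for a :: "'d \<Rightarrow> nat"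
      using that by (auto simp: fun_eq_iff le_fun_def)
    have 3: "a \<le> a + b" for a b :: "'d \<Rightarrow> nat" by (simp add: le_fun_def)
    show ?thesis
      by (rule sum.reindex_bij_witness[of _ "\<lambda>\<gamma>. (\<gamma>, \<beta> - \<gamma>)" fst]) (auto simp: 1 2 3)
  qed
  finally show ?thesis by (simp only: times_pser.rep_eq)
qed

text \<open>Monomials \<open>X\<^sup>\<beta> Y\<^sup>k\<close> are ordered by a weight, which makes every initial segment finite.\<close>

definition coeff2 :: "('a::comm_ring_1, 'd::finite) mps poly \<Rightarrow> nat \<times> ('d \<Rightarrow> nat) \<Rightarrow> 'a" where
  "coeff2 p e = pcoeff (coeff p (fst e)) (snd e)"

text \<open>The key plays the role of a monomial order; power series have a least, not a greatest, monomial.\<close>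

definition lead_at :: "(nat \<times> ('d \<Rightarrow> nat) \<Rightarrow> real) \<Rightarrow> ('a::comm_ring_1, 'd::finite) mps poly \<Rightarrow> nat \<times> ('d \<Rightarrow> nat) \<Rightarrow> bool" where
  "lead_at key p e \<longleftrightarrow> coeff2 p e \<noteq> 0 \<and> (\<forall>e'. coeff2 p e' \<noteq> 0 \<longrightarrow> key e \<le> key e')"

lemma coeff2_eqI: "(\<And>e. coeff2 p e = coeff2 q e) \<Longrightarrow> p = q"
  by (rule poly_eqI, rule pser_eqI) (metis coeff2_def fst_conv snd_conv)

lemma coeff2_add: "coeff2 (p + q) e = coeff2 p e + coeff2 q e"
  and coeff2_diff: "coeff2 (p - q) e = coeff2 p e - coeff2 q e"
  and coeff2_0: "coeff2 0 e = 0"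
  by (simp_all add: coeff2_def)

lemma coeff2_sum: "coeff2 (sum F A) e = (\<Sum>i\<in>A. coeff2 (F i) e)"
  by (induction A rule: infinite_finite_induct) (auto simp: coeff2_add coeff2_0)

lemma coeff2_smult:
  "coeff2 (smult q p) (k, \<beta>) = (\<Sum>\<gamma>\<in>{\<gamma>. \<gamma> \<le> \<beta>}. pcoeff q \<gamma> * coeff2 p (k, \<beta> - \<gamma>))"
  by (simp add: coeff2_def pcoeff_mult_mps)

lemma monomial_key_exists:
  obtains key :: "nat \<times> ('d::finite \<Rightarrow> nat) \<Rightarrow> real" and v :: "('d \<Rightarrow> nat) \<Rightarrow> real"
  where "inj key" "\<And>r. finite {e. key e \<le> r}" "\<And>k \<beta> \<gamma>. key (k, \<beta> + \<gamma>) = key (k, \<beta>) + v \<gamma>"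
proof -
  obtain w :: "'d option \<Rightarrow> real" where w: "weight w" using weight_exists by blast
  define ex where "ex e = rat_exp (case_option (fst e) (snd e))" for e :: "nat \<times> ('d \<Rightarrow> nat)"
  define key where "key e = wdot w (ex e)" for e
  have inj_ex: "inj ex"
  proof (rule injI)
    fix e e' assume "ex e = ex e'"
    hence eq: "(case_option (fst e) (snd e) :: 'd option \<Rightarrow> nat) = case_option (fst e') (snd e')"
      by (simp add: ex_def)
    have "fst e = fst e'" using fun_cong[OF eq, of None] by simp
    moreover have "snd e i = snd e' i" for i using fun_cong[OF eq, of "Some i"] by simp
    ultimately show "e = e'" by (simp add: prod_eq_iff fun_eq_iff)
  qed
  have "inj key" unfolding key_def using inj_compose[OF inj_wdot[OF w] inj_ex] by (simp add: comp_def)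
  moreover have "finite {e. key e \<le> r}" for r
  proof -
    have "ex ` {e. key e \<le> r} \<subseteq> {\<alpha> \<in> grid 1. wdot w \<alpha> \<le> r}"
      by (auto simp: key_def ex_def rat_exp_def grid_def)
    hence "finite (ex ` {e. key e \<le> r})"
      by (rule finite_subset) (rule finite_wdot_grid_le, auto intro: weightD(1)[OF w])
    thus ?thesis using inj_ex by (metis finite_imageD inj_on_subset subset_UNIV)
  qed
  moreover have "key (k, \<beta> + \<gamma>) = key (k, \<beta>) + key (0, \<gamma>)" for k \<beta> \<gamma>
  proof -
    have "(case_option k (\<beta> + \<gamma>) :: 'd option \<Rightarrow> nat) = case_option k \<beta> + case_option 0 \<gamma>"
      by (auto simp: fun_eq_iff split: option.splits)
    thus ?thesis by (simp add: key_def ex_def rat_exp_add wdot_add)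
  qed
  ultimately show ?thesis by (rule that[of key "\<lambda>\<gamma>. key (0, \<gamma>)"])
qed

lemma lead_at_exists:
  assumes "\<And>r. finite {e. key e \<le> r}" "p \<noteq> 0"
  shows "\<exists>e. lead_at key p e"
proof -
  obtain e0 where e0: "coeff2 p e0 \<noteq> 0"
  proof (rule ccontr)
    assume "\<not> thesis"
    hence "coeff2 p e = coeff2 0 e" for e using that unfolding coeff2_0 by blast
    hence "p = 0" by (rule coeff2_eqI)
    thus False using assms(2) by simp
  qed
  define S where "S = {e. coeff2 p e \<noteq> 0 \<and> key e \<le> key e0}"
  have fin: "finite S" unfolding S_def by (rule finite_subset[OF _ assms(1)[of "key e0"]]) auto
  have e0S: "e0 \<in> S" using e0 by (simp add: S_def)
  define e where "e = arg_min_on key S"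
  have e: "e \<in> S" "key e \<le> key e'" if "e' \<in> S" for e'
    using arg_min_if_finite(1)[OF fin, of key] arg_min_least[OF fin _ that, of key] that
    unfolding e_def by auto
  have min: "key e \<le> key e'" if "coeff2 p e' \<noteq> 0" for e'
  proof (cases "key e' \<le> key e0")
    case True
    hence "e' \<in> S" using that by (simp add: S_def)
    thus ?thesis by (rule e(2))
  next
    case False
    thus ?thesis using e(2)[OF e0S] by simp
  qed
  have "coeff2 p e \<noteq> 0" using e(1)[OF e0S] by (simp add: S_def)
  hence "lead_at key p e" unfolding lead_at_def using min by simp
  thus ?thesis by (rule exI)
qed

text \<open>A family with enough leading monomials generates: divide by it, monomial by monomial.\<close>

lemma standard_basis_generates:
  fixes M :: "('a::field, 'd::finite) mps poly set"
  assumes inj: "inj key" and fin: "\<And>r. finite {e. key e \<le> r}"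
    and key_add: "\<And>k \<beta> \<gamma>. key (k, \<beta> + \<gamma>) = key (k, \<beta>) + v \<gamma>"
    and diff: "\<And>p q. p \<in> M \<Longrightarrow> q \<in> M \<Longrightarrow> p - q \<in> M"
    and comb: "\<And>q. (\<Sum>\<phi>\<in>F. smult (q \<phi>) (P \<phi>)) \<in> M"
    and F: "finite F" "\<And>\<phi>. \<phi> \<in> F \<Longrightarrow> lead_at key (P \<phi>) \<phi>"
    and basis: "\<And>p k \<beta>. p \<in> M \<Longrightarrow> lead_at key p (k, \<beta>) \<Longrightarrow> \<exists>\<beta>'. (k, \<beta>') \<in> F \<and> \<beta>' \<le> \<beta>"
    and p: "p \<in> M"
  shows "\<exists>q. p = (\<Sum>\<phi>\<in>F. smult (q \<phi>) (P \<phi>))"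
proof -
  define E where "E = {e. \<exists>p\<in>M. lead_at key p e}"
  have "\<exists>\<beta>'. (fst e, \<beta>') \<in> F \<and> \<beta>' \<le> snd e" if "e \<in> E" for e
    using that basis[of _ "fst e" "snd e"] by (auto simp: E_def)
  then obtain ch where ch: "\<And>e. e \<in> E \<Longrightarrow> (fst e, ch e) \<in> F \<and> ch e \<le> snd e" by metis
  define T where "T e e' = coeff2 (P (fst e, ch e)) (fst e', snd e' - (snd e - ch e))"
    for e e' :: "nat \<times> ('d \<Rightarrow> nat)"
  define A where "A e = {e' \<in> E. snd e' - ch e' \<le> snd e}" for e :: "nat \<times> ('d \<Rightarrow> nat)"
  have T_key: "key e \<le> key e'" if e: "e \<in> A e'" and nz: "T e e' \<noteq> 0" for e e'
  proof -
    have eE: "e \<in> E" and le: "snd e - ch e \<le> snd e'" using e by (auto simp: A_def)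
    have "key (fst e, ch e) \<le> key (fst e', snd e' - (snd e - ch e))"
      using F(2)[of "(fst e, ch e)"] ch[OF eE] nz by (simp add: lead_at_def T_def)
    hence "key (fst e, ch e + (snd e - ch e)) \<le> key (fst e', (snd e' - (snd e - ch e)) + (snd e - ch e))"
      by (simp only: key_add)
    moreover have "ch e + (snd e - ch e) = snd e" using ch[OF eE] by (auto simp: le_fun_def fun_eq_iff)
    moreover have "(snd e' - (snd e - ch e)) + (snd e - ch e) = snd e'"
      using le by (auto simp: le_fun_def fun_eq_iff)
    ultimately show ?thesis by simp
  qed
  define B where "B e = {e' \<in> A e. key e' < key e}" for e
  have finB: "finite {e' \<in> A e. key e' \<le> key e}" for e
    by (rule finite_subset[OF _ fin[of "key e"]]) blast
  define G where "G c e = (if e \<in> E then (coeff2 p e - (\<Sum>e'\<in>B e. c e' * T e' e)) / T e e else 0)" for c :: "_ \<Rightarrow> 'a" and e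
  define R where "R = {(e', e). key e' < key e}"
  have "wf R"
  proof (rule wf_subset[OF wf_measure[of "\<lambda>e. card {e'. key e' < key e}"]])
    show "R \<subseteq> Wellfounded.measure (\<lambda>e. card {e'. key e' < key e})"
    proof (clarsimp simp: R_def)
      fix k \<beta> k' \<beta>' assume lt: "key (k, \<beta>) < key (k', \<beta>')"
      have "finite {e'. key e' < key (k', \<beta>')}"
        by (rule finite_subset[OF _ fin[of "key (k', \<beta>')"]]) auto
      thus "card {e'. key e' < key (k, \<beta>)} < card {e'. key e' < key (k', \<beta>')}"
        using lt by (intro psubset_card_mono) auto
    qed
  qed
  moreover have "adm_wf R G"
    unfolding adm_wf_def
  proof (intro allI impI)
    fix c c' :: "nat \<times> ('d \<Rightarrow> nat) \<Rightarrow> 'a" and e assume "\<forall>z. (z, e) \<in> R \<longrightarrow> c z = c' z"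
    hence "(\<Sum>e'\<in>B e. c e' * T e' e) = (\<Sum>e'\<in>B e. c' e' * T e' e)"
      by (intro sum.cong) (auto simp: R_def B_def)
    thus "G c e = G c' e" by (simp add: G_def)
  qed
  ultimately have fixp: "wfrec R G = G (wfrec R G)" by (rule wfrec_fixpoint)
  define c where "c = wfrec R G"
  have c: "c e = G c e" for e unfolding c_def by (rule fun_cong[OF fixp])
  define q where "q \<phi> = (Abs_pser (\<lambda>\<gamma>. if (fst \<phi>, snd \<phi> + \<gamma>) \<in> E \<and> ch (fst \<phi>, snd \<phi> + \<gamma>) = snd \<phi>
      then c (fst \<phi>, snd \<phi> + \<gamma>) else 0) :: ('a, 'd) mps)" for \<phi>
  have q: "pcoeff (q \<phi>) \<gamma> = (if (fst \<phi>, snd \<phi> + \<gamma>) \<in> E \<and> ch (fst \<phi>, snd \<phi> + \<gamma>) = snd \<phi>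
      then c (fst \<phi>, snd \<phi> + \<gamma>) else 0)" for \<phi> \<gamma>
    unfolding q_def pcoeff_Abs_mps ..
  let ?u = "\<Sum>\<phi>\<in>F. smult (q \<phi>) (P \<phi>)"
  have u: "coeff2 ?u e = (\<Sum>e'\<in>A e. c e' * T e' e)" and finA: "finite (A e)" for e
  proof -
    let ?D = "F \<times> {\<gamma>. \<gamma> \<le> snd e}"
    let ?C = "{(\<phi>, \<gamma>) \<in> ?D. (fst \<phi>, snd \<phi> + \<gamma>) \<in> E \<and> ch (fst \<phi>, snd \<phi> + \<gamma>) = snd \<phi>}"
    have finD: "finite ?D" using F(1) finite_exponents_le by blast
    have bij: "bij_betw (\<lambda>(\<phi>, \<gamma>). (fst \<phi>, snd \<phi> + \<gamma>)) ?C (A e)"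
    proof (rule bij_betw_byWitness[where f' = "\<lambda>e'. ((fst e', ch e'), snd e' - ch e')"])
      have le: "ch e' + (snd e' - ch e') = snd e'" if "e' \<in> E" for e'
        using ch[OF that] by (auto simp: le_fun_def fun_eq_iff)
      show "\<forall>a\<in>?C. (\<lambda>e'. ((fst e', ch e'), snd e' - ch e')) ((\<lambda>(\<phi>, \<gamma>). (fst \<phi>, snd \<phi> + \<gamma>)) a) = a"
        by (auto simp: fun_eq_iff)
      show "\<forall>a'\<in>A e. (\<lambda>(\<phi>, \<gamma>). (fst \<phi>, snd \<phi> + \<gamma>)) ((fst a', ch a'), snd a' - ch a') = a'"
        using le by (simp add: A_def prod_eq_iff)
      show "(\<lambda>(\<phi>, \<gamma>). (fst \<phi>, snd \<phi> + \<gamma>)) ` ?C \<subseteq> A e"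
        by (auto simp: A_def le_fun_def)
      show "(\<lambda>e'. ((fst e', ch e'), snd e' - ch e')) ` A e \<subseteq> ?C"
      proof (rule image_subsetI)
        fix e' assume e': "e' \<in> A e"
        hence E: "e' \<in> E" "snd e' - ch e' \<le> snd e" by (simp_all add: A_def)
        show "((fst e', ch e'), snd e' - ch e') \<in> ?C" using ch[OF E(1)] le[OF E(1)] E by simp
      qed
    qed
    have "?C \<subseteq> ?D" by blast
    hence "finite ?C" using finD by (rule finite_subset)
    thus "finite (A e)" using bij by (simp add: bij_betw_finite)
    have "coeff2 ?u e = (\<Sum>\<phi>\<in>F. \<Sum>\<gamma>\<in>{\<gamma>. \<gamma> \<le> snd e}. pcoeff (q \<phi>) \<gamma> * coeff2 (P \<phi>) (fst e, snd e - \<gamma>))"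
      unfolding coeff2_sum by (rule sum.cong[OF refl], cases e) (simp add: coeff2_smult)
    also have "\<dots> = (\<Sum>(\<phi>, \<gamma>)\<in>?D. pcoeff (q \<phi>) \<gamma> * coeff2 (P \<phi>) (fst e, snd e - \<gamma>))"
      by (rule sum.cartesian_product)
    also have "\<dots> = (\<Sum>(\<phi>, \<gamma>)\<in>?C. pcoeff (q \<phi>) \<gamma> * coeff2 (P \<phi>) (fst e, snd e - \<gamma>))"
      by (rule sum.mono_neutral_right[OF finD \<open>?C \<subseteq> ?D\<close>]) (auto simp: q split: if_splits)
    also have "\<dots> = (\<Sum>x\<in>?C. (\<lambda>e'. c e' * T e' e) ((\<lambda>(\<phi>, \<gamma>). (fst \<phi>, snd \<phi> + \<gamma>)) x))"
    proof (rule sum.cong[OF refl], clarify)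
      fix k \<beta> \<gamma> assume h: "(fst (k, \<beta>), snd (k, \<beta>) + \<gamma>) \<in> E" "ch (fst (k, \<beta>), snd (k, \<beta>) + \<gamma>) = snd (k, \<beta>)"
      have "\<beta> + \<gamma> - \<beta> = \<gamma>" by (auto simp: fun_eq_iff)
      thus "pcoeff (q (k, \<beta>)) \<gamma> * coeff2 (P (k, \<beta>)) (fst e, snd e - \<gamma>)
          = c (fst (k, \<beta>), snd (k, \<beta>) + \<gamma>) * T (fst (k, \<beta>), snd (k, \<beta>) + \<gamma>) e"
        using h by (simp add: q T_def)
    qed
    also have "\<dots> = (\<Sum>e'\<in>A e. c e' * T e' e)" by (rule sum.reindex_bij_betw[OF bij])
    finally show "coeff2 ?u e = (\<Sum>e'\<in>A e. c e' * T e' e)" .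
  qed
  have zero: "coeff2 (p - ?u) e = 0" if e: "e \<in> E" for e
  proof -
    have eA: "e \<in> A e" using e by (auto simp: A_def le_fun_def)
    have "snd e - (snd e - ch e) = ch e" using ch[OF e] by (auto simp: le_fun_def fun_eq_iff)
    hence Te: "T e e \<noteq> 0" using F(2) ch[OF e] by (simp add: T_def lead_at_def)
    have "(\<Sum>e'\<in>A e. c e' * T e' e) = (\<Sum>e'\<in>insert e (B e). c e' * T e' e)"
    proof (rule sum.mono_neutral_right[OF finA])
      show "insert e (B e) \<subseteq> A e" using eA by (auto simp: B_def)
      show "\<forall>i\<in>A e - insert e (B e). c i * T i e = 0"
      proof
        fix i assume i: "i \<in> A e - insert e (B e)"
        hence "\<not> key i < key e" by (auto simp: B_def)
        moreover have "key i \<noteq> key e" using i inj by (auto simp: inj_eq)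
        ultimately have "T i e = 0" using T_key[of i e] i by force
        thus "c i * T i e = 0" by simp
      qed
    qed
    also have "\<dots> = c e * T e e + (\<Sum>e'\<in>B e. c e' * T e' e)"
      by (rule sum.insert) (auto simp: B_def intro: finite_subset[OF _ finA[of e]])
    also have "c e * T e e = coeff2 p e - (\<Sum>e'\<in>B e. c e' * T e' e)"
      unfolding c[of e] using Te e by (simp add: G_def)
    finally show ?thesis by (simp add: coeff2_diff u)
  qed
  have "p - ?u = 0"
  proof (rule ccontr)
    assume nz: "p - ?u \<noteq> 0"
    obtain e where e: "lead_at key (p - ?u) e" using lead_at_exists[OF fin nz] by blast
    have "p - ?u \<in> M" by (rule diff[OF p comb])
    hence "e \<in> E" using e by (auto simp: E_def)
    thus False using zero e by (simp add: lead_at_def)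
  qed
  thus ?thesis by (intro exI[of _ q]) simp
qed

text \<open>The power series ring is Noetherian; the form needed below.\<close>

theorem bounded_degree_sequence_relation:
  fixes g :: "nat \<Rightarrow> ('a::field, 'd::finite) mps poly"
  assumes deg: "\<And>j. degree (g j) < n"
  shows "\<exists>m b. g m = (\<Sum>j<m. smult (b j) (g j))"
proof -
  obtain key :: "nat \<times> ('d \<Rightarrow> nat) \<Rightarrow> real" and v where key: "inj key" "\<And>r. finite {e. key e \<le> r}"
    "\<And>k \<beta> \<gamma>. key (k, \<beta> + \<gamma>) = key (k, \<beta>) + v \<gamma>" by (rule monomial_key_exists) (rule that)
  define S where "S m = {\<Sum>j<m. smult (b j) (g j) | b. True}" for m :: nat
  define M where "M = (\<Union>m. S m)"
  have S_mono: "S m \<subseteq> S m'" if "m \<le> m'" for m m'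
  proof
    fix p assume "p \<in> S m"
    then obtain b where b: "p = (\<Sum>j<m. smult (b j) (g j))" by (auto simp: S_def)
    have "(\<Sum>j<m'. smult (if j < m then b j else 0) (g j)) = (\<Sum>j<m. smult (if j < m then b j else 0) (g j))"
      using that by (intro sum.mono_neutral_right) auto
    also have "\<dots> = p" unfolding b by (rule sum.cong) auto
    finally show "p \<in> S m'" unfolding S_def
      by (intro CollectI exI[of _ "\<lambda>j. if j < m then b j else 0"] conjI TrueI) (rule sym)
  qed
  have S_diff: "p - q \<in> S m" if pq: "p \<in> S m" "q \<in> S m" for p q m
  proof -
    obtain b b' where "p = (\<Sum>j<m. smult (b j) (g j))" "q = (\<Sum>j<m. smult (b' j) (g j))"
      using pq by (auto simp: S_def)
    hence "p - q = (\<Sum>j<m. smult (b j - b' j) (g j))" by (simp add: sum_subtractf smult_diff_left)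
    thus ?thesis unfolding S_def by (intro CollectI exI[of _ "\<lambda>j. b j - b' j"] conjI TrueI)
  qed
  have S_smult: "smult c p \<in> S m" if p: "p \<in> S m" for c p m
  proof -
    obtain b where "p = (\<Sum>j<m. smult (b j) (g j))" using p by (auto simp: S_def)
    hence "smult c p = (\<Sum>j<m. smult (c * b j) (g j))" by (simp add: smult_sum2)
    thus ?thesis unfolding S_def by (intro CollectI exI[of _ "\<lambda>j. c * b j"] conjI TrueI)
  qed
  have S_0: "0 \<in> S m" for m unfolding S_def by (auto intro!: exI[of _ "\<lambda>_. 0"])
  have S_sum: "(\<Sum>i\<in>I. h i) \<in> S m" if h: "\<And>i. i \<in> I \<Longrightarrow> h i \<in> S m" for I h m
    using h
  proof (induction I rule: infinite_finite_induct)
    case (insert x I)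
    have "h x - (0 - sum h I) \<in> S m" by (intro S_diff S_0) (use insert in auto)
    thus ?case using insert.hyps by simp
  qed (simp_all add: S_0)
  have M_diff: "p - q \<in> M" if pq: "p \<in> M" "q \<in> M" for p q
  proof -
    obtain a b where "p \<in> S a" "q \<in> S b" using pq unfolding M_def by blast
    hence "p \<in> S (max a b)" "q \<in> S (max a b)" using S_mono[of a "max a b"] S_mono[of b "max a b"] by auto
    hence "p - q \<in> S (max a b)" by (rule S_diff)
    thus ?thesis by (auto simp: M_def)
  qed
  have M_deg: "coeff p k = 0" if "p \<in> M" "n \<le> k" for p k
  proof -
    have "coeff (g j) k = 0" for j using deg[of j] that(2) by (intro coeff_eq_0) simp
    thus ?thesis using that(1) by (auto simp: M_def S_def coeff_sum)
  qed
  define L where "L k = {\<beta>. \<exists>p\<in>M. lead_at key p (k, \<beta>)}" for k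
  define Fk where "Fk k = (SOME F. F \<subseteq> L k \<and> finite F \<and> (\<forall>\<alpha>\<in>L k. \<exists>\<phi>\<in>F. \<phi> \<le> \<alpha>))" for k
  have Fk: "Fk k \<subseteq> L k \<and> finite (Fk k) \<and> (\<forall>\<alpha>\<in>L k. \<exists>\<phi>\<in>Fk k. \<phi> \<le> \<alpha>)" for k
    unfolding Fk_def by (rule someI_ex) (rule finite_basis_of_exponents)
  define F where "F = Sigma {..<n} Fk"
  have finF: "finite F" unfolding F_def by (rule finite_SigmaI) (simp_all add: Fk)
  define P where "P \<phi> = (SOME p. p \<in> M \<and> lead_at key p \<phi>)" for \<phi>
  have P: "P \<phi> \<in> M \<and> lead_at key (P \<phi>) \<phi>" if \<phi>: "\<phi> \<in> F" for \<phi>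
  proof -
    have "snd \<phi> \<in> L (fst \<phi>)" using \<phi> Fk[of "fst \<phi>"] unfolding F_def by auto
    hence "\<exists>p. p \<in> M \<and> lead_at key p \<phi>" unfolding L_def by auto
    thus ?thesis unfolding P_def by (rule someI_ex)
  qed
  define mm where "mm \<phi> = (SOME m. P \<phi> \<in> S m)" for \<phi>
  have mm: "P \<phi> \<in> S (mm \<phi>)" if \<phi>: "\<phi> \<in> F" for \<phi>
  proof -
    have "\<exists>m. P \<phi> \<in> S m" using P[OF \<phi>] unfolding M_def by blast
    thus ?thesis unfolding mm_def by (rule someI_ex)
  qed
  define m where "m = Max (insert 0 (mm ` F))"
  have PS: "P \<phi> \<in> S m" if "\<phi> \<in> F" for \<phi>
  proof -
    have "mm \<phi> \<le> m" unfolding m_def using finF that by (intro Max_ge) auto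
    thus ?thesis using mm[OF that] S_mono by blast
  qed
  have combS: "(\<Sum>\<phi>\<in>F. smult (q \<phi>) (P \<phi>)) \<in> S m" for q
    by (intro S_sum S_smult PS)
  have "(\<Sum>j<Suc m. smult (if j = m then 1 else 0) (g j)) = g m" by (simp add: sum.neutral)
  hence "g m \<in> S (Suc m)" unfolding S_def
    by (intro CollectI exI[of _ "\<lambda>j. if j = m then 1 else 0"] conjI TrueI) (rule sym)
  hence gm: "g m \<in> M" unfolding M_def by blast
  have "\<exists>q. g m = (\<Sum>\<phi>\<in>F. smult (q \<phi>) (P \<phi>))"
  proof (rule standard_basis_generates[OF key M_diff _ finF conjunct2[OF P] _ gm])
    show "(\<Sum>\<phi>\<in>F. smult (q \<phi>) (P \<phi>)) \<in> M" for q using combS by (auto simp: M_def)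
    fix p k \<beta> assume h: "p \<in> M" "lead_at key p (k, \<beta>)"
    have "k < n"
    proof (rule ccontr)
      assume "\<not> k < n"
      hence "coeff p k = 0" using M_deg[OF h(1), of k] by simp
      thus False using h(2) by (simp add: lead_at_def coeff2_def)
    qed
    moreover have "\<beta> \<in> L k" using h by (auto simp: L_def)
    moreover from this obtain \<phi> where "\<phi> \<in> Fk k" "\<phi> \<le> \<beta>" using Fk[of k] by blast
    ultimately show "\<exists>\<beta>'. (k, \<beta>') \<in> F \<and> \<beta>' \<le> \<beta>" by (auto simp: F_def)
  qed
  then obtain q where q: "g m = (\<Sum>\<phi>\<in>F. smult (q \<phi>) (P \<phi>))" by blast
  have "g m \<in> S m" unfolding q by (rule combS)
  thus ?thesis by (auto simp: S_def)
qed

section \<open>Roots of quasi-ordinary polynomials\<close>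

lemma embed_eq_0_iff: "embed f = 0 \<longleftrightarrow> f = 0"
  using embed_eq_iff[of f 0] unfolding embed_0 .

lemma wsubst_eq_0_iff: "weight w \<Longrightarrow> wsubst w f = 0 \<longleftrightarrow> f = 0"
  using wsubst_eq_iff[of w f 0] by (simp only: wsubst_0)

lemma inj_idom_hom_wser: "weight w \<Longrightarrow> inj_idom_hom (wser w :: ('a::idom, 'd::finite) mps \<Rightarrow> 'a hahn)"
  by unfold_locales
    (simp_all only: wsubst_add wsubst_mult embed_add embed_mult embed_eq_0_iff wsubst_eq_0_iff
      embed_0 embed_1 wsubst_0 wsubst_1)

lemma inj_idom_hom_wsubst: "weight w \<Longrightarrow> inj_idom_hom (wsubst w :: ('a::idom, 'd::finite) fracps \<Rightarrow> 'a hahn)"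
  by unfold_locales (simp_all only: wsubst_add wsubst_mult wsubst_eq_0_iff wsubst_0 wsubst_1)

lemma inj_idom_hom_embed: "inj_idom_hom (embed :: ('a::idom, 'd::finite) mps \<Rightarrow> ('a, 'd) fracps)"
  by unfold_locales (simp_all only: embed_add embed_mult embed_eq_0_iff embed_0 embed_1)

abbreviation wpoly :: "('d::finite \<Rightarrow> real) \<Rightarrow> ('a::comm_ring_1, 'd) mps poly \<Rightarrow> 'a hahn poly" where
  "wpoly w p \<equiv> map_poly (wser w) p"

lemma wpoly_simps:
  fixes p q :: "('a::idom, 'd::finite) mps poly" and P :: "'e \<Rightarrow> ('a, 'd) mps poly"
  assumes w: "weight w"
  shows "coeff (wpoly w p) i = wser w (coeff p i)" "degree (wpoly w p) = degree p"
    "wpoly w (p + q) = wpoly w p + wpoly w q" "wpoly w (p - q) = wpoly w p - wpoly w q"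
    "wpoly w (p * q) = wpoly w p * wpoly w q" "wpoly w (smult c p) = smult (wser w c) (wpoly w p)"
    "pderiv (wpoly w p) = wpoly w (pderiv p)" "wpoly w [:c:] = [:wser w c:]" "wpoly w 0 = 0"
    "wpoly w (sum P I) = (\<Sum>i\<in>I. wpoly w (P i))"
proof -
  interpret h: inj_idom_hom "wser w :: ('a, 'd) mps \<Rightarrow> 'a hahn" by (rule inj_idom_hom_wser[OF w])
  interpret mh: map_poly_inj_idom_hom "wser w :: ('a, 'd) mps \<Rightarrow> 'a hahn" ..
  show "coeff (wpoly w p) i = wser w (coeff p i)" "degree (wpoly w p) = degree p"
    "wpoly w (p + q) = wpoly w p + wpoly w q" "wpoly w (p - q) = wpoly w p - wpoly w q"
    "wpoly w (p * q) = wpoly w p * wpoly w q" "wpoly w (smult c p) = smult (wser w c) (wpoly w p)"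
    "wpoly w 0 = 0"
    by (simp_all add: mh.hom_add mh.hom_minus mh.hom_mult h.map_poly_hom_smult)
  show "wpoly w [:c:] = [:wser w c:]" by (simp add: h.map_poly_pCons_hom)
  show "wpoly w (sum P I) = (\<Sum>i\<in>I. wpoly w (P i))"
    by (induction I rule: infinite_finite_induct) (simp_all add: mh.hom_add)
  show "pderiv (wpoly w p) = wpoly w (pderiv p)" by (simp add: h.map_poly_pderiv)
qed

lemma supp_ge_0_poly:
  assumes "\<And>i. supp_ge 0 (coeff p i)" "supp_ge 0 y"
  shows "supp_ge 0 (poly p y :: 'a::comm_ring_1 hahn)"
  unfolding poly_altdef
proof (rule supp_ge_sum)
  fix i
  have "supp_ge (0 + real i * 0) (coeff p i * y ^ i)" by (intro supp_ge_mult supp_ge_power assms)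
  thus "supp_ge 0 (coeff p i * y ^ i)" by simp
qed

lemma supp_ge_0_coeff_mult:
  assumes "\<And>i. supp_ge 0 (coeff p i)" "\<And>i. supp_ge 0 (coeff q i)"
  shows "supp_ge 0 (coeff (p * q) i :: 'a::comm_ring_1 hahn)"
  unfolding coeff_mult
proof (rule supp_ge_sum)
  fix j
  have "supp_ge (0 + 0) (coeff p j * coeff q (i - j))" by (intro supp_ge_mult assms)
  thus "supp_ge 0 (coeff p j * coeff q (i - j))" by simp
qed

lemma supp_ge_0_coeff_prod_linear:
  assumes "\<And>y. y \<in> set ys \<Longrightarrow> supp_ge 0 (y :: 'a::comm_ring_1 hahn)"
  shows "supp_ge 0 (coeff (\<Prod>y\<leftarrow>ys. [:- y, 1:]) i)"
  using assms
proof (induction ys arbitrary: i)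
  case Nil
  show ?case by (cases i) (simp_all add: supp_ge_def hcoeff_1)
next
  case (Cons y ys)
  have "supp_ge 0 (coeff [:- y, 1:] j)" for j
    using Cons.prems[of y] by (auto simp: coeff_pCons supp_ge_def hcoeff_1 split: nat.splits)
  thus ?case unfolding list.map prod_list.Cons using Cons by (intro supp_ge_0_coeff_mult) auto
qed

lemma pderiv_zero_at_double_root:
  fixes p :: "'a::idom poly"
  assumes "p = [:- y, 1:] * ([:- y, 1:] * q)"
  shows "poly (pderiv p) y = 0"
  unfolding assms pderiv_mult by (simp del: mult_pCons_left)

lemma distinct_if_simple_roots:
  fixes ys :: "'a::idom list"
  assumes "\<And>y. y \<in> set ys \<Longrightarrow> poly (pderiv (\<Prod>y\<leftarrow>ys. [:- y, 1:])) y \<noteq> 0"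
  shows "distinct ys"
proof (rule ccontr)
  assume "\<not> distinct ys"
  then obtain as bs cs y where ys: "ys = as @ [y] @ bs @ [y] @ cs" using not_distinct_decomp by blast
  let ?q = "(\<Prod>y\<leftarrow>as @ bs @ cs. [:- y, 1:])"
  have "(\<Prod>y\<leftarrow>ys. [:- y, 1:]) = [:- y, 1:] * ([:- y, 1:] * ?q)"
    unfolding ys by (simp only: map_append prod_list.append list.map prod_list.Cons prod_list.Nil mult_1_right mult.assoc mult.left_commute)
  hence "poly (pderiv (\<Prod>y\<leftarrow>ys. [:- y, 1:])) y = 0" by (rule pderiv_zero_at_double_root)
  thus False using assms[of y] ys by simp
qed

text \<open>Lagrange interpolation over a domain, with the denominators \<open>p'(y)\<close> cleared.\<close>

lemma lagrange_interpolation: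
  fixes p h :: "'a::idom poly"
  assumes p: "p = (\<Prod>y\<leftarrow>ys. [:- y, 1:])" and dist: "distinct ys" and deg: "degree h < length ys"
    and d: "\<And>y. y \<in> set ys \<Longrightarrow> d = poly B y * poly (pderiv p) y"
  shows "smult d h = (\<Sum>y\<in>set ys. smult (poly h y * poly B y) (\<Prod>z\<leftarrow>remove1 y ys. [:- z, 1:]))"
proof (rule poly_eqI_degree[of "set ys"])
  let ?q = "\<lambda>y. \<Prod>z\<leftarrow>remove1 y ys. [:- z, 1:]"
  have split: "p = [:- y, 1:] * ?q y" if "y \<in> set ys" for y
  proof -
    show ?thesis unfolding p by (rule prod_list_map_remove1[OF that])
  qed
  have root: "poly (?q y) z = 0" if "z \<in> set ys" "z \<noteq> y" for y z
  proof -
    have "z \<in> set (remove1 y ys)" using that dist by simp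
    then obtain as bs where "remove1 y ys = as @ z # bs" by (meson split_list)
    thus ?thesis by (simp del: mult_pCons_left)
  qed
  fix x assume x: "x \<in> set ys"
  have "poly (pderiv p) x = poly (?q x) x"
    using arg_cong[OF split[OF x], of "\<lambda>p. poly (pderiv p) x"] unfolding pderiv_mult by (simp add: pderiv_pCons del: mult_pCons_left)
  hence "poly (smult d h) x = poly h x * poly B x * poly (?q x) x" using d[OF x] by simp
  also have "\<dots> = (\<Sum>y\<in>set ys. poly h y * poly B y * poly (?q y) x)"
  proof -
    have "(\<Sum>y\<in>set ys - {x}. poly h y * poly B y * poly (?q y) x) = 0"
    proof (rule sum.neutral, rule ballI)
      fix y assume "y \<in> set ys - {x}"
      hence "poly (?q y) x = 0" using root[OF x, of y] by blast
      thus "poly h y * poly B y * poly (?q y) x = 0" by (simp only: mult_zero_right)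
    qed
    thus ?thesis by (subst sum.remove[OF finite_set x]) (simp only: add_0_right)
  qed
  finally show "poly (smult d h) x = poly (\<Sum>y\<in>set ys. smult (poly h y * poly B y) (?q y)) x"
    by (simp add: poly_sum)
next
  show "degree (smult d h) < card (set ys)"
    using deg distinct_card[OF dist] le_less_trans[OF degree_smult_le] by metis
  have degq: "degree (\<Prod>z\<leftarrow>zs. [:- z, 1 :: 'a:]) \<le> length zs" for zs
  proof (induction zs)
    case (Cons z zs)
    have "degree ([:- z, 1:] * (\<Prod>z\<leftarrow>zs. [:- z, 1 :: 'a:])) \<le> degree [:- z, 1 :: 'a:] + degree (\<Prod>z\<leftarrow>zs. [:- z, 1 :: 'a:])"
      by (rule degree_mult_le)
    thus ?case using Cons by (simp del: mult_pCons_left)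
  qed simp
  have "degree (\<Sum>y\<in>set ys. smult (poly h y * poly B y) (\<Prod>z\<leftarrow>remove1 y ys. [:- z, 1:])) < length ys"
  proof (rule degree_sum_less)
    fix y assume y: "y \<in> set ys"
    have "degree (smult (poly h y * poly B y) (\<Prod>z\<leftarrow>remove1 y ys. [:- z, 1:])) \<le> length (remove1 y ys)"
      by (rule order.trans[OF degree_smult_le degq])
    also have "\<dots> < length ys" using y length_pos_if_in_set[OF y] by (simp add: length_remove1)
    finally show "degree (smult (poly h y * poly B y) (\<Prod>z\<leftarrow>remove1 y ys. [:- z, 1:])) < length ys" .
  qed (rule le_less_trans[OF le0 deg])
  thus "degree (\<Sum>y\<in>set ys. smult (poly h y * poly B y) (\<Prod>z\<leftarrow>remove1 y ys. [:- z, 1:])) < card (set ys)"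
    by (simp add: distinct_card[OF dist])
qed

lemma monic_remainder:
  fixes f :: "'a::comm_ring_1 poly"
  assumes "lead_coeff f = 1" "degree f > 0"
  shows "\<exists>q r. p = f * q + r \<and> degree r < degree f"
proof -
  obtain q r where qr: "pseudo_divmod p f = (q, r)" by (cases "pseudo_divmod p f")
  have nz: "f \<noteq> 0" using assms(2) by auto
  have "p = f * q + r" using pseudo_divmod(1)[OF nz qr] assms(1) by simp
  moreover have "degree r < degree f" using pseudo_divmod(2)[OF nz qr] assms(2) by auto
  ultimately show ?thesis by blast
qed

text \<open>Division by \<open>X\<^sup>\<delta>\<close>, forgetting the terms that are not divisible.\<close>

definition shift_series :: "('d \<Rightarrow> nat) \<Rightarrow> ('a::comm_ring_1, 'd::finite) mps \<Rightarrow> ('a, 'd) mps" where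
  "shift_series \<delta> a = Abs_pser (\<lambda>\<beta>. pcoeff a (\<delta> + \<beta>))"

lemma pcoeff_shift_series: "pcoeff (shift_series \<delta> a) \<beta> = pcoeff a (\<delta> + \<beta>)"
  unfolding shift_series_def pcoeff_Abs_mps ..

lemma grid_1_UNIV: "(\<delta> :: 'd \<Rightarrow> nat) \<in> grid 1"
  unfolding grid_nat by (rule UNIV_I)

lemma nat_one_pos: "(0::nat) < 1"
  by simp

lemma pcoeff_X_pow_mps: "pcoeff (X_pow \<epsilon> :: ('a::comm_ring_1, 'd::finite) mps) \<beta> = (if \<beta> = \<epsilon> then 1 else 0)"
proof -
  have "\<exists>k>0. \<epsilon> \<in> grid k" by (intro exI[of _ "1::nat"] conjI grid_1_UNIV nat_one_pos)
  thus ?thesis by (simp add: X_pow.rep_eq)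
qed

lemma pcoeff_X_pow_mult_mps:
  "pcoeff (X_pow \<delta> * u :: ('a::comm_ring_1, 'd::finite) mps) (\<delta> + \<beta>) = pcoeff u \<beta>"
  "pcoeff (X_pow \<delta> * u :: ('a::comm_ring_1, 'd::finite) mps) \<gamma> \<noteq> 0 \<Longrightarrow> \<delta> \<le> \<gamma>"
proof -
  show "pcoeff (X_pow \<delta> * u) (\<delta> + \<beta>) = pcoeff u \<beta>"
    by (rule pcoeff_X_pow_mult(1)[OF grid_1_UNIV nat_one_pos])
  assume "pcoeff (X_pow \<delta> * u) \<gamma> \<noteq> 0"
  from pcoeff_X_pow_mult(2)[OF grid_1_UNIV nat_one_pos this]
  obtain \<beta> where "\<gamma> = \<delta> + \<beta>" by blast
  thus "\<delta> \<le> \<gamma>" by (simp add: le_fun_def)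
qed

lemma X_pow_shift_series:
  assumes "\<And>\<beta>. pcoeff a \<beta> \<noteq> 0 \<Longrightarrow> \<delta> \<le> \<beta>"
  shows "a = X_pow \<delta> * shift_series \<delta> a"
proof (rule pser_eqI)
  fix \<gamma>
  show "pcoeff a \<gamma> = pcoeff (X_pow \<delta> * shift_series \<delta> a) \<gamma>"
  proof (cases "\<delta> \<le> \<gamma>")
    case True
    hence eq: "\<gamma> = \<delta> + (\<gamma> - \<delta>)" by (auto simp: le_fun_def fun_eq_iff)
    show ?thesis
      by (subst (2) eq, subst pcoeff_X_pow_mult_mps(1), subst pcoeff_shift_series, subst eq[symmetric]) (rule refl)
  next
    case False
    thus ?thesis using assms[of \<gamma>] pcoeff_X_pow_mult_mps(2)[of \<delta> "shift_series \<delta> a" \<gamma>]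
      by (cases "pcoeff a \<gamma> = 0"; cases "pcoeff (X_pow \<delta> * shift_series \<delta> a) \<gamma> = 0") simp_all
  qed
qed

lemma X_pow_0 [simp]: "X_pow (0 :: 'd::finite \<Rightarrow> nat) = (1 :: ('a::comm_ring_1, 'd) mps)"
  by (rule pser_eqI) (simp add: pcoeff_X_pow_mps pcoeff_1)

lemma X_pow_add:
  "X_pow (\<gamma> + \<delta>) = (X_pow \<gamma> * X_pow \<delta> :: ('a::comm_ring_1, 'd::finite) mps)"
proof (rule pser_eqI)
  fix \<beta>
  show "pcoeff (X_pow (\<gamma> + \<delta>) :: ('a, 'd) mps) \<beta> = pcoeff (X_pow \<gamma> * X_pow \<delta> :: ('a, 'd) mps) \<beta>"
  proof (cases "\<gamma> \<le> \<beta>")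
    case True
    then obtain \<epsilon> where eq: "\<beta> = \<gamma> + \<epsilon>"
      by (intro that[of "\<beta> - \<gamma>"]) (auto simp: le_fun_def fun_eq_iff)
    have "pcoeff (X_pow \<gamma> * X_pow \<delta> :: ('a, 'd) mps) \<beta> = pcoeff (X_pow \<delta> :: ('a, 'd) mps) \<epsilon>"
      unfolding eq by (rule pcoeff_X_pow_mult_mps(1))
    thus ?thesis by (simp add: pcoeff_X_pow_mps eq)
  next
    case False
    hence "pcoeff (X_pow \<gamma> * X_pow \<delta> :: ('a, 'd) mps) \<beta> = 0" using pcoeff_X_pow_mult_mps(2) by blast
    moreover have "\<beta> \<noteq> \<gamma> + \<delta>" using False by (auto simp: le_fun_def)
    ultimately show ?thesis by (simp add: pcoeff_X_pow_mps)
  qed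
qed

lemma X_pow_power:
  "(X_pow \<alpha> :: ('a::comm_ring_1, 'd::finite) mps) ^ e = X_pow (\<lambda>i. e * \<alpha> i)"
proof (induction e)
  case 0
  have "(\<lambda>i. 0 * \<alpha> i) = 0" by (auto simp: fun_eq_iff)
  thus ?case by simp
next
  case (Suc e)
  have "(\<lambda>i. Suc e * \<alpha> i) = \<alpha> + (\<lambda>i. e * \<alpha> i)" by (auto simp: fun_eq_iff)
  thus ?case by (simp add: Suc X_pow_add)
qed

lemma resultant_of_quasi_ordinary:
  fixes f :: "('a::field, 'd::finite) mps poly"
  assumes "quasi_ordinary f"
  shows "\<exists>\<alpha> u. resultant f (pderiv f) = X_pow \<alpha> * u \<and> const_term u \<noteq> 0"
proof -
  obtain \<alpha> u where u: "monic_discriminant f = X_pow \<alpha> * u" "const_term u \<noteq> 0"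
    using assms by (auto simp: quasi_ordinary_def)
  let ?N = "degree f * (degree f - 1) div 2"
  let ?s = "(-1) ^ ?N :: ('a, 'd) mps"
  have "?s * ?s = 1" by (simp add: power_add[symmetric] mult_2[symmetric])
  hence "resultant f (pderiv f) = ?s * (?s * resultant f (pderiv f))"
    by (simp only: mult.assoc[symmetric] mult_1_left)
  also have "?s * resultant f (pderiv f) = X_pow \<alpha> * u"
    using u(1) unfolding monic_discriminant_def .
  also have "?s * (X_pow \<alpha> * u) = X_pow \<alpha> * (?s * u)" by (rule mult.left_commute)
  finally have "resultant f (pderiv f) = X_pow \<alpha> * (?s * u)" .
  moreover have "const_term ((-1) ^ ?N * u) \<noteq> 0" using u(2) by (cases "even ?N") simp_all
  ultimately show ?thesis by blast
qed

lemma map_poly_hderiv_wpoly: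
  fixes p :: "('a::field_char_0, 'd::finite) mps poly"
  assumes w: "weight w" and l: "\<And>\<alpha>. l (wdot w \<alpha>) = \<alpha> i"
  shows "map_poly (hderiv l) (wpoly w p) = wpoly w (map_poly (euler_deriv i) p)"
proof (rule poly_eqI)
  fix k
  have "euler_deriv i 0 = (0 :: ('a, 'd) mps)"
    by (rule pser_eqI) (simp add: euler_deriv_def pcoeff_Abs_mps)
  thus "coeff (map_poly (hderiv l) (wpoly w p)) k = coeff (wpoly w (map_poly (euler_deriv i) p)) k"
    by (simp add: coeff_map_poly w hderiv_wser[OF w l])
qed

text \<open>A derivation along which \<open>X\<^sub>i\<close> is an eigenvector and the other variables are constant.\<close>

definition euler_along :: "('d::finite \<Rightarrow> real) \<Rightarrow> 'd \<Rightarrow> (real \<Rightarrow> rat) \<Rightarrow> bool" where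
  "euler_along w i l \<longleftrightarrow> weight w \<and> additive_fun l \<and> (\<forall>\<alpha>. l (wdot w \<alpha>) = \<alpha> i)"

lemma hderiv_root:
  fixes f :: "('a::field_char_0, 'd::finite) mps poly"
  assumes e: "euler_along w i l" and y: "poly (wpoly w f) y = 0"
  shows "poly (wpoly w (map_poly (euler_deriv i) f)) y + poly (wpoly w (pderiv f)) y * hderiv l y = 0"
proof -
  have w: "weight w" and l: "additive_fun l" "\<And>\<alpha>. l (wdot w \<alpha>) = \<alpha> i"
    using e by (auto simp: euler_along_def)
  show ?thesis
    using hderiv_poly[OF l(1), of "wpoly w f" y] y
    by (simp add: map_poly_hderiv_wpoly[OF w l(2)] wpoly_simps[OF w])
qed

text \<open>The induction step for iterated derivatives: \<open>E z\<close> is a polynomial in the root, \<open>r\<close> is the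
  derivative of the root, and \<open>D r\<close> is a polynomial in the root as well.\<close>

lemma leibniz_rearrange:
  "E' * z + E * z' = P + Q * r \<Longrightarrow> D * E * E * z' = D * E * P + E * Q * (D * r) - D * E' * (E * (z :: 'a::comm_ring_1))"
proof -
  assume h: "E' * z + E * z' = P + Q * r"
  have "D * E * E * z' = D * E * (E' * z + E * z') - D * E' * (E * z)" by (simp add: algebra_simps)
  thus ?thesis unfolding h by (simp add: algebra_simps)
qed

text \<open>Every iterated derivative of a root is, up to a power of the resultant, a polynomial in the
  root, and this polynomial is independent of the weight.\<close>

lemma iterated_derivative_as_polynomial:
  fixes f :: "('a::field_char_0, 'd::finite) mps poly"
  assumes lc: "lead_coeff f = 1" and deg: "degree f > 0"
    and D: "[:D:] = A * f + B * pderiv f"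
  shows "\<exists>h e. degree h < degree f \<and> (\<forall>w l y. euler_along w i l \<longrightarrow> poly (wpoly w f) y = 0 \<longrightarrow>
    wser w D ^ e * (hderiv l ^^ j) y = poly (wpoly w h) y)"
proof (induction j)
  case 0
  obtain q r where qr: "[:0, 1:] = f * q + r" "degree r < degree f"
    using monic_remainder[OF lc deg] by blast
  have "wser w D ^ 0 * (hderiv l ^^ 0) y = poly (wpoly w r) y"
    if e: "euler_along w i l" and y: "poly (wpoly w f) y = 0" for w l y
  proof -
    have w: "weight w" using e by (simp add: euler_along_def)
    have X: "wpoly w [:0, 1:] = [:0, 1:]"
      by (rule poly_eqI) (simp add: wpoly_simps[OF w] coeff_pCons w split: nat.splits)
    have "[:0, 1:] = wpoly w f * wpoly w q + wpoly w r"
      using arg_cong[OF qr(1), of "wpoly w"] unfolding X wpoly_simps(3,5)[OF w] .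
    hence "poly [:0, 1:] y = poly (wpoly w f * wpoly w q + wpoly w r) y" by (rule arg_cong)
    thus ?thesis using y by simp
  qed
  thus ?case using qr(2) by (intro exI[of _ r] exI[of _ 0]) simp
next
  case (Suc j)
  then obtain h e where he: "degree h < degree f \<and> (\<forall>w l y. euler_along w i l \<longrightarrow> poly (wpoly w f) y = 0 \<longrightarrow>
    wser w D ^ e * (hderiv l ^^ j) y = poly (wpoly w h) y)" by (elim exE) (rule that)
  have h: "wser w D ^ e * (hderiv l ^^ j) y = poly (wpoly w h) y"
    if "euler_along w i l" "poly (wpoly w f) y = 0" for w l y
    using conjunct2[OF he, rule_format, OF that] .
  let ?d = "euler_deriv i :: ('a, 'd) mps \<Rightarrow> _"
  define b where "b = - (B * map_poly ?d f)"
  define p where "p = smult (D ^ Suc e) (map_poly ?d h) + smult (D ^ e) (pderiv h * b) - smult (D * ?d (D ^ e)) h"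
  obtain q r where qr: "p = f * q + r" "degree r < degree f" using monic_remainder[OF lc deg] by blast
  have "wser w D ^ Suc (2 * e) * (hderiv l ^^ Suc j) y = poly (wpoly w r) y"
    if e: "euler_along w i l" and y: "poly (wpoly w f) y = 0" for w l y
  proof -
    have w: "weight w" and l: "additive_fun l" "\<And>\<alpha>. l (wdot w \<alpha>) = \<alpha> i"
      using e by (auto simp: euler_along_def)
    interpret w: inj_idom_hom "wser w :: ('a, 'd) mps \<Rightarrow> 'a hahn" by (rule inj_idom_hom_wser[OF w])
    let ?D = "wser w D" and ?z = "(hderiv l ^^ j) y" and ?E = "wser w (D ^ e)"
    have DB: "?D = poly (wpoly w B) y * poly (wpoly w (pderiv f)) y"
    proof -
      have "wpoly w [:D:] = wpoly w A * wpoly w f + wpoly w B * wpoly w (pderiv f)"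
        unfolding D by (simp add: wpoly_simps[OF w])
      hence "poly [:?D:] y = poly (wpoly w A * wpoly w f + wpoly w B * wpoly w (pderiv f)) y"
        by (simp only: wpoly_simps[OF w])
      thus ?thesis using y by simp
    qed
    have Dy: "?D * hderiv l y = poly (wpoly w b) y"
    proof -
      have "poly (wpoly w (pderiv f)) y * hderiv l y = - poly (wpoly w (map_poly ?d f)) y"
        using hderiv_root[OF e y] by (simp add: eq_neg_iff_add_eq_0 add.commute)
      hence "?D * hderiv l y = poly (wpoly w B) y * (- poly (wpoly w (map_poly ?d f)) y)"
        unfolding DB by (simp only: mult.assoc)
      moreover have "wpoly w b = wpoly w 0 - wpoly w B * wpoly w (map_poly ?d f)"
      proof -
        have "b = 0 - B * map_poly ?d f" by (simp add: b_def)
        thus ?thesis by (simp only: wpoly_simps(4,5)[OF w])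
      qed
      ultimately show ?thesis by (simp add: wpoly_simps(9)[OF w])
    qed
    have IH: "?E * ?z = poly (wpoly w h) y" using h[OF e y] by (simp only: w.hom_power)
    have "hderiv l ?E * ?z + ?E * hderiv l ?z = poly (wpoly w (map_poly ?d h)) y + poly (wpoly w (pderiv h)) y * hderiv l y"
      using arg_cong[OF IH, of "hderiv l"]
      unfolding hderiv_mult[OF l(1)] hderiv_poly[OF l(1)] map_poly_hderiv_wpoly[OF w l(2)] wpoly_simps(7)[OF w] .
    hence "?D * ?E * ?E * hderiv l ?z
      = ?D * ?E * poly (wpoly w (map_poly ?d h)) y + ?E * poly (wpoly w (pderiv h)) y * (?D * hderiv l y)
        - ?D * hderiv l ?E * (?E * ?z)"
      by (rule leibniz_rearrange)
    also have "\<dots> = poly (wpoly w p) y"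
      unfolding Dy IH p_def hderiv_wser[OF w l(2)] by (simp add: wpoly_simps[OF w] w.hom_mult w.hom_power mult_ac)
    also have "\<dots> = poly (wpoly w r) y" unfolding qr(1) using y by (simp add: wpoly_simps[OF w])
    also have "?D * ?E * ?E * hderiv l ?z = ?D ^ Suc (2 * e) * hderiv l ?z"
      by (simp add: w.hom_power power_add[symmetric] mult_2 mult.assoc[symmetric])
    finally show ?thesis by simp
  qed
  thus ?case using qr(2) by (intro exI[of _ r] exI[of _ "Suc (2 * e)"]) simp
qed

lemma supp_ge_hderiv_iter: "supp_ge r y \<Longrightarrow> supp_ge r ((hderiv l ^^ j) y)"
  by (induction j) (auto intro: supp_ge_hderiv)

lemma wpoly_splits:
  fixes f :: "('a::alg_closed_field, 'd::finite) mps poly"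
  assumes w: "weight w" and lc: "lead_coeff f = 1"
  shows "\<exists>ys. length ys = degree f \<and> wpoly w f = (\<Prod>y\<leftarrow>ys. [:- y, 1:])"
proof -
  have "lead_coeff (wpoly w f) = 1" using lc w by (simp add: wpoly_simps[OF w])
  from monic_splits_if_roots[OF hahn_poly_has_root this] show ?thesis
    by (simp add: wpoly_simps(2)[OF w])
qed

lemma wpoly_root_supp_ge_0:
  fixes f :: "('a::idom, 'd::finite) mps poly"
  assumes w: "weight w" and lc: "lead_coeff f = 1" and y: "poly (wpoly w f) y = 0"
  shows "supp_ge 0 y"
  by (rule hahn_root_supp_ge_0[OF _ _ y]) (simp_all add: wpoly_simps[OF w] lc w supp_ge_0_wsubst)

text \<open>Integrality of the values at all roots bounds the coefficients from below, by interpolation.\<close>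

lemma coeff_order_by_interpolation:
  fixes f :: "('a::{alg_closed_field, field_char_0}, 'd::finite) mps poly"
  assumes w: "weight w" and lc: "lead_coeff f = 1" and D: "[:D:] = A * f + B * pderiv f" "D \<noteq> 0"
    and deg: "degree h < degree f"
    and val: "\<And>y. poly (wpoly w f) y = 0 \<Longrightarrow> supp_ge r (poly (wpoly w h) y)"
  shows "supp_ge r (wser w (D * coeff h k))"
proof -
  interpret w: inj_idom_hom "wser w :: ('a, 'd) mps \<Rightarrow> 'a hahn" by (rule inj_idom_hom_wser[OF w])
  obtain ys where ys: "length ys = degree f" "wpoly w f = (\<Prod>y\<leftarrow>ys. [:- y, 1:])"
    using wpoly_splits[OF w lc] by blast
  have root: "poly (wpoly w f) y = 0" if y: "y \<in> set ys" for y
  proof -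
    obtain as bs where "ys = as @ y # bs" using split_list[OF y] by blast
    thus ?thesis unfolding ys(2) by (simp del: mult_pCons_left)
  qed
  have DB: "wser w D = poly (wpoly w B) y * poly (pderiv (wpoly w f)) y" if y: "y \<in> set ys" for y
  proof -
    have "wpoly w [:D:] = wpoly w A * wpoly w f + wpoly w B * wpoly w (pderiv f)"
      unfolding D(1) by (simp add: wpoly_simps[OF w])
    hence "poly [:wser w D:] y = poly (wpoly w A * wpoly w f + wpoly w B * wpoly w (pderiv f)) y"
      by (simp only: wpoly_simps[OF w])
    thus ?thesis using root[OF y] by (simp add: wpoly_simps(7)[OF w])
  qed
  have nz: "wser w D \<noteq> 0" using D(2) by simp
  have dist: "distinct ys"
  proof (rule distinct_if_simple_roots)
    fix y assume "y \<in> set ys"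
    from DB[OF this] nz show "poly (pderiv (\<Prod>y\<leftarrow>ys. [:- y, 1:])) y \<noteq> 0"
      unfolding ys(2)[symmetric] by (intro notI) (simp only: mult_zero_right)
  qed
  have lagr: "smult (wser w D) (wpoly w h)
      = (\<Sum>y\<in>set ys. smult (poly (wpoly w h) y * poly (wpoly w B) y) (\<Prod>z\<leftarrow>remove1 y ys. [:- z, 1:]))"
    by (rule lagrange_interpolation[OF ys(2) dist _ DB])
      (simp only: ys(1) deg wpoly_simps(2)[OF w])
  have "wser w D * wser w (coeff h k)
      = coeff (\<Sum>y\<in>set ys. smult (poly (wpoly w h) y * poly (wpoly w B) y) (\<Prod>z\<leftarrow>remove1 y ys. [:- z, 1:])) k"
    using arg_cong[OF lagr, of "\<lambda>p. coeff p k"] by (simp only: coeff_smult wpoly_simps(1)[OF w])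
  also have "\<dots> = (\<Sum>y\<in>set ys. poly (wpoly w h) y * poly (wpoly w B) y * coeff (\<Prod>z\<leftarrow>remove1 y ys. [:- z, 1:]) k)"
    by (simp only: coeff_sum coeff_smult)
  also have "supp_ge r \<dots>"
  proof (rule supp_ge_sum)
    fix y assume y: "y \<in> set ys"
    have 0: "supp_ge 0 z" if z: "z \<in> set ys" for z by (rule wpoly_root_supp_ge_0[OF w lc root[OF z]])
    have "supp_ge (r + 0 + 0) (poly (wpoly w h) y * poly (wpoly w B) y * coeff (\<Prod>z\<leftarrow>remove1 y ys. [:- z, 1:]) k)"
    proof (intro supp_ge_mult)
      show "supp_ge r (poly (wpoly w h) y)" by (rule val[OF root[OF y]])
      show "supp_ge 0 (poly (wpoly w B) y)"
        by (rule supp_ge_0_poly[OF _ 0[OF y]]) (simp add: wpoly_simps[OF w] w supp_ge_0_wsubst)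
      show "supp_ge 0 (coeff (\<Prod>z\<leftarrow>remove1 y ys. [:- z, 1:]) k)"
        by (rule supp_ge_0_coeff_prod_linear, rule 0) (erule set_mp[OF set_remove1_subset])
    qed
    thus "supp_ge r (poly (wpoly w h) y * poly (wpoly w B) y * coeff (\<Prod>z\<leftarrow>remove1 y ys. [:- z, 1:]) k)" by simp
  qed
  finally show ?thesis by (simp add: w.hom_mult)
qed

lemma wdot_rat_exp_scale: "wdot w (rat_exp (\<lambda>i. e * \<alpha> i)) = real e * wdot w (rat_exp \<alpha>)"
  by (simp add: wdot_def rat_exp_def of_rat_mult sum_distrib_left mult.assoc)

text \<open>Hence the module generated by the iterated derivatives of the roots lies in a finitely
  generated one, and the roots satisfy a linear differential equation with regular coefficients.\<close>

lemma derivative_in_module: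
  fixes f :: "('a::{alg_closed_field, field_char_0}, 'd::finite) mps poly"
  assumes lc: "lead_coeff f = 1" and deg: "degree f > 0"
    and D: "[:D:] = A * f + B * pderiv f" "D = X_pow \<alpha> * u" "const_term u \<noteq> 0"
  shows "\<exists>g e. degree g < degree f \<and> (\<forall>w l y. euler_along w i l \<longrightarrow> poly (wpoly w f) y = 0 \<longrightarrow>
    wser w (u ^ e) * wser w D * (hderiv l ^^ j) y = poly (wpoly w g) y)"
proof -
  obtain h e where he: "degree h < degree f \<and> (\<forall>w l y. euler_along w i l \<longrightarrow> poly (wpoly w f) y = 0 \<longrightarrow>
    wser w D ^ e * (hderiv l ^^ j) y = poly (wpoly w h) y)"
    using iterated_derivative_as_polynomial[OF lc deg D(1), of i j] by (elim exE) (rule that)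
  note h = conjunct1[OF he] conjunct2[OF he, rule_format]
  have Dm: "monomial_unit D \<alpha>" unfolding D(2) by (rule monomial_unit_X_pow[OF grid_1_UNIV nat_one_pos D(3)])
  have Dnz: "D \<noteq> 0" using Dm by (auto simp: monomial_unit_def)
  define \<delta> where "\<delta> = (\<lambda>i. e * \<alpha> i)"
  have le: "\<delta> \<le> \<beta>" if nz: "pcoeff (D * coeff h k) \<beta> \<noteq> 0" for k \<beta>
  proof -
    have "rat_exp \<delta> \<le> rat_exp \<beta>"
    proof (rule le_if_wdot_le)
      fix w :: "'d \<Rightarrow> real" assume w: "weight w"
      obtain l :: "real \<Rightarrow> rat" where l: "additive_fun l" "\<And>\<alpha>. l (wdot w \<alpha>) = \<alpha> i"
        by (rule coordinate_functional[OF w, of i]) (rule that)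
      have el: "euler_along w i l" using w l by (simp add: euler_along_def)
      have "supp_ge (wdot w (rat_exp \<alpha>)) (wser w D)"
        by (rule wsubst_monomial_unit[OF w monomial_unit_embed[OF Dm]])
      hence De: "supp_ge (real e * wdot w (rat_exp \<alpha>)) (wser w D ^ e)" by (rule supp_ge_power)
      have "supp_ge (real e * wdot w (rat_exp \<alpha>)) (wser w (D * coeff h k))"
      proof (rule coeff_order_by_interpolation[OF w lc D(1) Dnz h(1)])
        fix y assume y: "poly (wpoly w f) y = 0"
        have "supp_ge (real e * wdot w (rat_exp \<alpha>) + 0) (wser w D ^ e * (hderiv l ^^ j) y)"
          by (intro supp_ge_mult De supp_ge_hderiv_iter wpoly_root_supp_ge_0[OF w lc y])
        thus "supp_ge (real e * wdot w (rat_exp \<alpha>)) (poly (wpoly w h) y)" using h(2)[OF el y] by simp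
      qed
      hence "real e * wdot w (rat_exp \<alpha>) \<le> wdot w (rat_exp \<beta>)"
        using nz unfolding supp_ge_wsubst_iff[OF w] by simp
      thus "wdot w (rat_exp \<delta>) \<le> wdot w (rat_exp \<beta>)" by (simp add: \<delta>_def wdot_rat_exp_scale)
    qed
    thus ?thesis by simp
  qed
  define g where "g = map_poly (shift_series \<delta>) (smult D h)"
  have s0: "shift_series \<delta> 0 = (0 :: ('a, 'd) mps)" by (rule pser_eqI) (simp add: pcoeff_shift_series)
  have g: "smult D h = smult (X_pow \<delta>) g"
  proof (rule poly_eqI)
    fix k show "coeff (smult D h) k = coeff (smult (X_pow \<delta>) g) k"
      using X_pow_shift_series[OF le[of k]] by (simp add: g_def coeff_map_poly s0)
  qed
  have "degree g \<le> degree (smult D h)" unfolding g_def by (rule degree_map_poly_le)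
  also have "\<dots> \<le> degree h" by (rule degree_smult_le)
  finally have degg: "degree g < degree f" using h(1) by simp
  have "wser w (u ^ e) * wser w D * (hderiv l ^^ j) y = poly (wpoly w g) y"
    if el: "euler_along w i l" and y: "poly (wpoly w f) y = 0" for w l y
  proof -
    have w: "weight w" using el by (simp add: euler_along_def)
    interpret w: inj_idom_hom "wser w :: ('a, 'd) mps \<Rightarrow> 'a hahn" by (rule inj_idom_hom_wser[OF w])
    have X: "X_pow \<delta> \<noteq> (0 :: ('a, 'd) mps)"
      using pcoeff_X_pow_mps[of \<delta> \<delta>, where 'a = 'a] by auto
    have De: "D ^ e = X_pow \<delta> * u ^ e" unfolding D(2) power_mult_distrib X_pow_power \<delta>_def ..
    have "wser w D * (wser w D ^ e * (hderiv l ^^ j) y) = poly (wpoly w (smult D h)) y"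
      using h(2)[OF el y] by (simp add: wpoly_simps[OF w])
    also have "\<dots> = wser w (X_pow \<delta>) * poly (wpoly w g) y" unfolding g by (simp add: wpoly_simps[OF w])
    also have "wser w D * (wser w D ^ e * (hderiv l ^^ j) y)
        = wser w (X_pow \<delta>) * (wser w (u ^ e) * wser w D * (hderiv l ^^ j) y)"
      unfolding w.hom_power[symmetric] De w.hom_mult by (simp only: mult_ac)
    finally show ?thesis using X by simp
  qed
  thus ?thesis using degg by (intro exI[of _ g] exI[of _ e]) simp
qed

lemma const_term_mult:
  "const_term (a * b :: ('a::comm_ring_1, 'd::finite) mps) = const_term a * const_term b"
proof -
  have 0: "\<gamma> = 0" if "\<gamma> \<le> 0" for \<gamma> :: "'d \<Rightarrow> nat"
    using that by (intro ext) (simp add: le_fun_def)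
  have S: "{\<gamma>. \<gamma> \<le> (0 :: 'd \<Rightarrow> nat)} = {0}"
    by (intro equalityI subsetI) (use 0 in blast, simp)
  show ?thesis unfolding pcoeff_mult_mps S by simp
qed

lemma roots_satisfy_linear_ode:
  fixes f :: "('a::{alg_closed_field, field_char_0}, 'd::finite) mps poly"
  assumes lc: "lead_coeff f = 1" and deg: "degree f > 0"
    and D: "resultant f (pderiv f) = X_pow \<alpha> * u" "const_term u \<noteq> 0"
  shows "\<exists>m c. const_term (c m) \<noteq> 0 \<and> (\<forall>w l y. euler_along w i l \<longrightarrow> poly (wpoly w f) y = 0 \<longrightarrow>
    (\<Sum>j\<le>m. wser w (c j) * (hderiv l ^^ j) y) = 0)"
proof -
  let ?D = "resultant f (pderiv f)"
  obtain A B where AB: "[:?D:] = A * f + B * pderiv f" using resultant_as_combination[OF deg] by blast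
  define ok where "ok j g e \<longleftrightarrow> degree g < degree f \<and> (\<forall>w l y. euler_along w i l \<longrightarrow> poly (wpoly w f) y = 0 \<longrightarrow>
    wser w (u ^ e) * wser w ?D * (hderiv l ^^ j) y = poly (wpoly w g) y)" for j g and e :: nat
  have "\<exists>g e. ok j g e" for j
    unfolding ok_def by (rule derivative_in_module[OF lc deg AB D])
  hence "\<forall>j. \<exists>p. ok j (fst p) (snd p)" by simp
  then obtain p where p: "\<And>j. ok j (fst (p j)) (snd (p j))" using choice[of "\<lambda>j p. ok j (fst p) (snd p)"] by blast
  define g where "g j = fst (p j)" for j
  define e where "e j = snd (p j)" for j
  have gdeg: "degree (g j) < degree f" for j using p[of j] by (simp add: ok_def g_def)
  have ge: "wser w (u ^ e j) * wser w ?D * (hderiv l ^^ j) y = poly (wpoly w (g j)) y"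
    if "euler_along w i l" "poly (wpoly w f) y = 0" for w l y j
    using p[of j] that by (simp add: ok_def g_def e_def)
  obtain m b where mb: "g m = (\<Sum>j<m. smult (b j) (g j))"
    using bounded_degree_sequence_relation[of g "degree f"] gdeg by blast
  define c where "c j = (if j = m then u ^ e m else - (b j * u ^ e j))" for j
  have "?D \<noteq> 0"
  proof -
    have "monomial_unit ?D \<alpha>" unfolding D(1) by (rule monomial_unit_X_pow[OF grid_1_UNIV nat_one_pos D(2)])
    thus ?thesis by (auto simp: monomial_unit_def)
  qed
  have cu: "const_term (u ^ k) = const_term u ^ k" for k
  proof (induction k)
    case 0
    show ?case by (simp only: power_0 pcoeff_1 refl if_True)
  next
    case (Suc k)
    show ?case unfolding power_Suc const_term_mult Suc ..
  qed
  have "(\<Sum>j\<le>m. wser w (c j) * (hderiv l ^^ j) y) = 0"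
    if el: "euler_along w i l" and y: "poly (wpoly w f) y = 0" for w l y
  proof -
    have w: "weight w" using el by (simp add: euler_along_def)
    interpret w: inj_idom_hom "wser w :: ('a, 'd) mps \<Rightarrow> 'a hahn" by (rule inj_idom_hom_wser[OF w])
    have "poly (wpoly w (g m)) y = (\<Sum>j<m. wser w (b j) * poly (wpoly w (g j)) y)"
      unfolding mb wpoly_simps(6,10)[OF w] poly_sum poly_smult ..
    hence "wser w (u ^ e m) * wser w ?D * (hderiv l ^^ m) y
        = (\<Sum>j<m. wser w (b j) * (wser w (u ^ e j) * wser w ?D * (hderiv l ^^ j) y))"
      by (simp only: ge[OF el y])
    hence "wser w ?D * (wser w (u ^ e m) * (hderiv l ^^ m) y)
        = wser w ?D * (\<Sum>j<m. wser w (b j * u ^ e j) * (hderiv l ^^ j) y)"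
      by (simp only: sum_distrib_left w.hom_mult mult_ac)
    hence eq: "wser w (u ^ e m) * (hderiv l ^^ m) y = (\<Sum>j<m. wser w (b j * u ^ e j) * (hderiv l ^^ j) y)"
      using \<open>?D \<noteq> 0\<close> by simp
    have neg: "wser w (- x) = - wser w x" for x :: "('a, 'd) mps" by (rule w.hom_uminus)
    have 1: "(\<Sum>j\<le>m. wser w (c j) * (hderiv l ^^ j) y)
        = (\<Sum>j<m. wser w (c j) * (hderiv l ^^ j) y) + wser w (c m) * (hderiv l ^^ m) y"
      by (simp only: lessThan_Suc_atMost[symmetric] sum.lessThan_Suc)
    have 2: "(\<Sum>j<m. wser w (c j) * (hderiv l ^^ j) y) = (\<Sum>j<m. - (wser w (b j * u ^ e j) * (hderiv l ^^ j) y))"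
    proof (rule sum.cong[OF refl])
      fix j assume "j \<in> {..<m}"
      hence "c j = - (b j * u ^ e j)" by (simp add: c_def)
      thus "wser w (c j) * (hderiv l ^^ j) y = - (wser w (b j * u ^ e j) * (hderiv l ^^ j) y)"
        by (simp only: neg mult_minus_left)
    qed
    have "c m = u ^ e m" by (simp add: c_def)
    hence 3: "wser w (c m) * (hderiv l ^^ m) y = (\<Sum>j<m. wser w (b j * u ^ e j) * (hderiv l ^^ j) y)"
      using eq by (simp only:)
    show ?thesis unfolding 1 2 3 sum_negf by (rule left_minus)
  qed
  moreover have "const_term (c m) \<noteq> 0" unfolding c_def if_True simp_thms cu using D(2) by (rule power_not_zero)
  ultimately show ?thesis by (intro exI[of _ m] exI[of _ c] conjI allI impI)
qed

lemma hcoeff_hderiv_iter: "hcoeff ((hderiv l ^^ j) y) a = of_rat (l a) ^ j * hcoeff y a"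
  by (induction j) (simp_all add: mult.assoc)

lemma hcoeff_mult_isolated:
  fixes x z :: "'a::comm_ring_1 hahn"
  assumes "\<And>b. hcoeff x b \<noteq> 0 \<Longrightarrow> b \<noteq> 0 \<Longrightarrow> hcoeff z (a - b) = 0"
  shows "hcoeff (x * z) a = hcoeff x 0 * hcoeff z a"
proof -
  have key: "b = 0 \<and> c = a" if "b + c = a" "hcoeff x b \<noteq> 0" "hcoeff z c \<noteq> 0" for b c
  proof -
    have "c = a - b" using that(1) by simp
    thus ?thesis using assms[of b] that(2,3) by (cases "b = 0") simp_all
  qed
  have "sum_pairs {a. hcoeff x a \<noteq> 0} {a. hcoeff z a \<noteq> 0} a
      = (if hcoeff x 0 = 0 \<or> hcoeff z a = 0 then {} else {(0, a)})"
  proof (rule Set.set_eqI)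
    fix p :: "real \<times> real"
    obtain b c where p: "p = (b, c)" by (cases p)
    show "p \<in> sum_pairs {a. hcoeff x a \<noteq> 0} {a. hcoeff z a \<noteq> 0} a
        \<longleftrightarrow> p \<in> (if hcoeff x 0 = 0 \<or> hcoeff z a = 0 then {} else {(0, a)})"
      unfolding p sum_pairs_def using key[of b c] by (cases "b = 0 \<and> c = a") auto
  qed
  thus ?thesis by (simp add: times_hahn.rep_eq hconv_def)
qed

text \<open>The indicial polynomial governs the exponents that do not come from a smaller one.\<close>

lemma exponent_of_ode_solution:
  fixes y :: "'a::field_char_0 hahn" and c :: "nat \<Rightarrow> ('a, 'd::finite) mps"
  assumes el: "euler_along w i l"
    and ode: "(\<Sum>j\<le>m. wser w (c j) * (hderiv l ^^ j) y) = 0"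
    and a: "hcoeff y a \<noteq> 0"
  shows "\<exists>n. poly (\<Sum>j\<le>m. monom (const_term (c j)) j) (of_rat (l a - of_nat n)) = 0"
proof (rule ccontr)
  assume bad: "\<nexists>n. poly (\<Sum>j\<le>m. monom (const_term (c j)) j) (of_rat (l a - of_nat n)) = 0"
  let ?P = "\<Sum>j\<le>m. monom (const_term (c j)) j"
  have w: "weight w" and l: "additive_fun l" "\<And>\<alpha>. l (wdot w \<alpha>) = \<alpha> i"
    using el by (auto simp: euler_along_def)
  define T where "T = {a. hcoeff y a \<noteq> 0 \<and> (\<forall>n. poly ?P (of_rat (l a - of_nat n)) \<noteq> 0)}"
  have "T \<subseteq> {a. hcoeff y a \<noteq> 0}" by (auto simp: T_def)
  moreover have "a \<in> T" using a bad by (simp add: T_def)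
  moreover have "well_ordered_set {a. hcoeff y a \<noteq> 0}" using hcoeff[of y] by simp
  ultimately have "\<exists>b\<in>T. \<forall>x\<in>T. b \<le> x" by (intro well_ordered_setD) auto
  then obtain b where b: "b \<in> T" "\<And>x. x \<in> T \<Longrightarrow> b \<le> x" by auto
  have iso: "hcoeff y (b - e) = 0" if e: "hcoeff (wser w (c j)) e \<noteq> 0" "e \<noteq> 0" for j e
  proof (rule ccontr)
    assume nz: "hcoeff y (b - e) \<noteq> 0"
    obtain \<alpha> where \<alpha>: "e = wdot w \<alpha>" "pcoeff (embed (c j)) \<alpha> \<noteq> 0" by (rule hcoeff_wsubst_nonzero[OF w e(1)])
    obtain \<beta> where \<beta>: "\<alpha> = rat_exp \<beta>" "pcoeff (c j) \<beta> \<noteq> 0" by (rule pcoeff_embed_nonzero[OF \<alpha>(2)])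
    have "0 \<le> e" unfolding \<alpha>(1) by (rule wdot_nonneg[OF w]) (simp add: \<beta>(1) rat_exp_def)
    hence "\<not> b \<le> b - e" using e(2) by simp
    hence "b - e \<notin> T" using b(2) by blast
    then obtain n where n: "poly ?P (of_rat (l (b - e) - of_nat n)) = 0" using nz by (auto simp: T_def)
    have "l b = l (b - e) + l e" using l(1) unfolding additive_fun_def by (metis diff_add_cancel)
    hence "l (b - e) = l b - of_nat (\<beta> i)" by (simp add: \<alpha>(1) l(2) \<beta>(1) rat_exp_def)
    hence "l (b - e) - of_nat n = l b - of_nat (\<beta> i + n)" by simp
    hence "poly ?P (of_rat (l b - of_nat (\<beta> i + n))) = 0" using n by (simp only:)
    thus False using b(1) unfolding T_def by blast
  qed
  have w0: "hcoeff (wser w x) 0 = const_term x" for x :: "('a, 'd) mps"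
    using hcoeff_wsubst_wdot[OF w, of "embed x" 0] pcoeff_embed_rat_exp[of x 0] by (simp only: wdot_0 rat_exp_0)
  have "0 = (\<Sum>j\<le>m. hcoeff (wser w (c j) * (hderiv l ^^ j) y) b)"
    unfolding hcoeff_sum[symmetric] ode by simp
  also have "\<dots> = (\<Sum>j\<le>m. const_term (c j) * of_rat (l b) ^ j * hcoeff y b)"
  proof (rule sum.cong[OF refl])
    fix j
    have "hcoeff (wser w (c j) * (hderiv l ^^ j) y) b = hcoeff (wser w (c j)) 0 * hcoeff ((hderiv l ^^ j) y) b"
      by (rule hcoeff_mult_isolated) (simp add: hcoeff_hderiv_iter iso)
    thus "hcoeff (wser w (c j) * (hderiv l ^^ j) y) b = const_term (c j) * of_rat (l b) ^ j * hcoeff y b"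
      unfolding w0 hcoeff_hderiv_iter by (simp only: mult.assoc)
  qed
  also have "\<dots> = poly ?P (of_rat (l b)) * hcoeff y b"
    by (simp only: poly_sum poly_monom sum_distrib_right)
  finally have "poly ?P (of_rat (l b)) * hcoeff y b = 0" by simp
  moreover have "hcoeff y b \<noteq> 0" "poly ?P (of_rat (l b - of_nat 0)) \<noteq> 0" using b(1) unfolding T_def by blast+
  ultimately show False by simp
qed

text \<open>One shift and one denominator serve all exponents modulo \<open>\<nat>\<close>.\<close>

lemma finite_rats_common_shift:
  assumes "finite Z"
  shows "\<exists>q M. q > 0 \<and> (\<forall>z\<in>Z. of_nat q * (z + of_nat M :: rat) \<in> \<nat>)"
  using assms
proof (induction Z)
  case empty
  show ?case by (intro exI[of _ "1::nat"]) simp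
next
  case (insert x Z)
  from insert.IH obtain q M where qM: "q > 0 \<and> (\<forall>z\<in>Z. of_nat q * (z + of_nat M :: rat) \<in> \<nat>)"
    by (elim exE) (rule that)
  obtain N :: nat where N: "- x < of_nat N" using reals_Archimedean2 by blast
  have "(0::rat) \<le> of_nat M" by (rule of_nat_0_le_iff)
  hence "0 \<le> x + of_nat (M + N)" using N unfolding of_nat_add by linarith
  from rat_multiple_in_Nats[OF this] obtain k where k: "k > 0 \<and> of_nat k * (x + of_nat (M + N)) \<in> \<nat>"
    by (elim exE) (rule that)
  have "of_nat (q * k) * (z + of_nat (M + N)) \<in> \<nat>" if z: "z \<in> insert x Z" for z
  proof (cases "z = x")
    case True
    have "of_nat (q * k) * (z + of_nat (M + N)) = of_nat q * (of_nat k * (x + of_nat (M + N)))"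
      unfolding True by (simp only: of_nat_mult mult.assoc)
    also have "\<dots> \<in> \<nat>" by (rule Nats_mult[OF of_nat_in_Nats conjunct2[OF k]])
    finally show ?thesis .
  next
    case False
    hence "z \<in> Z" using z by simp
    hence "of_nat q * (z + of_nat M) \<in> \<nat>" by (rule bspec[OF conjunct2[OF qM]])
    hence N: "of_nat k * (of_nat q * (z + of_nat M)) + of_nat (q * k * N) \<in> \<nat>"
      by (rule Nats_add[OF Nats_mult[OF of_nat_in_Nats] of_nat_in_Nats])
    have "of_nat (q * k) * (z + of_nat (M + N)) = of_nat k * (of_nat q * (z + of_nat M)) + of_nat (q * k * N)"
      by (simp only: of_nat_add of_nat_mult distrib_left mult_ac add_ac)
    thus ?thesis using N by (simp only:)
  qed
  moreover have "q * k > 0" using qM k by simp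
  ultimately show ?case by (intro exI[of _ "q * k"] exI[of _ "M + N"] conjI ballI)
qed

lemma pcoeff_X_pow_fracps:
  assumes "\<mu> \<in> grid k" "k > 0"
  shows "pcoeff (X_pow \<mu> :: ('a::comm_ring_1, 'd::finite) fracps) \<beta> = (if \<beta> = \<mu> then 1 else 0)"
proof -
  have "\<exists>k>0. \<mu> \<in> grid k" using assms by (intro exI[of _ k] conjI)
  thus ?thesis by (simp add: X_pow.rep_eq)
qed

lemma wsubst_X_pow:
  assumes "weight w" "\<mu> \<in> grid k" "k > 0"
  shows "wsubst w (X_pow \<mu>) = hmonom 1 (wdot w \<mu>)"
proof (rule hahn_eq_wsubstI[OF assms(1), symmetric])
  show "hcoeff (hmonom 1 (wdot w \<mu>)) (wdot w \<alpha>) = pcoeff (X_pow \<mu>) \<alpha>" for \<alpha>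
    using weightD(2)[OF assms(1), of \<alpha> \<mu>] by (auto simp: hcoeff_hmonom pcoeff_X_pow_fracps[OF assms(2,3)])
  show "hcoeff (hmonom 1 (wdot w \<mu>)) a = 0" if "a \<notin> range (wdot w)" for a
    using that by (auto simp: hcoeff_hmonom)
qed

text \<open>The derivation of a functional that vanishes on the span of the weights kills the coefficients of
  \<open>f\<close>, hence the simple root \<open>y\<close>, hence every exponent of \<open>y\<close>.\<close>

lemma exponent_in_span:
  fixes f :: "('a::field_char_0, 'd::finite) mps poly"
  assumes w: "weight w" and y: "poly (wpoly w f) y = 0" and simple: "poly (pderiv (wpoly w f)) y \<noteq> 0"
    and a: "hcoeff y a \<noteq> 0"
  shows "a \<in> range (wdot w)"
proof (rule ccontr)
  assume "a \<notin> range (wdot w)"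
  then obtain l :: "real \<Rightarrow> rat" where l: "additive_fun l" "\<And>\<alpha>. l (wdot w \<alpha>) = 0" "l a \<noteq> 0"
    by (rule separating_functional[OF w]) (rule that)
  have "map_poly (hderiv l) (wpoly w f) = 0"
    by (rule poly_eqI) (simp add: coeff_map_poly wpoly_simps[OF w] hderiv_wser_0[where l = l, OF w l(2)])
  hence "poly (pderiv (wpoly w f)) y * hderiv l y = 0"
    using hderiv_poly[OF l(1), of "wpoly w f" y] y by simp
  hence "hderiv l y = 0" using simple by simp
  hence "of_rat (l a) * hcoeff y a = 0" using hcoeff_hderiv[of l y a] by simp
  thus False using a l(3) by simp
qed

text \<open>The substitution \<open>Y = Z / T\<close> clears denominators.\<close>

lemma poly_homogenize:
  fixes p :: "'a::comm_ring_1 poly"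
  shows "(\<Sum>k\<le>degree p. coeff p k * t ^ (degree p - k) * (t * y) ^ k) = t ^ degree p * poly p y"
proof -
  have "coeff p k * t ^ (degree p - k) * (t * y) ^ k = t ^ degree p * (coeff p k * y ^ k)" if k: "k \<in> {..degree p}" for k
  proof -
    have "t ^ degree p = t ^ (degree p - k) * t ^ k" using k by (simp add: power_add[symmetric])
    thus ?thesis by (simp add: power_mult_distrib mult_ac)
  qed
  thus ?thesis by (simp add: poly_altdef sum_distrib_left)
qed

text \<open>The Abhyankar-Jung theorem for one root. The root found among the generalized power series has
  exponents in the span of the weights, with bounded denominators and nonnegative coordinates.\<close>

theorem quasi_ordinary_has_fractional_root:
  fixes f :: "('a::{alg_closed_field, field_char_0}, 'd::finite) mps poly"
  assumes lc: "lead_coeff f = 1" and deg: "degree f > 0" and qo: "quasi_ordinary f"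
  shows "\<exists>z. poly (map_poly embed f) z = 0"
proof -
  obtain \<alpha>0 u where D: "resultant f (pderiv f) = X_pow \<alpha>0 * u" "const_term u \<noteq> 0"
    using resultant_of_quasi_ordinary[OF qo] by (elim exE conjE) (rule that)
  let ?D = "resultant f (pderiv f)"
  have Dnz: "?D \<noteq> 0"
  proof -
    have "monomial_unit ?D \<alpha>0" unfolding D(1) by (rule monomial_unit_X_pow[OF grid_1_UNIV nat_one_pos D(2)])
    thus ?thesis by (auto simp: monomial_unit_def)
  qed
  obtain A B where AB: "[:?D:] = A * f + B * pderiv f" using resultant_as_combination[OF deg, of "pderiv f"] by (elim exE) (rule that)
  obtain w :: "'d \<Rightarrow> real" where w: "weight w" using weight_exists by blast
  interpret w: inj_idom_hom "wser w :: ('a, 'd) mps \<Rightarrow> 'a hahn" by (rule inj_idom_hom_wser[OF w])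
  have "lead_coeff (wpoly w f) = 1" "degree (wpoly w f) > 0" using lc deg w by (simp_all add: wpoly_simps[OF w])
  then obtain y where y: "poly (wpoly w f) y = 0" using hahn_poly_has_root by blast
  have simple: "poly (pderiv (wpoly w f)) y \<noteq> 0"
  proof
    assume 0: "poly (pderiv (wpoly w f)) y = 0"
    have "wpoly w [:?D:] = wpoly w A * wpoly w f + wpoly w B * pderiv (wpoly w f)"
      unfolding AB wpoly_simps(3,5,7)[OF w] ..
    hence "poly [:wser w ?D:] y = poly (wpoly w A * wpoly w f + wpoly w B * pderiv (wpoly w f)) y"
      unfolding wpoly_simps(8)[OF w] by (rule arg_cong)
    hence "wser w ?D = 0" using 0 y by (simp add: w)
    thus False using Dnz wsubst_eq_0_iff[OF w] embed_eq_0_iff by blast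
  qed
  have "\<exists>Zi :: rat set. finite Zi \<and> (\<forall>\<alpha>. hcoeff y (wdot w \<alpha>) \<noteq> 0 \<longrightarrow> (\<exists>n. \<alpha> i - of_nat n \<in> Zi))" for i
  proof -
    obtain m c where mc: "const_term (c m) \<noteq> 0 \<and> (\<forall>w l y. euler_along w i l \<longrightarrow> poly (wpoly w f) y = 0 \<longrightarrow>
        (\<Sum>j\<le>m. wser w (c j) * (hderiv l ^^ j) y) = 0)"
      using roots_satisfy_linear_ode[OF lc deg D, of i] by (elim exE) (rule that)
    obtain l :: "real \<Rightarrow> rat" where l: "additive_fun l" "\<And>\<alpha>. l (wdot w \<alpha>) = \<alpha> i"
      by (rule coordinate_functional[OF w, of i]) (rule that)
    have el: "euler_along w i l" using w l by (simp add: euler_along_def)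
    define P where "P = (\<Sum>j\<le>m. monom (const_term (c j)) j)"
    have "coeff P m = const_term (c m)" unfolding P_def coeff_sum coeff_monom by simp
    hence "P \<noteq> 0" using mc by auto
    hence "finite {x. poly P x = 0}" by (rule poly_roots_finite)
    moreover have "inj (of_rat :: rat \<Rightarrow> 'a)" by (rule injI) simp
    ultimately have fin: "finite (of_rat -` {x. poly P x = 0} :: rat set)" by (rule finite_vimageI)
    have "\<exists>n. \<alpha> i - of_nat n \<in> of_rat -` {x. poly P x = 0}" if nz: "hcoeff y (wdot w \<alpha>) \<noteq> 0" for \<alpha>
      using exponent_of_ode_solution[OF el conjunct2[OF mc, rule_format, OF el y] nz]
      unfolding l(2) P_def by simp
    thus ?thesis using fin by (intro exI[of _ "of_rat -` {x. poly P x = 0}"]) simp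
  qed
  then obtain Zi :: "'d \<Rightarrow> rat set" where Zi: "\<And>i. finite (Zi i) \<and> (\<forall>\<alpha>. hcoeff y (wdot w \<alpha>) \<noteq> 0 \<longrightarrow> (\<exists>n. \<alpha> i - of_nat n \<in> Zi i))"
    using choice[of "\<lambda>i Zi. finite Zi \<and> (\<forall>\<alpha>. hcoeff y (wdot w \<alpha>) \<noteq> 0 \<longrightarrow> (\<exists>n. \<alpha> i - of_nat n \<in> Zi))"] by auto
  have "finite (\<Union>i. Zi i)" using Zi by simp
  from finite_rats_common_shift[OF this] obtain q M where qM: "q > 0 \<and> (\<forall>z\<in>\<Union>i. Zi i. of_nat q * (z + of_nat M :: rat) \<in> \<nat>)"
    by (elim exE) (rule that)
  \<comment> \<open>The exponents of \<open>y\<close> may still be negative; multiplying by \<open>X\<^sup>\<mu>\<close> repairs this for the moment.\<close>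
  define \<mu> where "\<mu> = (\<lambda>_::'d. of_nat M :: rat)"
  have \<mu>g: "\<mu> \<in> grid k" for k by (simp add: \<mu>_def grid_def flip: of_nat_mult)
  have shift_grid: "\<alpha> + \<mu> \<in> grid q" if nz: "hcoeff y (wdot w \<alpha>) \<noteq> 0" for \<alpha>
  proof -
    have "of_nat q * (\<alpha> i + of_nat M) \<in> \<nat>" for i
    proof -
      obtain n where n: "\<alpha> i - of_nat n \<in> Zi i" using Zi[of i] nz by auto
      hence "of_nat q * (\<alpha> i - of_nat n + of_nat M) \<in> \<nat>" using qM by blast
      hence "of_nat q * (\<alpha> i - of_nat n + of_nat M) + of_nat (q * n) \<in> \<nat>" by (rule Nats_add[OF _ of_nat_in_Nats])
      also have "of_nat q * (\<alpha> i - of_nat n + of_nat M) + of_nat (q * n) = of_nat q * (\<alpha> i + of_nat M)"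
        by (simp add: algebra_simps)
      finally show ?thesis .
    qed
    thus ?thesis by (simp add: grid_def \<mu>_def)
  qed
  have span: "a \<in> range (wdot w)" if "hcoeff y a \<noteq> 0" for a
    by (rule exponent_in_span[OF w y simple that])
  define z' where "z' = (Abs_pser (\<lambda>\<alpha>. hcoeff y (wdot w (\<alpha> - \<mu>))) :: ('a, 'd) fracps)"
  have z': "pcoeff z' \<alpha> = hcoeff y (wdot w (\<alpha> - \<mu>))" for \<alpha>
  proof -
    have "{\<alpha>. hcoeff y (wdot w (\<alpha> - \<mu>)) \<noteq> 0} \<subseteq> grid q"
    proof clarify
      fix \<alpha> assume "hcoeff y (wdot w (\<alpha> - \<mu>)) \<noteq> 0"
      from shift_grid[OF this] show "\<alpha> \<in> grid q" by simp
    qed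
    thus ?thesis unfolding z'_def using qM by (subst Abs_pser_inverse) auto
  qed
  have wz': "wsubst w z' = hmonom 1 (wdot w \<mu>) * y"
  proof (rule hahn_eq_wsubstI[OF w, symmetric])
    show "hcoeff (hmonom 1 (wdot w \<mu>) * y) (wdot w \<alpha>) = pcoeff z' \<alpha>" for \<alpha>
      by (simp add: hcoeff_hmonom_mult z' wdot_diff)
    fix a assume a: "a \<notin> range (wdot w)"
    show "hcoeff (hmonom 1 (wdot w \<mu>) * y) a = 0"
    proof (rule ccontr)
      assume "hcoeff (hmonom 1 (wdot w \<mu>) * y) a \<noteq> 0"
      hence "hcoeff y (a - wdot w \<mu>) \<noteq> 0" by (simp add: hcoeff_hmonom_mult)
      from span[OF this] obtain \<alpha> where "a - wdot w \<mu> = wdot w \<alpha>" by (rule imageE)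
      hence "a = wdot w (\<alpha> + \<mu>)" by (simp add: wdot_add)
      thus False using a by simp
    qed
  qed
  \<comment> \<open>\<open>F = X\<^bsup>\<mu> n\<^esup> f(z' / X\<^sup>\<mu>)\<close>; that it vanishes can be tested, and used, with any weight.\<close>
  define F where "F = (\<Sum>k\<le>degree f. embed (coeff f k) * X_pow \<mu> ^ (degree f - k) * z' ^ k)"
  have wF: "wsubst v F = hmonom 1 (wdot v \<mu>) ^ degree f * poly (wpoly v f) x"
    if v: "weight v" and x: "wsubst v z' = hmonom 1 (wdot v \<mu>) * x" for v x
  proof -
    interpret v: inj_idom_hom "wsubst v :: ('a, 'd) fracps \<Rightarrow> 'a hahn" by (rule inj_idom_hom_wsubst[OF v])
    have "wsubst v F = (\<Sum>k\<le>degree f. wser v (coeff f k) * hmonom 1 (wdot v \<mu>) ^ (degree f - k) * (hmonom 1 (wdot v \<mu>) * x) ^ k)"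
      unfolding F_def v.hom_sum v.hom_mult v.hom_power x wsubst_X_pow[OF v \<mu>g nat_one_pos] ..
    also have "\<dots> = hmonom 1 (wdot v \<mu>) ^ degree f * poly (wpoly v f) x"
      using poly_homogenize[of "wpoly v f" "hmonom 1 (wdot v \<mu>)" x] unfolding wpoly_simps(1,2)[OF v] .
    finally show ?thesis .
  qed
  have "wsubst w F = 0" unfolding wF[OF w wz'] y by simp
  hence F0: "F = 0" unfolding wsubst_eq_0_iff[OF w] .
  \<comment> \<open>The series \<open>z'\<close> is divisible by \<open>X\<^sup>\<mu>\<close>, since integrality over \<open>K[[X]]\<close> bounds every weighted order.\<close>
  have \<mu>le: "\<mu> \<le> \<alpha>" if nz: "pcoeff z' \<alpha> \<noteq> 0" for \<alpha>
  proof (rule le_if_wdot_le)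
    fix v :: "'d \<Rightarrow> real" assume v: "weight v"
    define x where "x = hmonom 1 (- wdot v \<mu>) * wsubst v z'"
    have x: "wsubst v z' = hmonom 1 (wdot v \<mu>) * x"
      unfolding x_def by (rule hahn_eqI) (simp add: hcoeff_hmonom_mult)
    have "hcoeff (hmonom 1 (wdot v \<mu>)) (wdot v \<mu>) \<noteq> (0 :: 'a)" by (simp add: hcoeff_hmonom)
    hence "hmonom 1 (wdot v \<mu>) \<noteq> (0 :: 'a hahn)" by (intro notI) simp
    hence "poly (wpoly v f) x = 0" using wF[OF v x] F0 v by simp
    hence "supp_ge 0 x" by (rule wpoly_root_supp_ge_0[OF v lc])
    moreover have "hcoeff x (wdot v \<alpha> - wdot v \<mu>) \<noteq> 0" using nz v by (simp add: x_def hcoeff_hmonom_mult)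
    ultimately have "0 \<le> wdot v \<alpha> - wdot v \<mu>" unfolding supp_ge_def by blast
    thus "wdot v \<mu> \<le> wdot v \<alpha>" by simp
  qed
  define z where "z = (Abs_pser (\<lambda>\<alpha>. hcoeff y (wdot w \<alpha>)) :: ('a, 'd) fracps)"
  have z: "pcoeff z \<alpha> = hcoeff y (wdot w \<alpha>)" for \<alpha>
  proof -
    have "{\<alpha>. hcoeff y (wdot w \<alpha>) \<noteq> 0} \<subseteq> grid q"
    proof clarify
      fix \<alpha> assume nz: "hcoeff y (wdot w \<alpha>) \<noteq> 0"
      have "pcoeff z' (\<alpha> + \<mu>) \<noteq> 0" using nz by (simp add: z')
      from grid_rat_diff[OF \<mu>g shift_grid[OF nz] \<mu>le[OF this]] show "\<alpha> \<in> grid q" by simp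
    qed
    thus ?thesis unfolding z_def using qM by (subst Abs_pser_inverse) auto
  qed
  have wz: "wsubst w z = y"
  proof (rule hahn_eq_wsubstI[OF w, symmetric])
    show "hcoeff y a = 0" if "a \<notin> range (wdot w)" for a using span[of a] that by (cases "hcoeff y a = 0") simp_all
  qed (simp add: z)
  interpret v: inj_idom_hom "wsubst w :: ('a, 'd) fracps \<Rightarrow> 'a hahn" by (rule inj_idom_hom_wsubst[OF w])
  have "map_poly (wsubst w) (map_poly embed f) = wpoly w f"
    by (rule poly_eqI) (simp add: coeff_map_poly w)
  hence "wsubst w (poly (map_poly embed f) z) = 0"
    using y wz v.poly_map_poly[of "map_poly embed f" z] by simp
  thus ?thesis unfolding wsubst_eq_0_iff[OF w] by (rule exI)
qed

section \<open>Contacts form an ultrametric\<close>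

text \<open>By the factorization of the discriminant this holds for the roots of a quasi-ordinary polynomial;
  the properties of contacts below rest on nothing else.\<close>

definition separated :: "('a::field, 'd::finite) fracps set \<Rightarrow> bool" where
  "separated Z \<longleftrightarrow> (\<forall>y\<in>Z. \<forall>z\<in>Z. y \<noteq> z \<longrightarrow> (\<exists>\<mu>. monomial_unit (y - z) \<mu>))"

lemma separated_subset: "separated Z \<Longrightarrow> B \<subseteq> Z \<Longrightarrow> separated B"
  unfolding separated_def by (simp add: subset_iff)

text \<open>The difference of two roots divides the discriminant, and all divisors of a monomial times a unit
  are of that form.\<close>

lemma separated_Zer:
  fixes f :: "('a::field_char_0, 'd::finite) mps poly"
  assumes deg: "degree f > 0" and qo: "quasi_ordinary f"
  shows "separated (Zer f)"
  unfolding separated_def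
proof (intro ballI impI)
  fix y z assume y: "y \<in> Zer f" and z: "z \<in> Zer f" and ne: "y \<noteq> z"
  interpret e: inj_idom_hom "embed :: ('a, 'd) mps \<Rightarrow> ('a, 'd) fracps" by (rule inj_idom_hom_embed)
  interpret me: map_poly_inj_idom_hom "embed :: ('a, 'd) mps \<Rightarrow> ('a, 'd) fracps" ..
  let ?f = "map_poly embed f" and ?D = "resultant f (pderiv f)"
  have fy: "poly ?f y = 0" and fz: "poly ?f z = 0" using y z by (simp_all add: Zer_def)
  obtain \<alpha> u where D: "?D = X_pow \<alpha> * u" "const_term u \<noteq> 0"
    using resultant_of_quasi_ordinary[OF qo] by (elim exE conjE) (rule that)
  have "monomial_unit ?D \<alpha>" unfolding D(1) by (rule monomial_unit_X_pow[OF grid_1_UNIV nat_one_pos D(2)])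
  hence Dm: "monomial_unit (embed ?D) (rat_exp \<alpha>)" by (rule monomial_unit_embed)
  obtain A B where AB: "[:?D:] = A * f + B * pderiv f"
    using resultant_as_combination[OF deg, of "pderiv f"] by (elim exE) (rule that)
  have "map_poly embed [:?D:] = map_poly embed A * ?f + map_poly embed B * pderiv ?f"
    unfolding AB me.hom_add me.hom_mult e.map_poly_pderiv ..
  hence "poly (map_poly embed [:?D:]) y = poly (map_poly embed A * ?f + map_poly embed B * pderiv ?f) y"
    by (rule arg_cong)
  hence DB: "embed ?D = poly (map_poly embed B) y * poly (pderiv ?f) y"
    using fy by (simp add: e.map_poly_pCons_hom)
  obtain q where q: "?f = [:- y, 1:] * q" using fy by (metis dvdE poly_eq_0_iff_dvd)
  have "poly ?f z = (z - y) * poly q z" unfolding q poly_mult by simp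
  hence "poly q z = 0" using fz ne by simp
  then obtain q2 where q2: "q = [:- z, 1:] * q2" by (metis dvdE poly_eq_0_iff_dvd)
  have "poly (pderiv ?f) y = poly q y" unfolding q pderiv_mult by (simp add: pderiv_pCons del: mult_pCons_left)
  also have "\<dots> = (y - z) * poly q2 y" unfolding q2 poly_mult by simp
  finally have "embed ?D = (y - z) * (poly q2 y * poly (map_poly embed B) y)"
    unfolding DB by (simp only: mult_ac)
  from monomial_unit_factor[OF Dm[unfolded this]] show "\<exists>\<mu>. monomial_unit (y - z) \<mu>" .
qed

lemma contact_eq_Top_iff: "contact y z = top.Top \<longleftrightarrow> y = z"
  by (simp add: contact_def)

lemma contact_eq_Value:
  assumes "y \<noteq> z" "monomial_unit (y - z) \<mu>"
  shows "contact y z = top.Value \<mu>"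
proof -
  have "(THE \<alpha>. 0 \<le> \<alpha> \<and> (\<exists>u. y - z = X_pow \<alpha> * u \<and> const_term u \<noteq> 0)) = \<mu>"
    unfolding monomial_unit_iff[symmetric]
    by (rule the_equality, rule assms(2), erule monomial_unit_unique, rule assms(2))
  thus ?thesis using assms(1) by (simp add: contact_def)
qed

lemma contact_Value_D:
  assumes "separated Z" "y \<in> Z" "z \<in> Z" "contact y z = top.Value \<mu>"
  shows "y \<noteq> z" "monomial_unit (y - z) \<mu>"
proof -
  show ne: "y \<noteq> z" using assms(4) contact_eq_Top_iff[of y z] by auto
  obtain \<nu> where \<nu>: "monomial_unit (y - z) \<nu>" using assms(1-3) ne by (auto simp: separated_def)
  have "\<nu> = \<mu>" using contact_eq_Value[OF ne \<nu>] assms(4) by simp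
  thus "monomial_unit (y - z) \<mu>" using \<nu> by simp
qed

lemma contact_cases:
  assumes "separated Z" "y \<in> Z" "z \<in> Z"
  obtains "y = z" "contact y z = top.Top"
  | \<mu> where "y \<noteq> z" "monomial_unit (y - z) \<mu>" "contact y z = top.Value \<mu>"
proof (cases "y = z")
  case True
  thus ?thesis using that(1) contact_eq_Top_iff by metis
next
  case False
  then obtain \<mu> where "monomial_unit (y - z) \<mu>" using assms by (auto simp: separated_def)
  thus ?thesis using that(2) False contact_eq_Value by metis
qed

lemma monomial_unit_neg: "monomial_unit (y - z) \<mu> \<Longrightarrow> monomial_unit (z - (y :: ('a::comm_ring_1, 'e::linordered_semidom, 'd::finite) pser)) \<mu>"
  unfolding monomial_unit_def pcoeff_simps by (metis right_minus_eq)

lemma contact_sym: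
  assumes "separated Z" "y \<in> Z" "z \<in> Z"
  shows "contact y z = contact z y"
proof (rule contact_cases[OF assms])
  fix \<mu> assume "y \<noteq> z" "monomial_unit (y - z) \<mu>" "contact y z = top.Value \<mu>"
  thus ?thesis using contact_eq_Value[of z y \<mu>] monomial_unit_neg by metis
qed simp

text \<open>If \<open>\<alpha>\<close> and \<open>\<beta>\<close> were incomparable, both would be minimal exponents of the sum.\<close>

lemma monomial_unit_sum_comparable:
  assumes a: "monomial_unit x \<alpha>" and b: "monomial_unit y \<beta>" and c: "monomial_unit (x + y) \<gamma>"
  shows "\<alpha> \<le> \<beta> \<or> \<beta> \<le> \<alpha>"
proof (rule ccontr)
  assume no: "\<not> (\<alpha> \<le> \<beta> \<or> \<beta> \<le> \<alpha>)"
  have "pcoeff y \<alpha> = 0" "pcoeff x \<beta> = 0" using a b no unfolding monomial_unit_def by auto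
  hence "pcoeff (x + y) \<alpha> \<noteq> 0" "pcoeff (x + y) \<beta> \<noteq> 0" using a b by (simp_all add: monomial_unit_def)
  hence "\<gamma> \<le> \<alpha>" "\<gamma> \<le> \<beta>" using c unfolding monomial_unit_def by simp_all
  moreover have "pcoeff x \<gamma> \<noteq> 0 \<or> pcoeff y \<gamma> \<noteq> 0" using c by (auto simp: monomial_unit_def)
  hence "\<alpha> \<le> \<gamma> \<or> \<beta> \<le> \<gamma>" using a b unfolding monomial_unit_def by auto
  ultimately show False using no order.trans by blast
qed

lemma monomial_unit_sum_ge:
  assumes "monomial_unit x \<alpha>" "monomial_unit y \<beta>" "monomial_unit (x + y) \<gamma>" "\<alpha> \<le> \<beta>"
  shows "\<alpha> \<le> \<gamma>"
proof -
  have "pcoeff x \<gamma> \<noteq> 0 \<or> pcoeff y \<gamma> \<noteq> 0" using assms(3) by (auto simp: monomial_unit_def)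
  hence "\<alpha> \<le> \<gamma> \<or> \<beta> \<le> \<gamma>" using assms(1,2) unfolding monomial_unit_def by auto
  thus ?thesis using assms(4) order.trans by blast
qed

lemma contact_total:
  assumes Z: "separated Z" and xyz: "x \<in> Z" "y \<in> Z" "z \<in> Z"
  shows "contact x y \<le> contact y z \<or> contact y z \<le> contact x y"
proof (rule contact_cases[OF Z xyz(1,2)])
  fix \<alpha> assume a: "monomial_unit (x - y) \<alpha>" "contact x y = top.Value \<alpha>"
  show ?thesis
  proof (rule contact_cases[OF Z xyz(2,3)])
    fix \<beta> assume b: "monomial_unit (y - z) \<beta>" "contact y z = top.Value \<beta>"
    show ?thesis
    proof (rule contact_cases[OF Z xyz(1,3)])
      assume "x = z"
      thus ?thesis using contact_sym[OF Z xyz(1,2)] by simp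
    next
      fix \<gamma> assume "monomial_unit (x - z) \<gamma>"
      hence "monomial_unit ((x - y) + (y - z)) \<gamma>" by simp
      from monomial_unit_sum_comparable[OF a(1) b(1) this] show ?thesis by (simp add: a(2) b(2))
    qed
  qed simp
qed simp

text \<open>With respect to the partial order of exponents this needs comparability of the two contacts.\<close>

lemma contact_ultrametric:
  assumes Z: "separated Z" and xyz: "x \<in> Z" "y \<in> Z" "z \<in> Z" and le: "contact x y \<le> contact y z"
  shows "contact x y \<le> contact x z"
proof (rule contact_cases[OF Z xyz(1,3)])
  fix \<gamma> assume c: "x \<noteq> z" "monomial_unit (x - z) \<gamma>" "contact x z = top.Value \<gamma>"
  show ?thesis
  proof (rule contact_cases[OF Z xyz(1,2)])
    assume "x = y" "contact x y = top.Top"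
    hence "contact y z = top.Top" using le less_eq_top_is_Top by simp
    hence "y = z" unfolding contact_eq_Top_iff .
    thus ?thesis using c(1) \<open>x = y\<close> by simp
  next
    fix \<alpha> assume a: "monomial_unit (x - y) \<alpha>" "contact x y = top.Value \<alpha>"
    show ?thesis
    proof (rule contact_cases[OF Z xyz(2,3)])
      assume "y = z" thus ?thesis by simp
    next
      fix \<beta> assume b: "monomial_unit (y - z) \<beta>" "contact y z = top.Value \<beta>"
      have "\<alpha> \<le> \<beta>" using le by (simp add: a(2) b(2))
      moreover have "monomial_unit ((x - y) + (y - z)) \<gamma>" using c(2) by simp
      ultimately have "\<alpha> \<le> \<gamma>" using monomial_unit_sum_ge[OF a(1) b(1)] by blast
      thus ?thesis by (simp add: a(2) c(3))
    qed
  qed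
qed simp

lemma contact_ge_trans:
  assumes Z: "separated Z" and xyz: "x \<in> Z" "y \<in> Z" "z \<in> Z" and "h \<le> contact x y" "h \<le> contact y z"
  shows "h \<le> contact x z"
  using contact_total[OF Z xyz]
proof
  assume "contact x y \<le> contact y z"
  from contact_ultrametric[OF Z xyz this] show ?thesis using assms(5) order.trans by blast
next
  assume "contact y z \<le> contact x y"
  hence "contact z y \<le> contact y x" using contact_sym[OF Z] xyz by metis
  from contact_ultrametric[OF Z xyz(3,2,1) this] show ?thesis
    using assms(6) contact_sym[OF Z] xyz order.trans by metis
qed

lemma contact_gt_trans:
  assumes Z: "separated Z" and xyz: "x \<in> Z" "y \<in> Z" "z \<in> Z" and "h < contact x y" "h < contact y z"
  shows "h < contact x z"
  using contact_total[OF Z xyz]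
proof
  assume "contact x y \<le> contact y z"
  from contact_ultrametric[OF Z xyz this] show ?thesis using assms(5) order.strict_trans2 by blast
next
  assume "contact y z \<le> contact x y"
  hence "contact z y \<le> contact y x" using contact_sym[OF Z] xyz by metis
  from contact_ultrametric[OF Z xyz(3,2,1) this] show ?thesis
    using assms(6) contact_sym[OF Z] xyz order.strict_trans2 by metis
qed

text \<open>The contacts with one point form a finite chain, and their minimum is minimal for all pairs.\<close>

lemma bar_height_props:
  assumes Z: "separated B" and fin: "finite B" and ne: "B \<noteq> {}"
  shows "\<exists>y\<in>B. \<exists>z\<in>B. bar_height B = contact y z"
    and "\<And>y z. y \<in> B \<Longrightarrow> z \<in> B \<Longrightarrow> bar_height B \<le> contact y z"
proof -
  obtain x where x: "x \<in> B" using ne by blast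
  have chain: "contact x y \<le> contact x z \<or> contact x z \<le> contact x y" if "y \<in> B" "z \<in> B" for y z
    using contact_total[OF Z that(1) x that(2)] contact_sym[OF Z that(1) x] by simp
  have "\<exists>m\<in>S. \<forall>y\<in>S. contact x m \<le> contact x y" if "finite S" "S \<noteq> {}" "S \<subseteq> B" for S
    using that
  proof (induction S rule: finite_ne_induct)
    case (insert a S)
    then obtain m where m: "m \<in> S" "\<forall>y\<in>S. contact x m \<le> contact x y" by auto
    show ?case
    proof (cases "contact x m \<le> contact x a")
      case True
      thus ?thesis using m by auto
    next
      case False
      hence "contact x a \<le> contact x m" using chain[of m a] m(1) insert.prems by auto
      hence "\<forall>y\<in>insert a S. contact x a \<le> contact x y" using m(2) order.trans by auto
      thus ?thesis by blast
    qed
  qed auto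
  from this[OF fin ne subset_refl] obtain m where m: "m \<in> B" "\<forall>y\<in>B. contact x m \<le> contact x y" by blast
  have le: "contact x m \<le> contact y z" if yz: "y \<in> B" "z \<in> B" for y z
    using contact_ge_trans[OF Z yz(1) x yz(2), of "contact x m"] m yz contact_sym[OF Z yz(1) x] by simp
  have eq: "bar_height B = contact x m"
    unfolding bar_height_def
    by (rule Least_equality) (use x m(1) le in blast)+
  show "\<exists>y\<in>B. \<exists>z\<in>B. bar_height B = contact y z" using eq x m(1) by blast
  show "bar_height B \<le> contact y z" if "y \<in> B" "z \<in> B" for y z using eq le that by simp
qed

lemma bar_height_Top_singleton:
  assumes "separated B" "finite B" "B \<noteq> {}" "bar_height B = top.Top" "y \<in> B" "z \<in> B"
  shows "y = z"
  using bar_height_props(2)[OF assms(1-3,5,6)] assms(4) less_eq_top_is_Top contact_eq_Top_iff by metis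

definition bar_class :: "('a::field, 'd::finite) fracps set \<Rightarrow> ('a, 'd) fracps \<Rightarrow> ('a, 'd) fracps set" where
  "bar_class B y = {z \<in> B. bar_height B < contact y z}"

lemma postbars_eq:
  assumes "bar_height B \<noteq> top.Top"
  shows "postbars B = bar_class B ` B"
  using assms unfolding postbars_def quotient_def bar_class_def by auto

lemma bar_class_self: "bar_height B \<noteq> top.Top \<Longrightarrow> y \<in> B \<Longrightarrow> y \<in> bar_class B y"
  unfolding bar_class_def using contact_eq_Top_iff[of y y] by (cases "bar_height B") auto

lemma bar_class_eq_iff:
  assumes Z: "separated B" and h: "bar_height B \<noteq> top.Top" and yz: "y \<in> B" "z \<in> B"
  shows "bar_class B y = bar_class B z \<longleftrightarrow> bar_height B < contact y z"
proof
  assume "bar_class B y = bar_class B z"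
  hence "z \<in> bar_class B y" using bar_class_self[OF h yz(2)] by simp
  thus "bar_height B < contact y z" by (simp add: bar_class_def)
next
  assume lt: "bar_height B < contact y z"
  hence lt': "bar_height B < contact z y" using contact_sym[OF Z yz] by simp
  show "bar_class B y = bar_class B z"
  proof (intro equalityI subsetI)
    fix x assume "x \<in> bar_class B y"
    hence x: "x \<in> B" "bar_height B < contact y x" by (simp_all add: bar_class_def)
    show "x \<in> bar_class B z"
      unfolding bar_class_def using contact_gt_trans[OF Z yz(2,1) x(1) lt' x(2)] x(1) by simp
  next
    fix x assume "x \<in> bar_class B z"
    hence x: "x \<in> B" "bar_height B < contact z x" by (simp_all add: bar_class_def)
    show "x \<in> bar_class B y"
      unfolding bar_class_def using contact_gt_trans[OF Z yz x(1) lt x(2)] x(1) by simp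
  qed
qed

lemma postbars_subset: "C \<in> postbars B \<Longrightarrow> C \<subseteq> B"
  unfolding postbars_def quotient_def by (auto split: if_splits)

lemma bars_subset: "B \<in> bars f \<Longrightarrow> B \<subseteq> Zer f"
  by (induction rule: bars.induct) (use postbars_subset in blast)+

lemma postbars_nonempty:
  assumes "C \<in> postbars B" shows "C \<noteq> {}"
proof -
  have h: "bar_height B \<noteq> top.Top" using assms by (auto simp: postbars_def)
  then obtain y where "y \<in> B" "C = bar_class B y" using assms unfolding postbars_eq[OF h] by blast
  thus ?thesis using bar_class_self[OF h] by blast
qed

lemma bars_nonempty: "B \<in> bars f \<Longrightarrow> Zer f \<noteq> {} \<Longrightarrow> B \<noteq> {}"
  by (induction rule: bars.induct) (use postbars_nonempty in auto)

lemma finite_Zer: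
  fixes f :: "('a::field, 'd::finite) mps poly"
  assumes "degree f > 0" shows "finite (Zer f)"
proof -
  interpret e: inj_idom_hom "embed :: ('a, 'd) mps \<Rightarrow> ('a, 'd) fracps" by (rule inj_idom_hom_embed)
  have "degree (map_poly embed f) = degree f" by simp
  hence "map_poly embed f \<noteq> 0" using assms by auto
  thus ?thesis unfolding Zer_def by (rule poly_roots_finite)
qed

section \<open>The tree is determined by its type\<close>

definition isometry :: "('a::field, 'd::finite) fracps set \<Rightarrow> ('a, 'd) fracps set \<Rightarrow> (('a, 'd) fracps \<Rightarrow> ('a, 'd) fracps) \<Rightarrow> bool" where
  "isometry A B \<Phi> \<longleftrightarrow> bij_betw \<Phi> A B \<and> (\<forall>y\<in>A. \<forall>z\<in>A. contact (\<Phi> y) (\<Phi> z) = contact y z)"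

lemma bar_height_isometry:
  assumes "isometry A B \<Phi>" "C \<subseteq> A"
  shows "bar_height (\<Phi> ` C) = bar_height C"
proof -
  have "(\<exists>y\<in>\<Phi> ` C. \<exists>z\<in>\<Phi> ` C. h = contact y z) \<longleftrightarrow> (\<exists>y\<in>C. \<exists>z\<in>C. h = contact y z)" for h
  proof -
    have "contact (\<Phi> y) (\<Phi> z) = contact y z" if "y \<in> C" "z \<in> C" for y z
      using assms that unfolding isometry_def by blast
    thus ?thesis by auto
  qed
  thus ?thesis unfolding bar_height_def by simp
qed

lemma postbars_isometry:
  assumes i: "isometry A B \<Phi>" and C: "C \<subseteq> A"
  shows "postbars (\<Phi> ` C) = (`) \<Phi> ` postbars C"
proof (cases "bar_height C = top.Top")
  case True
  thus ?thesis using bar_height_isometry[OF i C] by (simp add: postbars_def)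
next
  case False
  hence False': "bar_height (\<Phi> ` C) \<noteq> top.Top" using bar_height_isometry[OF i C] by simp
  have "bar_class (\<Phi> ` C) (\<Phi> y) = \<Phi> ` bar_class C y" if y: "y \<in> C" for y
  proof -
    have "contact (\<Phi> y) (\<Phi> z) = contact y z" if "z \<in> C" for z
      using i C y that unfolding isometry_def by blast
    thus ?thesis unfolding bar_class_def bar_height_isometry[OF i C] by auto
  qed
  thus ?thesis unfolding postbars_eq[OF False] postbars_eq[OF False'] image_image by simp
qed

text \<open>Heights and postbars are defined by contacts alone, so an isometry carries the recursion over.\<close>

lemma tree_iso_if_isometry:
  assumes i: "isometry (Zer f) (Zer g) \<Phi>"
  shows "tree_iso f g"
proof -
  have img: "\<Phi> ` Zer f = Zer g" and inj: "inj_on \<Phi> (Zer f)" using i by (auto simp: isometry_def bij_betw_def)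
  have fg: "\<Phi> ` B \<in> bars g" if "B \<in> bars f" for B
    using that
  proof (induction rule: bars.induct)
    case 1
    show ?case unfolding img by (rule bars.intros(1))
  next
    case (2 B C)
    have "\<Phi> ` C \<in> postbars (\<Phi> ` B)" unfolding postbars_isometry[OF i bars_subset[OF 2(1)]] using 2(2) by (rule imageI)
    thus ?case by (rule bars.intros(2)[OF 2(3)])
  qed
  have gf: "B' \<in> (`) \<Phi> ` bars f" if "B' \<in> bars g" for B'
    using that
  proof (induction rule: bars.induct)
    case 1
    show ?case unfolding img[symmetric] by (rule imageI) (rule bars.intros(1))
  next
    case (2 B' C')
    obtain B where B: "B' = \<Phi> ` B" "B \<in> bars f" using 2(3) by (rule imageE)
    have "C' \<in> (`) \<Phi> ` postbars B"
      using 2(2) unfolding B(1) postbars_isometry[OF i bars_subset[OF B(2)]] .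
    then obtain C where C: "C' = \<Phi> ` C" "C \<in> postbars B" by (rule imageE)
    show ?case unfolding C(1) by (rule imageI) (rule bars.intros(2)[OF B(2) C(2)])
  qed
  have inj': "\<Phi> ` B = \<Phi> ` C \<longleftrightarrow> B = C" if "B \<subseteq> Zer f" "C \<subseteq> Zer f" for B C
    by (rule inj_on_image_eq_iff[OF inj that])
  have "bij_betw ((`) \<Phi>) (bars f) (bars g)"
    unfolding bij_betw_def
  proof
    show "inj_on ((`) \<Phi>) (bars f)" by (rule inj_onI) (simp add: inj' bars_subset)
    show "(`) \<Phi> ` bars f = bars g" using fg gf by auto
  qed
  moreover have "bar_height (\<Phi> ` B) = bar_height B" if "B \<in> bars f" for B
    by (rule bar_height_isometry[OF i bars_subset[OF that]])
  moreover have "\<Phi> ` C \<in> postbars (\<Phi> ` B) \<longleftrightarrow> C \<in> postbars B" if B: "B \<in> bars f" and C: "C \<in> bars f" for B C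
  proof
    assume "\<Phi> ` C \<in> postbars (\<Phi> ` B)"
    then obtain C2 where C2: "\<Phi> ` C = \<Phi> ` C2" "C2 \<in> postbars B"
      unfolding postbars_isometry[OF i bars_subset[OF B]] by (rule imageE)
    have "C2 \<subseteq> Zer f" by (rule bars_subset[OF bars.intros(2)[OF B C2(2)]])
    hence "C = C2" using C2(1) inj' bars_subset[OF C] by simp
    thus "C \<in> postbars B" using C2(2) by simp
  next
    assume "C \<in> postbars B"
    thus "\<Phi> ` C \<in> postbars (\<Phi> ` B)" unfolding postbars_isometry[OF i bars_subset[OF B]] by (rule imageI)
  qed
  ultimately show ?thesis unfolding tree_iso_def by (intro exI[of _ "(`) \<Phi>"]) simp
qed

text \<open>Isometries of the postbars glue, because points in different postbars have contact \<open>h(B)\<close>.\<close>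

lemma glue_isometries:
  assumes B: "separated B" "finite B" "B \<noteq> {}" and B': "separated B'" "finite B'" "B' \<noteq> {}"
    and h: "bar_height B = bar_height B'" "bar_height B \<noteq> top.Top"
    and card: "card (postbars B) = card (postbars B')"
    and iso: "\<And>C C'. C \<in> postbars B \<Longrightarrow> C' \<in> postbars B' \<Longrightarrow> \<exists>\<Phi>. isometry C C' \<Phi>"
  shows "\<exists>\<Phi>. isometry B B' \<Phi>"
proof -
  have h': "bar_height B' \<noteq> top.Top" using h by simp
  note pb = postbars_eq[OF h(2)] and pb' = postbars_eq[OF h']
  have "finite (postbars B)" "finite (postbars B')" using B(2) B'(2) by (simp_all add: pb pb')
  then obtain \<psi> where \<psi>: "bij_betw \<psi> (postbars B) (postbars B')" using card finite_same_card_bij by blast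
  have cls: "bar_class B y \<in> postbars B" if "y \<in> B" for y using that by (simp add: pb)
  have \<psi>c: "\<psi> C \<in> postbars B'" if "C \<in> postbars B" for C using \<psi> that by (rule bij_betwE[THEN bspec])
  define \<Theta> where "\<Theta> C = (SOME \<Phi>. isometry C (\<psi> C) \<Phi>)" for C
  have \<Theta>: "isometry C (\<psi> C) (\<Theta> C)" if "C \<in> postbars B" for C
    using someI_ex[OF iso[OF that \<psi>c[OF that]]] unfolding \<Theta>_def .
  define \<Phi> where "\<Phi> y = \<Theta> (bar_class B y) y" for y
  have self: "y \<in> bar_class B y" if "y \<in> B" for y by (rule bar_class_self[OF h(2) that])
  have in\<psi>: "\<Phi> y \<in> \<psi> (bar_class B y)" if y: "y \<in> B" for y
    using \<Theta>[OF cls[OF y]] self[OF y] unfolding \<Phi>_def isometry_def by (auto dest: bij_betwE)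
  have inB': "\<Phi> y \<in> B'" if y: "y \<in> B" for y
    using in\<psi>[OF y] postbars_subset[OF \<psi>c[OF cls[OF y]]] by blast
  have class': "bar_class B' (\<Phi> y) = \<psi> (bar_class B y)" if y: "y \<in> B" for y
  proof -
    have "\<psi> (bar_class B y) \<in> bar_class B' ` B'" using \<psi>c[OF cls[OF y]] unfolding pb' .
    then obtain z where z: "\<psi> (bar_class B y) = bar_class B' z" "z \<in> B'" by (rule imageE)
    hence "bar_height B' < contact z (\<Phi> y)" using in\<psi>[OF y] by (simp add: bar_class_def)
    hence "bar_class B' z = bar_class B' (\<Phi> y)" using bar_class_eq_iff[OF B'(1) h' z(2) inB'[OF y]] by simp
    thus ?thesis using z(1) by simp
  qed
  have cont: "contact (\<Phi> y) (\<Phi> z) = contact y z" if yz: "y \<in> B" "z \<in> B" for y z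
  proof (cases "bar_class B y = bar_class B z")
    case True
    have "z \<in> bar_class B y" using self[OF yz(2)] True by simp
    thus ?thesis using \<Theta>[OF cls[OF yz(1)]] self[OF yz(1)] True unfolding isometry_def \<Phi>_def by simp
  next
    case False
    hence "\<not> bar_height B < contact y z" using bar_class_eq_iff[OF B(1) h(2) yz] by simp
    hence 1: "contact y z = bar_height B"
      using bar_height_props(2)[OF B yz] by (simp add: order.strict_iff_order)
    have "\<psi> (bar_class B y) \<noteq> \<psi> (bar_class B z)"
      using \<psi> False cls yz unfolding bij_betw_def inj_on_def by blast
    hence "\<not> bar_height B' < contact (\<Phi> y) (\<Phi> z)"
      using bar_class_eq_iff[OF B'(1) h' inB'[OF yz(1)] inB'[OF yz(2)]] class' yz by simp
    hence "contact (\<Phi> y) (\<Phi> z) = bar_height B'"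
      using bar_height_props(2)[OF B' inB'[OF yz(1)] inB'[OF yz(2)]] by (simp add: order.strict_iff_order)
    thus ?thesis using 1 h(1) by simp
  qed
  have "inj_on \<Phi> B"
  proof (rule inj_onI)
    fix y z assume yz: "y \<in> B" "z \<in> B" and eq: "\<Phi> y = \<Phi> z"
    have "contact y z = top.Top" using cont[OF yz] eq contact_eq_Top_iff[of "\<Phi> z" "\<Phi> z"] by simp
    thus "y = z" unfolding contact_eq_Top_iff .
  qed
  moreover have "\<Phi> ` B = B'"
  proof (intro equalityI subsetI)
    fix z assume z: "z \<in> B'"
    hence "bar_class B' z \<in> postbars B'" by (simp add: pb')
    then obtain C where C: "C \<in> postbars B" "\<psi> C = bar_class B' z"
      using \<psi> unfolding bij_betw_def by (metis imageE)
    have "z \<in> \<psi> C" unfolding C(2) by (rule bar_class_self[OF h' z])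
    then obtain y where y: "y \<in> C" "\<Theta> C y = z"
      using \<Theta>[OF C(1)] unfolding isometry_def bij_betw_def by (metis imageE)
    have yB: "y \<in> B" using y(1) postbars_subset[OF C(1)] by blast
    obtain x where x: "C = bar_class B x" "x \<in> B" using C(1) unfolding pb by (rule imageE)
    have "bar_height B < contact x y" using y(1) unfolding x(1) by (simp add: bar_class_def)
    hence "bar_class B y = C" using bar_class_eq_iff[OF B(1) h(2) x(2) yB] x(1) by simp
    hence "\<Phi> y = z" using y(2) by (simp add: \<Phi>_def)
    thus "z \<in> \<Phi> ` B" using yB by blast
  qed (use inB' in blast)
  ultimately have "isometry B B' \<Phi>" unfolding isometry_def bij_betw_def using cont by simp
  thus ?thesis by (rule exI[of _ \<Phi>])
qed

lemma char_height_inject: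
  assumes "distinct hs" "i \<in> {1..length hs + 1}" "j \<in> {1..length hs + 1}" "char_height hs i = char_height hs j"
  shows "i = j"
proof (cases "i \<le> length hs \<and> j \<le> length hs")
  case True
  hence "hs ! (i - 1) = hs ! (j - 1)" using assms(4) by (simp add: char_height_def)
  moreover have "i - 1 < length hs" "j - 1 < length hs" using True assms(2,3) by auto
  ultimately have "i - 1 = j - 1" using assms(1) by (simp add: nth_eq_iff_index_eq)
  thus ?thesis using assms(2,3) by auto
next
  case False
  thus ?thesis using assms(2-4) by (auto simp: char_height_def split: if_splits)
qed

lemma tree_type_root_height:
  assumes t: "has_tree_type f hs" and dist: "distinct hs"
  shows "bar_height (Zer f) = char_height hs 1"
proof -
  have hts: "bar_height ` bars f = char_height hs ` {1..length hs + 1}"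
    and post: "\<And>i B C. i \<in> {1..length hs} \<Longrightarrow> B \<in> bars f \<Longrightarrow> bar_height B = char_height hs i \<Longrightarrow>
      C \<in> postbars B \<Longrightarrow> bar_height C = char_height hs (i + 1)"
    using t unfolding has_tree_type_def by simp_all
  have "bar_height (Zer f) \<in> char_height hs ` {1..length hs + 1}"
    unfolding hts[symmetric] by (rule imageI) (rule bars.intros(1))
  then obtain j where j: "bar_height (Zer f) = char_height hs j" "j \<in> {1..length hs + 1}" by (rule imageE)
  have above: "\<exists>i\<in>{j..length hs + 1}. bar_height B = char_height hs i" if "B \<in> bars f" for B
    using that
  proof (induction rule: bars.induct)
    case 1
    thus ?case using j by auto
  next
    case (2 B C)
    obtain i where i: "i \<in> {j..length hs + 1}" "bar_height B = char_height hs i" using 2(3) by blast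
    have "bar_height B \<noteq> top.Top" using 2(2) by (auto simp: postbars_def)
    hence "i \<le> length hs" using i(2) by (auto simp: char_height_def split: if_splits)
    hence "bar_height C = char_height hs (i + 1)" using post[of i B C] 2 i j(2) by simp
    thus ?case using i(1) \<open>i \<le> length hs\<close> by (intro bexI[of _ "i + 1"]) auto
  qed
  have "char_height hs 1 \<in> bar_height ` bars f" unfolding hts by (rule imageI) simp
  then obtain B where B: "char_height hs 1 = bar_height B" "B \<in> bars f" by (rule imageE)
  obtain i where i: "i \<in> {j..length hs + 1}" "bar_height B = char_height hs i" using above[OF B(2)] by blast
  have "1 = i" by (rule char_height_inject[OF dist]) (use i j B in auto)
  thus ?thesis using i j by auto
qed

text \<open>By descending induction on \<open>i\<close>, a bar of height \<open>h\<^sub>i\<close> of one tree is isometric to every bar of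
  height \<open>h\<^sub>i\<close> of the other.\<close>

theorem tree_type_determines_tree:
  fixes f g :: "('a::field_char_0, 'd::finite) mps poly"
  assumes f: "degree f > 0" "quasi_ordinary f" "Zer f \<noteq> {}" and g: "degree g > 0" "quasi_ordinary g"
    and tf: "has_tree_type f hs" and tg: "has_tree_type g hs" and dist: "distinct hs"
  shows "tree_iso f g"
proof (cases "hs = []")
  case True
  have single: "bars k = {Zer k}" "postbars (Zer k) = {}" if t: "has_tree_type k hs" for k :: "('a, 'd) mps poly"
  proof -
    have Top: "bar_height B = top.Top" if "B \<in> bars k" for B
      using t that unfolding has_tree_type_def True by (auto simp: char_height_def)
    show "postbars (Zer k) = {}" using Top[OF bars.intros(1)] by (simp add: postbars_def)
    have "B = Zer k" if "B \<in> bars k" for B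
      using that by (induction rule: bars.induct) (use Top in \<open>simp_all add: postbars_def\<close>)
    thus "bars k = {Zer k}" using bars.intros(1)[of k] by blast
  qed
  have "bar_height (Zer g) = bar_height (Zer f)"
    using tree_type_root_height[OF tf dist] tree_type_root_height[OF tg dist] by simp
  thus ?thesis unfolding tree_iso_def single[OF tf] single[OF tg]
    by (intro exI[of _ "\<lambda>_. Zer g"]) (simp add: single[OF tf] single[OF tg] bij_betw_def)
next
  case False
  note sf = separated_Zer[OF f(1,2)] finite_Zer[OF f(1)] and sg = separated_Zer[OF g] finite_Zer[OF g(1)]
  let ?n = "\<lambda>i. add_index (char_lattice hs i) (char_lattice hs (i - 1))"
  have post: "card (postbars B) = ?n i \<and> (\<forall>C\<in>postbars B. bar_height C = char_height hs (i + 1))"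
    if "has_tree_type k hs" "i \<in> {1..length hs}" "B \<in> bars k" "bar_height B = char_height hs i"
    for k :: "('a, 'd) mps poly" and i B
    using that unfolding has_tree_type_def by simp
  have one: "1 \<in> {1..length hs}" using False by (cases hs) auto
  have notTop: "char_height hs i \<noteq> top.Top" if "i \<in> {1..length hs}" for i using that by (simp add: char_height_def)
  have "Zer g \<noteq> {}"
  proof
    assume empty: "Zer g = {}"
    have hf: "bar_height (Zer f) = char_height hs 1" and hg: "bar_height (Zer g) = char_height hs 1"
      using tree_type_root_height tf tg dist by blast+
    have "postbars (Zer g) = {}" unfolding empty by (simp add: postbars_def quotient_def)
    hence "?n 1 = 0" using post[OF tg one bars.intros(1) hg] by simp
    hence "card (postbars (Zer f)) = 0" using post[OF tf one bars.intros(1) hf] by simp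
    moreover have "postbars (Zer f) = bar_class (Zer f) ` Zer f"
      by (rule postbars_eq) (unfold hf, rule notTop[OF one])
    ultimately show False using f(3) sf(2) by simp
  qed
  note ne = f(3) this
  have iso: "\<exists>\<Phi>. isometry B B' \<Phi>"
    if "i \<in> {1..length hs + 1}" "B \<in> bars f" "B' \<in> bars g" "bar_height B = char_height hs i" "bar_height B' = char_height hs i"
    for i B B'
    using that
  proof (induction "length hs + 1 - i" arbitrary: i B B')
    case 0
    hence Top: "bar_height B = top.Top" "bar_height B' = top.Top" by (auto simp: char_height_def)
    note B = separated_subset[OF sf(1) bars_subset[OF 0(3)]] finite_subset[OF bars_subset[OF 0(3)] sf(2)] bars_nonempty[OF 0(3) ne(1)]
    note B' = separated_subset[OF sg(1) bars_subset[OF 0(4)]] finite_subset[OF bars_subset[OF 0(4)] sg(2)] bars_nonempty[OF 0(4) ne(2)]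
    obtain y where y: "y \<in> B" using B(3) by blast
    obtain y' where y': "y' \<in> B'" using B'(3) by blast
    have "B = {y}" using bar_height_Top_singleton[OF B Top(1) _ y] y by blast
    moreover have "B' = {y'}" using bar_height_Top_singleton[OF B' Top(2) _ y'] y' by blast
    ultimately show ?case
      by (intro exI[of _ "\<lambda>_. y'"]) (simp add: isometry_def bij_betw_def contact_def)
  next
    case (Suc n)
    hence i: "i \<in> {1..length hs}" by auto
    note B = separated_subset[OF sf(1) bars_subset[OF Suc(4)]] finite_subset[OF bars_subset[OF Suc(4)] sf(2)] bars_nonempty[OF Suc(4) ne(1)]
    note B' = separated_subset[OF sg(1) bars_subset[OF Suc(5)]] finite_subset[OF bars_subset[OF Suc(5)] sg(2)] bars_nonempty[OF Suc(5) ne(2)]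
    note pf = post[OF tf i Suc(4,6)] and pg = post[OF tg i Suc(5,7)]
    show ?case
    proof (rule glue_isometries[OF B B'])
      show "bar_height B = bar_height B'" "bar_height B \<noteq> top.Top" using Suc(6,7) notTop[OF i] by simp_all
      show "card (postbars B) = card (postbars B')" using pf pg by simp
      fix C C' assume C: "C \<in> postbars B" "C' \<in> postbars B'"
      show "\<exists>\<Phi>. isometry C C' \<Phi>"
        by (rule Suc(1)[of "i + 1"])
          (use Suc(2) i pf pg C bars.intros(2)[OF Suc(4) C(1)] bars.intros(2)[OF Suc(5) C(2)] in auto)
    qed
  qed
  have "\<exists>\<Phi>. isometry (Zer f) (Zer g) \<Phi>"
    by (rule iso[of 1]) (simp_all add: bars.intros(1) tree_type_root_height[OF tf dist] tree_type_root_height[OF tg dist])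
  then obtain \<Phi> where "isometry (Zer f) (Zer g) \<Phi>" by (rule exE)
  thus ?thesis by (rule tree_iso_if_isometry)
qed

section \<open>Characters of subgroups\<close>

lemma alg_closed_root_exists:
  fixes x :: "'a::alg_closed_field"
  assumes "r > 0" shows "\<exists>z. z ^ r = x"
proof -
  have "degree (monom 1 r + [:- x:]) = r"
    using assms by (subst degree_add_eq_left) (simp_all add: degree_monom_eq)
  then obtain z where "poly (monom 1 r + [:- x:]) z = 0"
    using alg_closed_imp_poly_has_root[of "monom 1 r + [:- x:]"] assms by auto
  hence "z ^ r = x" by (simp add: poly_monom)
  thus ?thesis by (rule exI)
qed

lemma card_roots_of_unity:
  assumes r: "r > 0"
  shows "card {z :: 'a::{alg_closed_field, field_char_0}. z ^ r = 1} = r"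
proof -
  let ?p = "monom 1 r + [:- 1:] :: 'a poly"
  have deg: "degree ?p = r"
    using r by (subst degree_add_eq_left) (simp_all add: degree_monom_eq)
  have lc: "lead_coeff ?p = 1" unfolding deg using r by (cases r) simp_all
  obtain ys where ys: "length ys = r" "?p = (\<Prod>y\<leftarrow>ys. [:- y, 1:])"
    using monic_splits_if_roots[OF alg_closed_imp_poly_has_root lc] deg by auto
  have root: "poly ?p y = 0 \<longleftrightarrow> y \<in> set ys" for y
    unfolding ys(2) by (induction ys) (auto simp del: mult_pCons_left)
  have root1: "poly ?p y = 0 \<longleftrightarrow> y ^ r = 1" for y by (simp add: poly_monom)
  have "distinct ys"
  proof (rule distinct_if_simple_roots)
    fix y assume "y \<in> set ys"
    hence "y ^ r = 1" using root root1 by blast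
    hence "y \<noteq> 0" using r by (auto simp: power_0_left)
    thus "poly (pderiv (\<Prod>y\<leftarrow>ys. [:- y, 1:])) y \<noteq> 0"
      unfolding ys(2)[symmetric] using r by (simp add: pderiv_add pderiv_monom pderiv_pCons poly_monom)
  qed
  moreover have "{z. z ^ r = 1} = set ys" using root root1 by blast
  ultimately show ?thesis using ys(1) by (simp add: distinct_card)
qed

text \<open>The graph of a homomorphism from a subgroup to the multiplicative group. Graphs make the union of
  a chain, and so the use of Zorn's lemma, immediate. The group is the additive group of a ring, so
  that integer multiples are products.\<close>

definition partial_character :: "('b::ring_1 \<times> 'a::field) set \<Rightarrow> bool" where
  "partial_character S \<longleftrightarrow> (0, 1) \<in> S \<and>
     (\<forall>a x b y. (a, x) \<in> S \<longrightarrow> (b, y) \<in> S \<longrightarrow> (a + b, x * y) \<in> S) \<and>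
     (\<forall>a x. (a, x) \<in> S \<longrightarrow> (- a, inverse x) \<in> S) \<and> (\<forall>x. (0, x) \<in> S \<longrightarrow> x = 1)"

lemma partial_characterD:
  assumes "partial_character S"
  shows "(0, 1) \<in> S" "(a, x) \<in> S \<Longrightarrow> (b, y) \<in> S \<Longrightarrow> (a + b, x * y) \<in> S"
    "(a, x) \<in> S \<Longrightarrow> (- a, inverse x) \<in> S" "(0, x) \<in> S \<Longrightarrow> x = 1"
  using assms unfolding partial_character_def by blast+

lemma partial_character_nonzero:
  assumes "partial_character S" "(a, x) \<in> S" shows "x \<noteq> 0"
proof
  assume "x = 0"
  hence "(0, 0) \<in> S"
    using partial_characterD(2)[OF assms partial_characterD(3)[OF assms]] by simp
  thus False using partial_characterD(4)[OF assms(1)] by fastforce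
qed

lemma partial_character_functional:
  assumes S: "partial_character S" and "(a, x) \<in> S" "(a, y) \<in> S" shows "x = y"
proof -
  have "(0, x * inverse y) \<in> S"
    using partial_characterD(2)[OF S assms(2) partial_characterD(3)[OF S assms(3)]] by simp
  hence "x * inverse y = 1" by (rule partial_characterD(4)[OF S])
  thus ?thesis using partial_character_nonzero[OF S assms(3)] by (simp add: field_simps)
qed

lemma partial_character_multiple:
  assumes S: "partial_character S" and a: "(a, x) \<in> S" shows "(of_int c * a, x powi c) \<in> S"
proof -
  have nat: "(of_nat n * a, x ^ n) \<in> S" for n
  proof (induction n)
    case 0
    show ?case using partial_characterD(1)[OF S] by simp
  next
    case (Suc n)
    thus ?case using partial_characterD(2)[OF S a Suc] by (simp add: distrib_right)
  qed
  show ?thesis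
  proof (cases c rule: int_cases2)
    case (nonneg n)
    thus ?thesis using nat[of n] by simp
  next
    case (nonpos n)
    thus ?thesis using partial_characterD(3)[OF S nat[of n]] by (simp add: power_int_minus)
  qed
qed

text \<open>The condition makes the values on the subgroup and on the multiples of \<open>g\<close> agree on the
  intersection.\<close>

lemma partial_character_extend:
  fixes S :: "('b::ring_1 \<times> 'a::field) set"
  assumes S: "partial_character S" and \<zeta>: "\<zeta> \<noteq> 0"
    and compat: "\<And>c x. (of_int c * g, x) \<in> S \<Longrightarrow> x = \<zeta> powi c"
  shows "\<exists>S'. partial_character S' \<and> S \<subseteq> S' \<and> (g, \<zeta>) \<in> S'"
proof -
  define S' where "S' = {p. \<exists>a x c. p = (a + of_int c * g, x * \<zeta> powi c) \<and> (a, x) \<in> S}"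
  have I: "(b, y) \<in> S'" if "(a, x) \<in> S" "b = a + of_int c * g" "y = x * \<zeta> powi c" for a b x y c
    unfolding S'_def using that by blast
  have E: "\<exists>a x c. (a, x) \<in> S \<and> b = a + of_int c * g \<and> y = x * \<zeta> powi c" if "(b, y) \<in> S'" for b y
    using that unfolding S'_def by blast
  have "partial_character S'"
    unfolding partial_character_def
  proof (intro conjI allI impI)
    show "(0, 1) \<in> S'" by (rule I[OF partial_characterD(1)[OF S], of _ 0]) simp_all
  next
    fix b1 y1 b2 y2 assume "(b1, y1) \<in> S'" "(b2, y2) \<in> S'"
    then obtain a1 x1 c1 a2 x2 c2 where h: "(a1, x1) \<in> S" "b1 = a1 + of_int c1 * g" "y1 = x1 * \<zeta> powi c1"
      "(a2, x2) \<in> S" "b2 = a2 + of_int c2 * g" "y2 = x2 * \<zeta> powi c2" using E by meson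
    show "(b1 + b2, y1 * y2) \<in> S'"
      by (rule I[OF partial_characterD(2)[OF S h(1,4)], of _ "c1 + c2"])
        (simp_all add: h algebra_simps power_int_add \<zeta>)
  next
    fix b y assume "(b, y) \<in> S'"
    then obtain a x c where h: "(a, x) \<in> S" "b = a + of_int c * g" "y = x * \<zeta> powi c" using E by meson
    show "(- b, inverse y) \<in> S'"
      by (rule I[OF partial_characterD(3)[OF S h(1)], of _ "- c"]) (simp_all add: h power_int_minus)
  next
    fix y assume "(0, y) \<in> S'"
    then obtain a x c where h: "(a, x) \<in> S" "0 = a + of_int c * g" "y = x * \<zeta> powi c" using E by meson
    have a: "- a = of_int c * g" using h(2) by (metis add.inverse_unique)
    have "(of_int c * g, inverse x) \<in> S" using partial_characterD(3)[OF S h(1)] unfolding a .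
    hence "inverse x = \<zeta> powi c" by (rule compat)
    thus "y = 1" using h(3) partial_character_nonzero[OF S h(1)] by (simp flip: \<open>inverse x = \<zeta> powi c\<close>)
  qed
  moreover have "S \<subseteq> S'"
  proof (rule subrelI)
    fix a x assume "(a, x) \<in> S"
    thus "(a, x) \<in> S'" by (rule I[of _ _ _ 0]) simp_all
  qed
  moreover have "(g, \<zeta>) \<in> S'" by (rule I[OF partial_characterD(1)[OF S], of _ 1]) simp_all
  ultimately show ?thesis by (intro exI[of _ S'] conjI)
qed

text \<open>The multiples of \<open>g\<close> in the domain are the multiples of the least positive one.\<close>

lemma partial_character_compatible:
  fixes S :: "('b::ring_1 \<times> 'a::field) set"
  assumes S: "partial_character S" and r: "r > 0" and val: "(of_nat r * g, \<zeta> ^ r) \<in> S"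
    and least: "\<And>m x. 0 < m \<Longrightarrow> (of_nat m * g, x) \<in> S \<Longrightarrow> r \<le> m" and c: "(of_int c * g, x) \<in> S"
  shows "x = \<zeta> powi c"
proof -
  define q where "q = c div int r"
  define m where "m = nat (c mod int r)"
  have m: "int m = c mod int r" "m < r" using r by (simp_all add: m_def nat_less_iff)
  have cq: "c = q * int r + int m" unfolding m(1) q_def by simp
  have "(of_int c * g + of_int (- q) * (of_nat r * g), x * (\<zeta> ^ r) powi (- q)) \<in> S"
    by (rule partial_characterD(2)[OF S c partial_character_multiple[OF S val]])
  moreover have "of_int c * g + of_int (- q) * (of_nat r * g) = of_nat m * g"
    unfolding cq by (simp add: algebra_simps)
  ultimately have "m = 0" using least[of m] m(2) by (cases "m = 0") auto
  hence "of_int c * g = of_int q * (of_nat r * g)" unfolding cq by (simp add: algebra_simps)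
  hence "(of_int q * (of_nat r * g), x) \<in> S" using c by simp
  hence "x = (\<zeta> ^ r) powi q"
    using partial_character_functional[OF S _ partial_character_multiple[OF S val]] by blast
  thus ?thesis unfolding cq \<open>m = 0\<close> by (simp add: power_int_power mult.commute)
qed

lemma partial_character_extension_exists:
  fixes S :: "('b::ring_1 \<times> 'a::alg_closed_field) set"
  assumes S: "partial_character S"
  shows "\<exists>S' \<zeta>. partial_character S' \<and> S \<subseteq> S' \<and> (g, \<zeta>) \<in> S'"
proof (cases "\<exists>m>0. \<exists>x. (of_nat m * g, x) \<in> S")
  case True
  define r where "r = (LEAST m. m > 0 \<and> (\<exists>x. (of_nat m * g, x) \<in> S))"
  have r: "r > 0 \<and> (\<exists>x. (of_nat r * g, x) \<in> S)" unfolding r_def by (rule LeastI_ex) (use True in blast)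
  then obtain x where x: "(of_nat r * g, x) \<in> S" by blast
  obtain \<zeta> where \<zeta>: "\<zeta> ^ r = x" using alg_closed_root_exists r by blast
  have "\<zeta> \<noteq> 0" using \<zeta> r partial_character_nonzero[OF S x] by (auto simp: power_0_left)
  have least: "r \<le> m" if "m > 0" "(of_nat m * g, y) \<in> S" for m y
    unfolding r_def by (rule Least_le) (use that in blast)
  have "r > 0" and val: "(of_nat r * g, \<zeta> ^ r) \<in> S" using r x \<zeta> by simp_all
  have "\<exists>S'. partial_character S' \<and> S \<subseteq> S' \<and> (g, \<zeta>) \<in> S'"
    by (rule partial_character_extend[OF S \<open>\<zeta> \<noteq> 0\<close>], rule partial_character_compatible[OF S \<open>r > 0\<close> val least])
  thus ?thesis by (elim exE) (intro exI)
next
  case False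
  have "x = 1 powi c" if c: "(of_int c * g, x) \<in> S" for c x
  proof (cases c "0::int" rule: linorder_cases)
    case less
    hence "(of_nat (nat (- c)) * g, inverse x) \<in> S" using partial_characterD(3)[OF S c] by simp
    thus ?thesis using False less by (metis neg_0_less_iff_less zero_less_nat_eq)
  next
    case equal
    thus ?thesis using c partial_characterD(4)[OF S] by simp
  next
    case greater
    hence "(of_nat (nat c) * g, x) \<in> S" using c by simp
    thus ?thesis using False greater by (metis zero_less_nat_eq)
  qed
  hence "\<exists>S'. partial_character S' \<and> S \<subseteq> S' \<and> (g, 1) \<in> S'"
    by (rule partial_character_extend[OF S one_neq_zero])
  thus ?thesis by blast
qed

definition character :: "('b::ring_1 \<Rightarrow> 'a::field) \<Rightarrow> bool" where
  "character \<chi> \<longleftrightarrow> \<chi> 0 = 1 \<and> (\<forall>a b. \<chi> (a + b) = \<chi> a * \<chi> b)"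

lemma characterD:
  assumes "character \<chi>"
  shows "\<chi> 0 = 1" "\<chi> (a + b) = \<chi> a * \<chi> b" "\<chi> a \<noteq> 0" "\<chi> (- a) = inverse (\<chi> a)" "\<chi> (a - b) = \<chi> a / \<chi> b"
proof -
  show "\<chi> 0 = 1" and add: "\<chi> (a + b) = \<chi> a * \<chi> b" for a b using assms unfolding character_def by auto
  have "\<chi> a * \<chi> (- a) = 1" for a using add[of a "- a"] \<open>\<chi> 0 = 1\<close> by simp
  thus nz: "\<chi> a \<noteq> 0" and neg: "\<chi> (- a) = inverse (\<chi> a)" for a
    by (metis mult_zero_left zero_neq_one, metis inverse_unique)
  show "\<chi> (a - b) = \<chi> a / \<chi> b" using add[of a "- b"] neg[of b] by (simp add: divide_inverse)
qed

lemma character_multiple: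
  assumes "character \<chi>" shows "\<chi> (of_int c * a) = \<chi> a powi c"
proof -
  have nat: "\<chi> (of_nat n * a) = \<chi> a ^ n" for n
    by (induction n) (simp_all add: characterD[OF assms] distrib_right)
  show ?thesis
  proof (cases c rule: int_cases2)
    case (nonneg n)
    thus ?thesis using nat[of n] by simp
  next
    case (nonpos n)
    thus ?thesis using nat[of n] characterD(4)[OF assms] by (simp add: power_int_minus)
  qed
qed

text \<open>Characters with values in an algebraically closed field extend, since its multiplicative group
  is divisible.\<close>

lemma partial_character_total:
  fixes S :: "('b::ring_1 \<times> 'a::alg_closed_field) set"
  assumes S: "partial_character S"
  shows "\<exists>\<chi>. character \<chi> \<and> (\<forall>a x. (a, x) \<in> S \<longrightarrow> \<chi> a = x)"
proof -
  let ?A = "{T. partial_character T \<and> S \<subseteq> T}"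
  have "\<exists>M\<in>?A. \<forall>X\<in>?A. M \<subseteq> X \<longrightarrow> X = M"
  proof (rule subset_Zorn_nonempty)
    have "S \<in> ?A" using S by simp
    thus "?A \<noteq> {}" by fast
    fix C assume ne: "C \<noteq> {}" and chain: "subset.chain ?A C"
    have sub: "T \<in> C \<Longrightarrow> partial_character T \<and> S \<subseteq> T" for T 
      using chain unfolding subset.chain_def by (metis (lifting) mem_Collect_eq subsetD)
    have lin: "T \<subseteq> U \<or> U \<subseteq> T" if "T \<in> C" "U \<in> C" for T U
      using chain that by (simp add: subset_chain_def)
    have "partial_character (\<Union>C)"
      unfolding partial_character_def
    proof (intro conjI allI impI)
      show "(0, 1) \<in> \<Union>C" using ne by (elim ex_in_conv[THEN iffD2, elim_format] exE) (rule UnionI, assumption, rule partial_characterD(1)[OF conjunct1[OF sub]])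
    next
      fix a x b y assume "(a, x) \<in> \<Union>C" "(b, y) \<in> \<Union>C"
      then obtain T U where TU: "T \<in> C" "(a, x) \<in> T" "U \<in> C" "(b, y) \<in> U" by blast
      obtain V where V: "V \<in> C" "(a, x) \<in> V" "(b, y) \<in> V"
      proof (cases "T \<subseteq> U")
        case True
        thus ?thesis using that[OF TU(3) subsetD TU(4)] TU(2) by simp
      next
        case False
        hence "U \<subseteq> T" using lin[OF TU(1,3)] by simp
        thus ?thesis using that[OF TU(1,2) subsetD] TU(4) by simp
      qed
      have "(a + b, x * y) \<in> V" by (rule partial_characterD(2)[OF conjunct1[OF sub[OF V(1)]] V(2,3)])
      thus "(a + b, x * y) \<in> \<Union>C" using V(1) by blast
    next
      fix a x assume "(a, x) \<in> \<Union>C"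
      then obtain T where T: "T \<in> C" "(a, x) \<in> T" by (rule UnionE)
      show "(- a, inverse x) \<in> \<Union>C" by (rule UnionI[OF T(1) partial_characterD(3)[OF conjunct1[OF sub[OF T(1)]] T(2)]])
    next
      fix x assume "(0, x) \<in> \<Union>C"
      then obtain T where "T \<in> C" "(0, x) \<in> T" by (rule UnionE)
      thus "x = 1" using partial_characterD(4)[OF conjunct1[OF sub]] by simp
    qed
    moreover have "S \<subseteq> \<Union>C"
    proof
      fix p assume "p \<in> S"
      obtain T where "T \<in> C" using ne by fast
      thus "p \<in> \<Union>C" using sub[of T] \<open>p \<in> S\<close> by fast
    qed
    ultimately show "\<Union>C \<in> ?A" by simp
  qed
  then obtain M where M': "M \<in> ?A" "\<forall>X\<in>?A. M \<subseteq> X \<longrightarrow> X = M" by (rule bexE)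
  hence M: "partial_character M" "S \<subseteq> M" by simp_all
  have max: "X = M" if "partial_character X" "M \<subseteq> X" for X
    using M'(2) that order.trans[OF M(2) that(2)] by simp
  have "\<exists>x. (a, x) \<in> M" for a
  proof -
    obtain X x where X: "partial_character X" "M \<subseteq> X" "(a, x) \<in> X"
      using partial_character_extension_exists[OF M(1), of a] by (elim exE conjE) (rule that)
    show ?thesis using X(3) unfolding max[OF X(1,2)] by (rule exI)
  qed
  hence "\<exists>\<chi>. \<forall>a. (a, \<chi> a) \<in> M" by (intro choice allI)
  then obtain \<chi> where \<chi>: "\<And>a. (a, \<chi> a) \<in> M" by (elim exE) (rule that, erule spec)
  note uniq = partial_character_functional[OF M(1)]
  have "\<chi> 0 = 1" by (rule uniq[OF \<chi> partial_characterD(1)[OF M(1)]])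
  moreover have "\<chi> (a + b) = \<chi> a * \<chi> b" for a b by (rule uniq[OF \<chi> partial_characterD(2)[OF M(1) \<chi> \<chi>]])
  ultimately have "character \<chi>" unfolding character_def by simp
  moreover have "\<chi> a = x" if "(a, x) \<in> S" for a x by (rule uniq[OF \<chi> subsetD[OF M(2) that]])
  ultimately show ?thesis by (intro exI[of _ \<chi>]) simp
qed

text \<open>The order of \<open>h\<close> modulo \<open>N\<close> is the only constraint on the value at \<open>h\<close>.\<close>

lemma character_with_value:
  fixes N :: "'b::ring_1 set" and \<zeta> :: "'a::alg_closed_field"
  assumes N: "0 \<in> N" "\<And>a b. a \<in> N \<Longrightarrow> b \<in> N \<Longrightarrow> a + b \<in> N" "\<And>a. a \<in> N \<Longrightarrow> - a \<in> N"
    and r: "r > 0" "of_nat r * h \<in> N" and least: "\<And>m. 0 < m \<Longrightarrow> of_nat m * h \<in> N \<Longrightarrow> r \<le> m"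
    and \<zeta>: "\<zeta> ^ r = 1"
  shows "\<exists>\<chi>. character \<chi> \<and> (\<forall>a\<in>N. \<chi> a = 1) \<and> \<chi> h = \<zeta>"
proof -
  let ?S = "N \<times> {1 :: 'a}"
  have S: "partial_character ?S" unfolding partial_character_def using N by auto
  have "\<zeta> \<noteq> 0" using \<zeta> r(1) by (auto simp: power_0_left)
  moreover have "x = \<zeta> powi c" if "(of_int c * h, x) \<in> ?S" for c x
    by (rule partial_character_compatible[OF S r(1) _ _ that]) (use r \<zeta> least in auto)
  ultimately obtain S' where S': "partial_character S'" "?S \<subseteq> S'" "(h, \<zeta>) \<in> S'"
    using partial_character_extend[OF S] by blast
  obtain \<chi> where "character \<chi>" "\<And>a x. (a, x) \<in> S' \<Longrightarrow> \<chi> a = x"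
    using partial_character_total[OF S'(1)] by blast
  thus ?thesis using S'(2,3) by blast
qed

section \<open>The Galois action on fractional power series\<close>

definition integral_exps :: "('d \<Rightarrow> rat) set" where
  "integral_exps = {\<alpha>. \<forall>i. \<alpha> i \<in> \<int>}"

lemma integral_exps_subgroup:
  "0 \<in> integral_exps" "\<alpha> \<in> integral_exps \<Longrightarrow> \<beta> \<in> integral_exps \<Longrightarrow> \<alpha> + \<beta> \<in> integral_exps"
  "\<alpha> \<in> integral_exps \<Longrightarrow> - \<alpha> \<in> integral_exps"
  by (simp_all add: integral_exps_def)

lemma rat_exp_integral: "rat_exp \<beta> \<in> integral_exps"
  by (simp add: rat_exp_def integral_exps_def)

text \<open>A character trivial on integral exponents is an element of the Galois group of the fractional
  series over \<open>K[[X]]\<close>.\<close>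

definition galois_character :: "(('d \<Rightarrow> rat) \<Rightarrow> 'a::field) \<Rightarrow> bool" where
  "galois_character \<chi> \<longleftrightarrow> character \<chi> \<and> (\<forall>\<alpha>\<in>integral_exps. \<chi> \<alpha> = 1)"

lift_definition twist :: "(('d::finite \<Rightarrow> rat) \<Rightarrow> 'a::comm_ring_1) \<Rightarrow> ('a, 'd) fracps \<Rightarrow> ('a, 'd) fracps"
  is "\<lambda>\<chi> f \<alpha>. \<chi> \<alpha> * f \<alpha>"
  by (elim exE conjE, intro exI conjI, assumption, erule order.trans[rotated], rule Collect_mono) auto

lemma pcoeff_twist: "pcoeff (twist \<chi> z) \<alpha> = \<chi> \<alpha> * pcoeff z \<alpha>"
  by (simp add: twist.rep_eq)

lemma twist_mult:
  fixes y z :: "('a::field, 'd::finite) fracps"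
  assumes "character \<chi>"
  shows "twist \<chi> (y * z) = twist \<chi> y * twist \<chi> z"
proof (rule pser_eqI)
  fix \<gamma>
  show "pcoeff (twist \<chi> (y * z)) \<gamma> = pcoeff (twist \<chi> y * twist \<chi> z) \<gamma>"
    unfolding pcoeff_twist times_pser.rep_eq conv_def sum_distrib_left
    by (rule sum.cong) (auto simp: characterD[OF assms] twist.rep_eq)
qed

lemma inj_idom_hom_twist:
  assumes \<chi>: "character \<chi>"
  shows "inj_idom_hom (twist \<chi> :: ('a::field, 'd::finite) fracps \<Rightarrow> ('a, 'd) fracps)"
proof
  show "twist \<chi> (0 :: ('a, 'd) fracps) = 0" "twist \<chi> (1 :: ('a, 'd) fracps) = 1"
    "twist \<chi> (y + z) = twist \<chi> y + twist \<chi> z" for y z :: "('a, 'd) fracps"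
    by (rule pser_eqI, simp add: pcoeff_twist pcoeff_1 characterD(1)[OF \<chi>] distrib_left)+
  show "twist \<chi> (y * z) = twist \<chi> y * twist \<chi> z" for y z :: "('a, 'd) fracps" by (rule twist_mult[OF \<chi>])
  fix y :: "('a, 'd) fracps" assume y: "twist \<chi> y = 0"
  show "y = 0"
  proof (rule pser_eqI)
    fix \<alpha>
    have "\<chi> \<alpha> * pcoeff y \<alpha> = 0" unfolding pcoeff_twist[symmetric] y by simp
    thus "pcoeff y \<alpha> = pcoeff 0 \<alpha>" using characterD(3)[OF \<chi>] by simp
  qed
qed

lemma twist_embed:
  assumes "galois_character \<chi>" shows "twist \<chi> (embed f) = embed f"
proof (rule pser_eqI)
  fix \<alpha>
  show "pcoeff (twist \<chi> (embed f)) \<alpha> = pcoeff (embed f) \<alpha>"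
  proof (cases "\<alpha> \<in> range rat_exp")
    case True
    then obtain \<beta> where "\<alpha> = rat_exp \<beta>" by (rule rangeE)
    thus ?thesis using assms rat_exp_integral[of \<beta>] by (simp add: pcoeff_twist galois_character_def)
  qed (simp add: pcoeff_twist pcoeff_embed_not_range)
qed

lemma twist_twist: "twist \<psi> (twist \<chi> z) = twist (\<lambda>\<alpha>. \<psi> \<alpha> * \<chi> \<alpha>) z"
  by (rule pser_eqI) (simp add: pcoeff_twist mult.assoc)

lemma twist_one: "twist (\<lambda>_. 1) z = z"
  by (rule pser_eqI) (simp add: pcoeff_twist)

lemma galois_character_mult:
  "galois_character \<psi> \<Longrightarrow> galois_character \<chi> \<Longrightarrow> galois_character (\<lambda>\<alpha>. \<psi> \<alpha> * \<chi> \<alpha>)"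
  unfolding galois_character_def character_def by auto

lemma galois_character_one: "galois_character (\<lambda>_. 1)"
  unfolding galois_character_def character_def by auto

lemma galois_character_inverse: "galois_character \<chi> \<Longrightarrow> galois_character (\<lambda>\<alpha>. inverse (\<chi> \<alpha>))"
  unfolding galois_character_def character_def by auto

lemma twist_inverse:
  assumes "galois_character \<chi>" shows "twist (\<lambda>\<alpha>. inverse (\<chi> \<alpha>)) (twist \<chi> z) = z"
  using assms characterD(3)[of \<chi>] by (intro pser_eqI) (simp add: pcoeff_twist galois_character_def)

lemma twist_Zer:
  fixes f :: "('a::field, 'd::finite) mps poly"
  assumes \<chi>: "galois_character \<chi>" and y: "y \<in> Zer f"
  shows "twist \<chi> y \<in> Zer f"
proof -
  interpret t: inj_idom_hom "twist \<chi> :: ('a, 'd) fracps \<Rightarrow> ('a, 'd) fracps"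
    by (rule inj_idom_hom_twist) (use \<chi> in \<open>simp add: galois_character_def\<close>)
  have "map_poly (twist \<chi>) (map_poly embed f) = map_poly embed f"
    by (subst map_poly_map_poly) (simp_all add: o_def twist_embed[OF \<chi>])
  hence "poly (map_poly embed f) (twist \<chi> y) = twist \<chi> (poly (map_poly embed f) y)"
    using t.poly_map_poly[of "map_poly embed f" y] by (simp only:)
  thus ?thesis using y by (simp add: Zer_def)
qed

lemma monomial_unit_twist:
  assumes "character \<chi>" "monomial_unit z \<mu>" shows "monomial_unit (twist \<chi> z) \<mu>"
  using assms(2) characterD(3)[OF assms(1)] unfolding monomial_unit_def pcoeff_twist by simp

lemma nonneg_integral_rat_exp:
  assumes "\<alpha> \<in> integral_exps" "0 \<le> \<alpha>" shows "\<alpha> \<in> range rat_exp"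
proof
  show "\<alpha> = rat_exp (\<lambda>i. nat \<lfloor>\<alpha> i\<rfloor>)"
  proof
    fix i
    have "\<alpha> i \<in> \<int>" "0 \<le> \<alpha> i" using assms by (simp_all add: integral_exps_def le_fun_def)
    thus "\<alpha> i = rat_exp (\<lambda>i. nat \<lfloor>\<alpha> i\<rfloor>) i" by (auto simp: rat_exp_def elim!: Ints_cases)
  qed
qed simp

lemma multiple_in_integral_exps:
  fixes \<alpha> :: "'d::finite \<Rightarrow> rat"
  assumes "0 \<le> \<alpha>" shows "\<exists>k>0. of_nat k * \<alpha> \<in> integral_exps"
proof -
  obtain k where k: "k > 0" "\<alpha> \<in> grid k" using rat_nonneg_in_grid[OF assms] by (elim exE conjE) (rule that)
  have "of_nat k * \<alpha> i \<in> \<int>" for i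
  proof -
    have "of_nat k * \<alpha> i \<in> \<nat>" using k(2) by (simp add: grid_def)
    thus ?thesis using Nats_subset_Ints by blast
  qed
  hence "of_nat k * \<alpha> \<in> integral_exps" by (simp add: integral_exps_def)
  thus ?thesis using k(1) by (intro exI[of _ k] conjI)
qed

text \<open>The fixed ring of the Galois group: a non-integral exponent is moved by a character whose value
  there is a nontrivial root of unity.\<close>

lemma twist_invariant_in_range_embed:
  fixes z :: "('a::{alg_closed_field, field_char_0}, 'd::finite) fracps"
  assumes inv: "\<And>\<chi>. galois_character \<chi> \<Longrightarrow> twist \<chi> z = z"
  shows "\<exists>f. z = embed f"
proof -
  have int: "\<alpha> \<in> integral_exps" if nz: "pcoeff z \<alpha> \<noteq> 0" for \<alpha>
  proof (rule ccontr)
    assume no: "\<alpha> \<notin> integral_exps"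
    let ?P = "\<lambda>m. m > 0 \<and> of_nat m * \<alpha> \<in> integral_exps"
    define r where "r = (LEAST m. ?P m)"
    have r: "?P r" unfolding r_def
      by (rule LeastI_ex) (use multiple_in_integral_exps[OF fracps_supp_nonneg[OF nz]] in blast)
    have least: "r \<le> m" if "m > 0" "of_nat m * \<alpha> \<in> integral_exps" for m
      unfolding r_def by (rule Least_le) (use that in blast)
    have "r \<noteq> 1" using r no by auto
    hence "card {z :: 'a. z ^ r = 1} \<noteq> card {1 :: 'a}" using card_roots_of_unity[of r, where 'a = 'a] r by simp
    hence "{z :: 'a. z ^ r = 1} \<noteq> {1}" by metis
    then obtain \<zeta> :: 'a where \<zeta>: "\<zeta> ^ r = 1" "\<zeta> \<noteq> 1" by auto
    have rp: "r > 0" "of_nat r * \<alpha> \<in> integral_exps" using r by simp_all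
    have "\<exists>\<chi>. character \<chi> \<and> (\<forall>a\<in>integral_exps. \<chi> a = 1) \<and> \<chi> \<alpha> = \<zeta>"
      by (rule character_with_value[OF integral_exps_subgroup(1) _ _ rp _ \<zeta>(1)])
        (assumption | rule integral_exps_subgroup(2,3) least)+
    then obtain \<chi> :: "('d \<Rightarrow> rat) \<Rightarrow> 'a" where \<chi>: "character \<chi>" "\<forall>a\<in>integral_exps. \<chi> a = 1" "\<chi> \<alpha> = \<zeta>"
      by (elim exE conjE) (rule that)
    have "twist \<chi> z = z" by (rule inv) (use \<chi> in \<open>simp add: galois_character_def\<close>)
    hence "\<chi> \<alpha> * pcoeff z \<alpha> = pcoeff z \<alpha>" using pcoeff_twist[of \<chi> z \<alpha>] by simp
    thus False using nz \<chi>(3) \<zeta>(2) by simp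
  qed
  have "z = embed (Abs_pser (\<lambda>\<beta>. pcoeff z (rat_exp \<beta>)))"
  proof (rule pser_eq_embedI)
    show "pcoeff z (rat_exp \<beta>) = pcoeff (Abs_pser (\<lambda>\<beta>. pcoeff z (rat_exp \<beta>)) :: ('a, 'd) mps) \<beta>" for \<beta>
      by (simp only: pcoeff_Abs_mps)
    show "pcoeff z \<alpha> = 0" if "\<alpha> \<notin> range rat_exp" for \<alpha>
      using that int nonneg_integral_rat_exp fracps_supp_nonneg by blast
  qed
  thus ?thesis by (rule exI)
qed

text \<open>The polynomial with roots the conjugates of \<open>y\<close> has invariant coefficients, so it lies over
  \<open>K[[X]]\<close>; the remainder of \<open>f\<close> modulo it vanishes at all conjugates and has smaller degree, so
  it is zero, and \<open>f\<close> is irreducible.\<close>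

lemma galois_transitive:
  fixes f :: "('a::{alg_closed_field, field_char_0}, 'd::finite) mps poly"
  assumes irr: "irreducible f" and deg: "degree f > 0" and y: "y \<in> Zer f"
  shows "Zer f = {twist \<chi> y | \<chi>. galois_character \<chi>}"
proof -
  interpret e: inj_idom_hom "embed :: ('a, 'd) mps \<Rightarrow> ('a, 'd) fracps" by (rule inj_idom_hom_embed)
  interpret me: map_poly_inj_idom_hom "embed :: ('a, 'd) mps \<Rightarrow> ('a, 'd) fracps" ..
  define Orb where "Orb = {twist \<chi> y | \<chi>. galois_character \<chi>}"
  have Orb: "Orb \<subseteq> Zer f" unfolding Orb_def by (intro subsetI, elim CollectE exE conjE) (simp add: twist_Zer[OF _ y])
  have fin: "finite Orb" by (rule finite_subset[OF Orb finite_Zer[OF deg]])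
  have yO: "y \<in> Orb" unfolding Orb_def using galois_character_one twist_one[of y] by (intro CollectI exI[of _ "\<lambda>_. 1"]) simp
  hence card: "card Orb > 0" using fin card_gt_0_iff by blast
  let ?P = "\<Prod>z\<in>Orb. [:- z, 1:]"
  have degP: "degree ?P = card Orb" by (subst degree_prod_eq_sum_degree) simp_all
  have lcP: "lead_coeff ?P = 1" by (simp add: lead_coeff_prod)
  have "\<exists>c'. coeff ?P n = embed c'" for n
  proof (rule twist_invariant_in_range_embed)
    fix \<psi> :: "('d \<Rightarrow> rat) \<Rightarrow> 'a" assume \<psi>: "galois_character \<psi>"
    interpret t: inj_idom_hom "twist \<psi> :: ('a, 'd) fracps \<Rightarrow> ('a, 'd) fracps"
      by (rule inj_idom_hom_twist) (use \<psi> in \<open>simp add: galois_character_def\<close>)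
    interpret mt: map_poly_inj_idom_hom "twist \<psi> :: ('a, 'd) fracps \<Rightarrow> ('a, 'd) fracps" ..
    have inj: "inj_on (twist \<psi>) Orb" by (rule inj_onI) simp
    have "twist \<psi> ` Orb \<subseteq> Orb"
    proof (rule image_subsetI)
      fix z assume "z \<in> Orb"
      then obtain \<chi> where \<chi>: "galois_character \<chi>" "z = twist \<chi> y" unfolding Orb_def by blast
      show "twist \<psi> z \<in> Orb" unfolding Orb_def \<chi>(2) twist_twist
        by (intro CollectI exI[of _ "\<lambda>\<alpha>. \<psi> \<alpha> * \<chi> \<alpha>"] conjI refl galois_character_mult[OF \<psi> \<chi>(1)])
    qed
    hence img: "twist \<psi> ` Orb = Orb" by (rule endo_inj_surj[OF fin _ inj])
    have "map_poly (twist \<psi>) ?P = (\<Prod>z\<in>Orb. [:- twist \<psi> z, 1:])"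
      by (simp add: mt.hom_prod t.map_poly_pCons_hom t.hom_uminus)
    also have "\<dots> = (\<Prod>z\<in>twist \<psi> ` Orb. [:- z, 1:])" by (simp add: prod.reindex[OF inj])
    finally have "map_poly (twist \<psi>) ?P = ?P" unfolding img .
    hence "coeff (map_poly (twist \<psi>) ?P) n = coeff ?P n" by simp
    thus "twist \<psi> (coeff ?P n) = coeff ?P n" by simp
  qed
  hence "\<exists>c. \<forall>n. coeff ?P n = embed (c n)" by (intro choice allI)
  then obtain c where c: "\<And>n. coeff ?P n = embed (c n)" by (elim exE) (rule that, erule spec)
  have c0: "c n = 0" if "n > card Orb" for n
  proof -
    have "coeff ?P n = 0" by (rule coeff_eq_0) (use that degP in simp)
    hence "embed (c n) = 0" unfolding c .
    thus ?thesis by simp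
  qed
  define Q where "Q = Poly (map c [0..<Suc (card Orb)])"
  have cQ: "coeff Q n = c n" for n
    unfolding Q_def using c0[of n] by (auto simp: nth_default_def simp del: upt_Suc)
  have Q: "map_poly embed Q = ?P" by (rule poly_eqI) (unfold c, simp add: cQ)
  have degQ: "degree Q = card Orb" using degP unfolding Q[symmetric] by simp
  have "embed (lead_coeff Q) = 1" using lcP unfolding Q[symmetric] by simp
  hence lcQ: "lead_coeff Q = 1" by simp
  obtain q r where qr: "f = Q * q + r" "degree r < degree Q"
    using monic_remainder[OF lcQ card[folded degQ], of f] by (elim exE conjE) (rule that)
  have "r = 0"
  proof (rule ccontr)
    assume r: "r \<noteq> 0"
    have r': "map_poly embed r \<noteq> 0" using r by simp
    have "poly (map_poly embed r) z = 0" if z: "z \<in> Orb" for z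
    proof -
      have "poly (map_poly embed f) z = 0" using z Orb by (auto simp: Zer_def)
      moreover have "poly (map_poly embed Q) z = 0" unfolding Q poly_prod by (rule prod_zero[OF fin]) (use z in auto)
      ultimately show ?thesis unfolding qr(1) me.hom_add me.hom_mult poly_add poly_mult by simp
    qed
    hence "Orb \<subseteq> {z. poly (map_poly embed r) z = 0}" by (intro subsetI CollectI)
    hence "card Orb \<le> card {z. poly (map_poly embed r) z = 0}" by (rule card_mono[OF poly_roots_finite[OF r']])
    also have "\<dots> \<le> degree (map_poly embed r)" by (rule card_poly_roots_bound[OF r'])
    finally show False using qr(2) degQ by simp
  qed
  hence fQ: "f = Q * q" using qr(1) by simp
  have "\<not> Q dvd 1" using degQ card by (auto simp: poly_dvd_1)
  hence "q dvd 1" using irreducibleD[OF irr fQ] by simp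
  hence "degree q = 0" by (simp add: poly_dvd_1)
  moreover have "Q \<noteq> 0" "q \<noteq> 0" using fQ deg by auto
  ultimately have "degree f = card Orb" unfolding fQ by (simp add: degree_mult_eq degQ)
  moreover have "card (Zer f) \<le> degree (map_poly embed f)"
    unfolding Zer_def by (rule card_poly_roots_bound) (use deg in auto)
  ultimately have "card (Zer f) \<le> card Orb" by simp
  hence "card Orb = card (Zer f)" using card_mono[OF finite_Zer[OF deg] Orb] by (rule order.antisym[rotated])
  hence "Orb = Zer f" by (rule card_subset_eq[OF finite_Zer[OF deg] Orb])
  thus ?thesis unfolding Orb_def by (rule sym)
qed

section \<open>The lattices generated by the exponents\<close>

lemma of_int_fun_apply [simp]: "(of_int c :: 'a \<Rightarrow> 'b::ring_1) x = of_int c"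
  by (cases c rule: int_cases2) simp_all

lemma char_lattice_0: "char_lattice hs 0 = integral_exps"
proof (intro equalityI subsetI)
  fix \<alpha> :: "'a \<Rightarrow> rat" assume "\<alpha> \<in> char_lattice hs 0"
  thus "\<alpha> \<in> integral_exps" by (auto simp: char_lattice_def integral_exps_def)
next
  fix \<alpha> :: "'a \<Rightarrow> rat" assume "\<alpha> \<in> integral_exps"
  hence "\<alpha> = (\<lambda>j. of_int \<lfloor>\<alpha> j\<rfloor>)" by (auto simp: integral_exps_def)
  thus "\<alpha> \<in> char_lattice hs 0" unfolding char_lattice_def
    by (intro CollectI exI[of _ "\<lambda>j. \<lfloor>\<alpha> j\<rfloor>"] exI[of _ "\<lambda>_. 0"]) simp
qed

lemma char_lattice_Suc:
  "char_lattice hs (Suc j) = {\<alpha> + of_int c * (hs ! j) | \<alpha> c. \<alpha> \<in> char_lattice hs j}"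
proof (intro equalityI subsetI)
  fix \<beta> :: "'a \<Rightarrow> rat" assume "\<beta> \<in> char_lattice hs (Suc j)"
  then obtain z c where \<beta>: "\<beta> = (\<lambda>i. of_int (z i) + (\<Sum>l=1..Suc j. of_int (c l) * (hs ! (l - 1)) i))"
    unfolding char_lattice_def by (elim CollectE exE) (rule that)
  have "\<beta> = (\<lambda>i. of_int (z i) + (\<Sum>l=1..j. of_int (c l) * (hs ! (l - 1)) i)) + of_int (c (Suc j)) * (hs ! j)"
    unfolding \<beta> by (rule ext) simp
  moreover have "(\<lambda>i. of_int (z i) + (\<Sum>l=1..j. of_int (c l) * (hs ! (l - 1)) i)) \<in> char_lattice hs j"
    unfolding char_lattice_def by (rule CollectI, rule exI[of _ z], rule exI[of _ c], rule refl)
  ultimately show "\<beta> \<in> {\<alpha> + of_int c * (hs ! j) | \<alpha> c. \<alpha> \<in> char_lattice hs j}"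
    by (intro CollectI exI conjI)
next
  fix \<beta> :: "'a \<Rightarrow> rat" assume "\<beta> \<in> {\<alpha> + of_int c * (hs ! j) | \<alpha> c. \<alpha> \<in> char_lattice hs j}"
  then obtain \<alpha> d where \<beta>: "\<beta> = \<alpha> + of_int d * (hs ! j)" and "\<alpha> \<in> char_lattice hs j"
    by (elim CollectE exE conjE) (rule that)
  then obtain z c where \<alpha>: "\<alpha> = (\<lambda>i. of_int (z i) + (\<Sum>l=1..j. of_int (c l) * (hs ! (l - 1)) i))"
    unfolding char_lattice_def by (elim CollectE exE) (rule that)
  have "(\<Sum>l=1..j. of_int ((c(Suc j := d)) l) * (hs ! (l - 1)) i) = (\<Sum>l=1..j. of_int (c l) * (hs ! (l - 1)) i)" for i
    by (rule sum.cong) auto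
  hence "\<beta> = (\<lambda>i. of_int (z i) + (\<Sum>l=1..Suc j. of_int ((c(Suc j := d)) l) * (hs ! (l - 1)) i))"
    unfolding \<beta> \<alpha> by (intro ext) simp
  thus "\<beta> \<in> char_lattice hs (Suc j)" unfolding char_lattice_def by (intro CollectI exI)
qed

lemma char_lattice_SucI: "\<alpha> \<in> char_lattice hs j \<Longrightarrow> \<alpha> + of_int c * (hs ! j) \<in> char_lattice hs (Suc j)"
  unfolding char_lattice_Suc by (rule CollectI, rule exI[of _ \<alpha>], rule exI[of _ c], rule conjI[OF refl])

lemma char_lattice_SucE:
  assumes "\<beta> \<in> char_lattice hs (Suc j)"
  obtains \<alpha> c where "\<beta> = \<alpha> + of_int c * (hs ! j)" "\<alpha> \<in> char_lattice hs j"
  using assms unfolding char_lattice_Suc by (elim CollectE exE conjE) (rule that)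

lemma char_lattice_zero: "0 \<in> char_lattice hs j"
proof (induction j)
  case 0
  show ?case unfolding char_lattice_0 by (rule integral_exps_subgroup(1))
next
  case (Suc j)
  have "0 + of_int 0 * (hs ! j) \<in> char_lattice hs (Suc j)" by (rule char_lattice_SucI[OF Suc])
  thus ?case by (simp only: of_int_0 mult_zero_left add_0_right)
qed

lemma char_lattice_add:
  assumes "\<alpha> \<in> char_lattice hs j" "\<beta> \<in> char_lattice hs j" shows "\<alpha> + \<beta> \<in> char_lattice hs j"
  using assms
proof (induction j arbitrary: \<alpha> \<beta>)
  case 0
  thus ?case unfolding char_lattice_0 by (rule integral_exps_subgroup(2))
next
  case (Suc j)
  obtain a c where a: "\<alpha> = a + of_int c * (hs ! j)" "a \<in> char_lattice hs j" using Suc(2) by (rule char_lattice_SucE)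
  obtain b d where b: "\<beta> = b + of_int d * (hs ! j)" "b \<in> char_lattice hs j" using Suc(3) by (rule char_lattice_SucE)
  have eq: "\<alpha> + \<beta> = (a + b) + of_int (c + d) * (hs ! j)" unfolding a(1) b(1) by (simp add: algebra_simps)
  show ?case unfolding eq by (rule char_lattice_SucI[OF Suc(1)[OF a(2) b(2)]])
qed

lemma char_lattice_multiple:
  assumes "\<alpha> \<in> char_lattice hs j" shows "of_int n * \<alpha> \<in> char_lattice hs j"
  using assms
proof (induction j arbitrary: \<alpha>)
  case 0
  thus ?case by (simp add: char_lattice_0 integral_exps_def)
next
  case (Suc j)
  obtain a c where a: "\<alpha> = a + of_int c * (hs ! j)" "a \<in> char_lattice hs j" using Suc(2) by (rule char_lattice_SucE)
  have eq: "of_int n * \<alpha> = of_int n * a + of_int (n * c) * (hs ! j)" unfolding a(1) by (simp add: algebra_simps)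
  show ?case unfolding eq by (rule char_lattice_SucI[OF Suc(1)[OF a(2)]])
qed

lemma char_lattice_minus: "\<alpha> \<in> char_lattice hs j \<Longrightarrow> - \<alpha> \<in> char_lattice hs j"
  using char_lattice_multiple[of \<alpha> hs j "-1"] by simp

lemma char_lattice_diff: "\<alpha> \<in> char_lattice hs j \<Longrightarrow> \<beta> \<in> char_lattice hs j \<Longrightarrow> \<alpha> - \<beta> \<in> char_lattice hs j"
  using char_lattice_add[OF _ char_lattice_minus, of \<alpha> hs j \<beta>] by simp

lemma char_lattice_mono: "i \<le> j \<Longrightarrow> char_lattice hs i \<subseteq> char_lattice hs j"
proof (induction j rule: dec_induct)
  case (step j)
  have "char_lattice hs j \<subseteq> char_lattice hs (Suc j)"
  proof
    fix \<alpha> :: "'a \<Rightarrow> rat" assume "\<alpha> \<in> char_lattice hs j"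
    from char_lattice_SucI[OF this, of 0] show "\<alpha> \<in> char_lattice hs (Suc j)" by simp
  qed
  thus ?case using step by simp
qed simp

lemma exponent_in_char_lattice: "l \<in> {1..j} \<Longrightarrow> hs ! (l - 1) \<in> char_lattice hs j"
proof -
  assume l: "l \<in> {1..j}"
  have "0 + of_int 1 * (hs ! (l - 1)) \<in> char_lattice hs (Suc (l - 1))"
    by (rule char_lattice_SucI[OF char_lattice_zero])
  hence "hs ! (l - 1) \<in> char_lattice hs (Suc (l - 1))" by (simp only: add_0 of_int_1 mult_1_left)
  thus ?thesis using l char_lattice_mono[of "Suc (l - 1)" j hs] by auto
qed

lemma character_trivial_on_char_lattice:
  assumes \<chi>: "galois_character \<chi>" and triv: "\<And>l. l \<in> {1..j} \<Longrightarrow> \<chi> (hs ! (l - 1)) = 1"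
    and \<alpha>: "\<alpha> \<in> char_lattice hs j"
  shows "\<chi> \<alpha> = 1"
  using triv \<alpha>
proof (induction j arbitrary: \<alpha>)
  case 0
  thus ?case using \<chi> by (simp add: char_lattice_0 galois_character_def)
next
  case (Suc j)
  have c: "character \<chi>" using \<chi> by (simp add: galois_character_def)
  obtain a d where a: "\<alpha> = a + of_int d * (hs ! j)" "a \<in> char_lattice hs j" using Suc(3) by (rule char_lattice_SucE)
  have "\<chi> a = 1" using Suc.IH[OF _ a(2)] Suc.prems(1) by simp
  moreover have "\<chi> (hs ! j) = 1" using Suc.prems(1)[of "Suc j"] by simp
  ultimately show ?case unfolding a(1) characterD(2)[OF c] character_multiple[OF c] by simp
qed

text \<open>The quotient \<open>N\<^sub>i / N\<^sub>i\<^sub>-\<^sub>1\<close> is cyclic, generated by \<open>h\<^sub>i\<close>, so the index is the order of \<open>h\<^sub>i\<close>.\<close>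

lemma add_index_char_lattice:
  fixes hs :: "('d \<Rightarrow> rat) list"
  assumes r: "r > 0" "of_nat r * (hs ! j) \<in> char_lattice hs j"
    and least: "\<And>m. 0 < m \<Longrightarrow> of_nat m * (hs ! j) \<in> char_lattice hs j \<Longrightarrow> r \<le> m"
  shows "add_index (char_lattice hs (Suc j)) (char_lattice hs j) = r"
proof -
  let ?H = "char_lattice hs j" and ?h = "hs ! j"
  define K where "K a = (\<lambda>x. x + a) ` ?H" for a
  have K_eq: "K a = K b \<longleftrightarrow> a - b \<in> ?H" for a b
  proof
    assume "K a = K b"
    moreover have "a \<in> K a" unfolding K_def by (rule image_eqI[OF _ char_lattice_zero]) simp
    ultimately have "a \<in> K b" by simp
    then obtain x where "a = x + b" "x \<in> ?H" unfolding K_def by (rule imageE)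
    thus "a - b \<in> ?H" by simp
  next
    assume ab: "a - b \<in> ?H"
    have "x + a \<in> K b" if "x \<in> ?H" for x
      unfolding K_def by (rule image_eqI[OF _ char_lattice_add[OF that ab]]) simp
    moreover have "x + b \<in> K a" if "x \<in> ?H" for x
      unfolding K_def by (rule image_eqI[OF _ char_lattice_diff[OF that ab]]) simp
    ultimately show "K a = K b" unfolding K_def by (intro equalityI image_subsetI)
  qed
  have cosets: "rcosets\<^bsub>\<lparr>carrier = char_lattice hs (Suc j), monoid.mult = (+), one = 0\<rparr>\<^esub> ?H
      = K ` char_lattice hs (Suc j)"
    unfolding RCOSETS_def r_coset_def K_def by auto
  have "K ` char_lattice hs (Suc j) = (\<lambda>m. K (of_nat m * ?h)) ` {..<r}"
  proof (intro equalityI subsetI)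
    fix C assume "C \<in> K ` char_lattice hs (Suc j)"
    then obtain a where a: "C = K a" "a \<in> char_lattice hs (Suc j)" by (rule imageE)
    obtain \<alpha> c where \<alpha>: "a = \<alpha> + of_int c * ?h" "\<alpha> \<in> ?H" using a(2) by (rule char_lattice_SucE)
    define m where "m = nat (c mod int r)"
    have m: "int m = c mod int r" "m < r" using r(1) by (simp_all add: m_def nat_less_iff)
    have "c = (c div int r) * int r + int m" unfolding m(1) by simp
    hence "of_int c * ?h = of_int ((c div int r) * int r + int m) * ?h" by (rule arg_cong)
    hence "a - of_nat m * ?h = \<alpha> + of_int (c div int r) * (of_nat r * ?h)"
      unfolding \<alpha>(1) by (simp add: algebra_simps)
    hence "a - of_nat m * ?h \<in> ?H" using char_lattice_add[OF \<alpha>(2) char_lattice_multiple[OF r(2)]] by simp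
    hence "C = K (of_nat m * ?h)" unfolding a(1) K_eq .
    thus "C \<in> (\<lambda>m. K (of_nat m * ?h)) ` {..<r}" by (rule image_eqI) (simp add: m(2))
  next
    fix C assume "C \<in> (\<lambda>m. K (of_nat m * ?h)) ` {..<r}"
    then obtain m where m: "C = K (of_nat m * ?h)" by (rule imageE)
    have "0 + of_int (int m) * ?h \<in> char_lattice hs (Suc j)" by (rule char_lattice_SucI[OF char_lattice_zero])
    hence "of_nat m * ?h \<in> char_lattice hs (Suc j)" by (simp only: add_0 of_int_of_nat_eq)
    thus "C \<in> K ` char_lattice hs (Suc j)" unfolding m by (rule imageI)
  qed
  moreover have "inj_on (\<lambda>m. K (of_nat m * ?h)) {..<r}"
  proof (rule linorder_inj_onI')
    fix m n :: nat assume mn: "m < n" "n \<in> {..<r}"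
    show "K (of_nat m * ?h) \<noteq> K (of_nat n * ?h)"
    proof
      assume "K (of_nat m * ?h) = K (of_nat n * ?h)"
      hence "K (of_nat n * ?h) = K (of_nat m * ?h)" by (rule sym)
      hence "of_nat n * ?h - of_nat m * ?h \<in> ?H" unfolding K_eq .
      moreover have "of_nat n * ?h - of_nat m * ?h = of_nat (n - m) * ?h"
        using mn(1) by (simp add: of_nat_diff algebra_simps)
      ultimately have "of_nat (n - m) * ?h \<in> ?H" by (simp only:)
      thus False using least[of "n - m"] mn by auto
    qed
  qed
  ultimately show ?thesis unfolding add_index_def cosets by (simp add: card_image)
qed

section \<open>The sequence of characteristic exponents\<close>

lemma finite_chain_sorted_list:
  fixes H :: "'b::order set"
  assumes "finite H" "\<And>x y. x \<in> H \<Longrightarrow> y \<in> H \<Longrightarrow> x \<le> y \<or> y \<le> x"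
  shows "\<exists>hs. sorted_wrt (<) hs \<and> set hs = H"
  using assms
proof (induction "card H" arbitrary: H)
  case 0
  thus ?case by (intro exI[of _ "[]"]) simp
next
  case (Suc n)
  hence "H \<noteq> {}" by auto
  then obtain m where m: "m \<in> H" "\<And>x. x \<in> H \<Longrightarrow> m \<le> x \<Longrightarrow> m = x"
    using finite_has_maximal[OF Suc(3)] by metis
  have "\<exists>hs. sorted_wrt (<) hs \<and> set hs = H - {m}"
    by (rule Suc(1)) (use Suc(2-4) m(1) in auto)
  then obtain hs where hs: "sorted_wrt (<) hs" "set hs = H - {m}" by blast
  have "x < m" if "x \<in> set hs" for x
    using Suc(4)[OF m(1), of x] m(2)[of x] that hs(2) by (auto simp: order.strict_iff_order)
  hence "sorted_wrt (<) (hs @ [m])" using hs(1) by (simp add: sorted_wrt_append)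
  moreover have "set (hs @ [m]) = H" using hs(2) m(1) by auto
  ultimately show ?case by blast
qed

lemma sorted_list_unique:
  fixes xs ys :: "'b::order list"
  assumes "sorted_wrt (<) xs" "sorted_wrt (<) ys" "set xs = set ys"
  shows "xs = ys"
  using assms
proof (induction xs arbitrary: ys)
  case (Cons a xs)
  then obtain b ys' where ys: "ys = b # ys'" by (cases ys) auto
  have "a = b \<or> b < a" "a = b \<or> a < b" using Cons.prems unfolding ys by auto
  hence ab: "a = b" by auto
  have "a \<notin> set xs" "b \<notin> set ys'" using Cons.prems unfolding ys by auto
  hence "set xs = set ys'" using Cons.prems(3) unfolding ys ab by auto
  thus ?case using Cons.IH[of ys'] Cons.prems unfolding ys ab by simp
qed simp

lemma sorted_wrt_less_distinct: "sorted_wrt (<) (xs :: 'b::order list) \<Longrightarrow> distinct xs"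
  by (induction xs) auto

lemma contact_twist:
  assumes Z: "separated Z" and yz: "y \<in> Z" "z \<in> Z" and \<chi>: "galois_character \<chi>"
  shows "contact (twist \<chi> y) (twist \<chi> z) = contact y z"
proof (rule contact_cases[OF Z yz])
  assume "y = z"
  thus ?thesis by (simp add: contact_def)
next
  fix \<mu> assume h: "y \<noteq> z" "monomial_unit (y - z) \<mu>" "contact y z = top.Value \<mu>"
  have c: "character \<chi>" using \<chi> by (simp add: galois_character_def)
  have diff: "twist \<chi> y - twist \<chi> z = twist \<chi> (y - z)"
    by (rule pser_eqI) (simp add: pcoeff_twist right_diff_distrib)
  have "monomial_unit (twist \<chi> y - twist \<chi> z) \<mu>" unfolding diff by (rule monomial_unit_twist[OF c h(2)])
  moreover have "twist \<chi> y \<noteq> twist \<chi> z" using twist_inverse[OF \<chi>] h(1) by metis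
  ultimately show ?thesis using contact_eq_Value h(3) by simp
qed

lemma contact_set_twist:
  fixes f :: "('a::field_char_0, 'd::finite) mps poly"
  assumes Z: "separated (Zer f)" and y: "y \<in> Zer f" and \<chi>: "galois_character \<chi>"
  shows "{contact z y | z. z \<in> Zer f \<and> z \<noteq> y} \<subseteq> {contact z (twist \<chi> y) | z. z \<in> Zer f \<and> z \<noteq> twist \<chi> y}"
proof (intro subsetI, elim CollectE exE conjE)
  fix c z assume h: "c = contact z y" "z \<in> Zer f" "z \<noteq> y"
  have "c = contact (twist \<chi> z) (twist \<chi> y)" unfolding h(1) by (rule contact_twist[OF Z h(2) y \<chi>, symmetric])
  moreover have "twist \<chi> z \<noteq> twist \<chi> y" using twist_inverse[OF \<chi>] h(3) by metis
  ultimately show "c \<in> {contact z (twist \<chi> y) | z. z \<in> Zer f \<and> z \<noteq> twist \<chi> y}"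
    using twist_Zer[OF \<chi> h(2)] by (intro CollectI exI[of _ "twist \<chi> z"] conjI)
qed

text \<open>Conjugation carries the contacts with one root to the contacts with another, and all contacts with
  one root are comparable; hence the increasing enumeration exists and is unique.\<close>

lemma char_exponents_spec:
  fixes f :: "('a::{alg_closed_field, field_char_0}, 'd::finite) mps poly"
  assumes deg: "degree f > 0" and qo: "quasi_ordinary f" and irr: "irreducible f" and ne: "Zer f \<noteq> {}"
  shows "sorted_wrt (<) (char_exponents f)"
    and "\<And>y. y \<in> Zer f \<Longrightarrow> top.Value ` set (char_exponents f) = {contact z y | z. z \<in> Zer f \<and> z \<noteq> y}"
proof -
  note Z = separated_Zer[OF deg qo]
  obtain y0 where y0: "y0 \<in> Zer f" using ne by blast
  let ?C = "\<lambda>y. {contact z y | z. z \<in> Zer f \<and> z \<noteq> y}"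
  have const: "?C y = ?C y0" if y: "y \<in> Zer f" for y
  proof -
    have "y \<in> {twist \<chi> y0 | \<chi>. galois_character \<chi>}" using y galois_transitive[OF irr deg y0] by simp
    then obtain \<chi> where \<chi>: "y = twist \<chi> y0" "galois_character \<chi>" by (elim CollectE exE conjE) (rule that)
    have "?C y0 \<subseteq> ?C y" unfolding \<chi>(1) by (rule contact_set_twist[OF Z y0 \<chi>(2)])
    moreover have "y0 = twist (\<lambda>\<alpha>. inverse (\<chi> \<alpha>)) y" unfolding \<chi>(1) by (rule twist_inverse[OF \<chi>(2), symmetric])
    hence "?C y \<subseteq> ?C y0" using contact_set_twist[OF Z y galois_character_inverse[OF \<chi>(2)]] by simp
    ultimately show ?thesis by (rule equalityI[rotated])
  qed
  define H where "H = {\<mu>. top.Value \<mu> \<in> ?C y0}"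
  have VH: "top.Value ` H = ?C y0"
  proof (intro equalityI subsetI)
    fix c assume c: "c \<in> ?C y0"
    then obtain z where z: "c = contact z y0" "z \<in> Zer f" "z \<noteq> y0" by (elim CollectE exE conjE) (rule that)
    obtain \<mu> where \<mu>: "c = top.Value \<mu>"
      by (rule contact_cases[OF Z z(2) y0]) (use z in \<open>simp_all add: that\<close>)
    have "\<mu> \<in> H" unfolding H_def using c \<mu> by (simp only: mem_Collect_eq)
    thus "c \<in> top.Value ` H" unfolding \<mu> by (rule imageI)
  next
    fix c assume "c \<in> top.Value ` H"
    then obtain \<mu> where "c = top.Value \<mu>" "\<mu> \<in> H" by (rule imageE)
    thus "c \<in> ?C y0" unfolding H_def by (simp only: mem_Collect_eq)
  qed
  have "?C y0 \<subseteq> (\<lambda>z. contact z y0) ` Zer f" by (intro subsetI, elim CollectE exE conjE) (simp add: imageI)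
  hence "finite (?C y0)" by (rule finite_subset) (rule finite_imageI[OF finite_Zer[OF deg]])
  hence fin: "finite H" unfolding VH[symmetric] by (rule finite_imageD) (simp add: inj_on_def)
  have chain: "\<mu> \<le> \<nu> \<or> \<nu> \<le> \<mu>" if m: "\<mu> \<in> H" "\<nu> \<in> H" for \<mu> \<nu>
  proof -
    obtain z w where zw: "top.Value \<mu> = contact z y0" "z \<in> Zer f" "top.Value \<nu> = contact w y0" "w \<in> Zer f"
      using m unfolding H_def by (elim CollectE exE conjE) (rule that)
    have "contact z y0 \<le> contact y0 w \<or> contact y0 w \<le> contact z y0" by (rule contact_total[OF Z zw(2) y0 zw(4)])
    thus ?thesis unfolding contact_sym[OF Z y0 zw(4)] zw(1,3)[symmetric] by simp
  qed
  let ?S = "\<lambda>hs. sorted_wrt (<) hs \<and> (\<forall>y\<in>Zer f. top.Value ` set hs = ?C y)"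
  have "\<exists>hs. sorted_wrt (<) hs \<and> set hs = H"
    by (rule finite_chain_sorted_list[OF fin]) (rule chain)
  then obtain hs where hs: "sorted_wrt (<) hs" "set hs = H" by (elim exE conjE) (rule that)
  have S: "?S hs"
  proof (intro conjI ballI)
    fix y assume "y \<in> Zer f"
    show "top.Value ` set hs = ?C y" unfolding hs(2) VH by (rule const[OF \<open>y \<in> Zer f\<close>, symmetric])
  qed (rule hs(1))
  have "?S (char_exponents f)"
    unfolding char_exponents_def
  proof (rule theI[of ?S, OF S])
    fix ks assume ks: "?S ks"
    have "top.Value ` set ks = top.Value ` set hs"
      by (rule trans[OF bspec[OF conjunct2[OF ks] y0] bspec[OF conjunct2[OF S] y0, symmetric]])
    hence "set ks = set hs" by (rule inj_image_eq_iff[THEN iffD1, rotated]) (simp add: inj_on_def)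
    thus "ks = hs" by (rule sorted_list_unique[OF conjunct1[OF ks] hs(1)])
  qed
  thus "sorted_wrt (<) (char_exponents f)"
    and "\<And>y. y \<in> Zer f \<Longrightarrow> top.Value ` set (char_exponents f) = ?C y" by (rule conjunct1, rule bspec[OF conjunct2])
qed

section \<open>The bars of an irreducible polynomial\<close>

text \<open>Counts postbars by counting values of characters.\<close>

lemma card_image_eq_if_same_kernel:
  assumes "\<And>x y. x \<in> X \<Longrightarrow> y \<in> X \<Longrightarrow> F x = F y \<longleftrightarrow> G x = G y"
  shows "card (F ` X) = card (G ` X)"
proof -
  let ?\<phi> = "\<lambda>u. G (inv_into X F u)"
  have \<phi>: "?\<phi> (F x) = G x" if "x \<in> X" for x
    using assms[OF inv_into_into[of "F x" F X] that] f_inv_into_f[of "F x" F X] that by simp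
  have "inj_on ?\<phi> (F ` X)" by (rule inj_onI) (auto simp: \<phi> assms)
  moreover have "?\<phi> ` (F ` X) = G ` X" by (simp add: image_image \<phi>)
  ultimately show ?thesis by (metis card_image)
qed

text \<open>The existence of a root is kept as a hypothesis; it comes from the Abhyankar-Jung theorem.\<close>

locale irreducible_quasi_ordinary =
  fixes f :: "('k::{alg_closed_field, field_char_0}, 'd::finite) mps poly"
  assumes deg: "degree f > 0" and qo: "quasi_ordinary f" and irr: "irreducible f" and ne: "Zer f \<noteq> {}"
begin

abbreviation "Z \<equiv> Zer f"
abbreviation "hs \<equiv> char_exponents f"
abbreviation "ht \<equiv> char_height hs"

lemmas sep = separated_Zer[OF deg qo]
lemmas sorted_hs = char_exponents_spec(1)[OF deg qo irr ne]
lemmas contacts_hs = char_exponents_spec(2)[OF deg qo irr ne]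

lemma ht_less_iff:
  assumes "i \<in> {1..length hs + 1}" "j \<in> {1..length hs + 1}" shows "ht i < ht j \<longleftrightarrow> i < j"
proof -
  have less: "ht i < ht j" if ij: "i \<ge> 1" "i < j" "j \<le> length hs + 1" for i j
  proof (cases "j \<le> length hs")
    case True
    have "hs ! (i - 1) < hs ! (j - 1)" by (rule sorted_wrt_nth_less[OF sorted_hs]) (use ij True in auto)
    thus ?thesis using True ij by (simp add: char_height_def)
  qed (use ij in \<open>simp add: char_height_def\<close>)
  show ?thesis
  proof (cases i j rule: linorder_cases)
    case greater
    hence "ht j < ht i" using less assms by simp
    thus ?thesis using greater by (simp add: order.strict_iff_not)
  qed (use less assms in auto)
qed

lemma ht_le_iff:
  assumes "i \<in> {1..length hs + 1}" "j \<in> {1..length hs + 1}" shows "ht i \<le> ht j \<longleftrightarrow> i \<le> j"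
proof (cases "i = j")
  case False
  hence "ht i \<noteq> ht j" using char_height_inject[OF sorted_wrt_less_distinct[OF sorted_hs] assms] by blast
  thus ?thesis using ht_less_iff[OF assms] False by (auto simp: order.order_iff_strict)
qed simp

lemma contact_is_ht:
  assumes "y \<in> Z" "z \<in> Z" obtains i where "i \<in> {1..length hs + 1}" "contact z y = ht i"
proof (cases "z = y")
  case True
  thus ?thesis using that[of "length hs + 1"] by (simp add: char_height_def contact_def)
next
  case False
  have "contact z y \<in> top.Value ` set hs" unfolding contacts_hs[OF assms(1)] using False assms(2)
    by (intro CollectI exI[of _ z]) simp
  then obtain h where h: "contact z y = top.Value h" "h \<in> set hs" by (rule imageE)
  obtain n where "n < length hs" "hs ! n = h" using h(2) unfolding in_set_conv_nth by (elim exE conjE) (rule that)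
  thus ?thesis using that[of "Suc n"] h(1) by (simp add: char_height_def)
qed

lemma exists_contact:
  assumes "y \<in> Z" "i \<in> {1..length hs + 1}" obtains z where "z \<in> Z" "contact z y = ht i"
proof (cases "i \<le> length hs")
  case True
  have "top.Value (hs ! (i - 1)) \<in> top.Value ` set hs" using assms(2) True by (intro imageI nth_mem) auto
  thus ?thesis unfolding contacts_hs[OF assms(1)] using that True
    by (elim CollectE exE conjE) (simp add: char_height_def)
next
  case False
  thus ?thesis using that[OF assms(1)] by (simp add: char_height_def contact_def)
qed

lemma root_as_twist:
  assumes "y \<in> Z" "z \<in> Z" obtains \<chi> where "galois_character \<chi>" "z = twist \<chi> y"
proof -
  have "z \<in> {twist \<chi> y | \<chi>. galois_character \<chi>}" using assms(2) galois_transitive[OF irr deg assms(1)] by simp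
  thus ?thesis by (elim CollectE exE conjE) (rule that)
qed

lemma pcoeff_twist_diff: "pcoeff (twist \<chi> y - y) \<alpha> = (\<chi> \<alpha> - 1) * pcoeff y \<alpha>"
  by (simp add: pcoeff_twist left_diff_distrib)

lemma twist_contact_coeff:
  assumes y: "y \<in> Z" and \<chi>: "galois_character \<chi>" and h: "contact (twist \<chi> y) y = top.Value h"
  shows "\<chi> h \<noteq> 1" "pcoeff y h \<noteq> 0"
proof -
  have "monomial_unit (twist \<chi> y - y) h" by (rule contact_Value_D(2)[OF sep twist_Zer[OF \<chi> y] y h])
  hence "(\<chi> h - 1) * pcoeff y h \<noteq> 0" unfolding monomial_unit_def pcoeff_twist_diff by (rule conjunct1)
  thus "\<chi> h \<noteq> 1" "pcoeff y h \<noteq> 0" by auto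
qed

text \<open>A characteristic exponent occurs in every root, as it is the lowest exponent of a difference of
  conjugates.\<close>

lemma pcoeff_char_exponent:
  assumes y: "y \<in> Z" and i: "i \<in> {1..length hs}" shows "pcoeff y (hs ! (i - 1)) \<noteq> 0"
proof -
  obtain z where z: "z \<in> Z" "contact z y = ht i" by (rule exists_contact[OF y, of i]) (use i in auto)
  obtain \<chi> where \<chi>: "galois_character \<chi>" "z = twist \<chi> y" using y z(1) by (rule root_as_twist)
  show ?thesis by (rule twist_contact_coeff(2)[OF y \<chi>(1)]) (use z(2) i in \<open>simp add: \<chi>(2)[symmetric] char_height_def\<close>)
qed

text \<open>The contact of a root with its conjugate by \<open>\<chi>\<close> is the first characteristic exponent that \<open>\<chi>\<close>
  moves.\<close>

lemma ht_le_contact_twist_iff: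
  assumes y: "y \<in> Z" and \<chi>: "galois_character \<chi>" and i: "i \<in> {1..length hs + 1}"
  shows "ht i \<le> contact (twist \<chi> y) y \<longleftrightarrow> (\<forall>l\<in>{1..<i}. \<chi> (hs ! (l - 1)) = 1)"
proof
  note ty = twist_Zer[OF \<chi> y]
  assume le: "ht i \<le> contact (twist \<chi> y) y"
  show "\<forall>l\<in>{1..<i}. \<chi> (hs ! (l - 1)) = 1"
  proof
    fix l assume l: "l \<in> {1..<i}"
    hence lt: "ht l < contact (twist \<chi> y) y" using ht_less_iff[of l i] le i order.strict_trans2 by auto
    have l': "l \<in> {1..length hs}" using l i by auto
    have "pcoeff (twist \<chi> y - y) (hs ! (l - 1)) = 0"
    proof (rule contact_cases[OF sep ty y])
      fix \<mu> assume \<mu>: "monomial_unit (twist \<chi> y - y) \<mu>" "contact (twist \<chi> y) y = top.Value \<mu>"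
      have "\<not> \<mu> \<le> hs ! (l - 1)" using lt l' by (auto simp: \<mu>(2) char_height_def)
      thus ?thesis using \<mu>(1) unfolding monomial_unit_def by auto
    qed simp
    thus "\<chi> (hs ! (l - 1)) = 1" using pcoeff_char_exponent[OF y l'] unfolding pcoeff_twist_diff by simp
  qed
next
  assume triv: "\<forall>l\<in>{1..<i}. \<chi> (hs ! (l - 1)) = 1"
  obtain j where j: "j \<in> {1..length hs + 1}" "contact (twist \<chi> y) y = ht j"
    by (rule contact_is_ht[OF y twist_Zer[OF \<chi> y]])
  have "i \<le> j"
  proof (rule ccontr)
    assume "\<not> i \<le> j"
    hence "j < i" "j \<le> length hs" using i by auto
    hence "\<chi> (hs ! (j - 1)) \<noteq> 1"
      using j(2) by (intro twist_contact_coeff(1)[OF y \<chi>]) (simp add: char_height_def)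
    thus False using triv \<open>j < i\<close> j(1) by simp
  qed
  thus "ht i \<le> contact (twist \<chi> y) y" using ht_le_iff[OF i j(1)] j(2) by simp
qed

text \<open>By the ultrametric inequality these are the classes of roots with mutual contact at least \<open>h\<^sub>i\<close>;
  they turn out to be the bars of height \<open>h\<^sub>i\<close>.\<close>

definition ball :: "nat \<Rightarrow> ('k, 'd) fracps \<Rightarrow> ('k, 'd) fracps set" where
  "ball i y = {z \<in> Z. ht i \<le> contact z y}"

lemma ball_subset: "ball i y \<subseteq> Z" by (auto simp: ball_def)

lemma ball_centre: "y \<in> Z \<Longrightarrow> y \<in> ball i y" by (simp add: ball_def contact_def)

lemma ball_pairs:
  assumes y: "y \<in> Z" and zw: "z \<in> ball i y" "w \<in> ball i y" shows "ht i \<le> contact z w"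
proof -
  have z: "z \<in> Z" "ht i \<le> contact z y" and w: "w \<in> Z" "ht i \<le> contact w y" using zw by (simp_all add: ball_def)
  have "ht i \<le> contact y w" using w(2) contact_sym[OF sep w(1) y] by simp
  from contact_ge_trans[OF sep z(1) y w(1) z(2) this] show ?thesis .
qed

lemma ball_eq_iff:
  assumes "y \<in> Z" "z \<in> Z" shows "ball i y = ball i z \<longleftrightarrow> ht i \<le> contact y z"
proof
  assume "ball i y = ball i z"
  hence "y \<in> ball i z" using ball_centre[OF assms(1), of i] by simp
  thus "ht i \<le> contact y z" by (simp add: ball_def)
next
  assume le: "ht i \<le> contact y z"
  hence le': "ht i \<le> contact z y" using contact_sym[OF sep assms] by simp
  show "ball i y = ball i z"
  proof (intro equalityI subsetI)
    fix w assume "w \<in> ball i y"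
    hence w: "w \<in> Z" "ht i \<le> contact w y" by (simp_all add: ball_def)
    show "w \<in> ball i z" using contact_ge_trans[OF sep w(1) assms w(2) le] w(1) by (simp add: ball_def)
  next
    fix w assume "w \<in> ball i z"
    hence w: "w \<in> Z" "ht i \<le> contact w z" by (simp_all add: ball_def)
    show "w \<in> ball i y" using contact_ge_trans[OF sep w(1) assms(2,1) w(2) le'] w(1) by (simp add: ball_def)
  qed
qed

lemma bar_height_ball:
  assumes y: "y \<in> Z" and i: "i \<in> {1..length hs + 1}" shows "bar_height (ball i y) = ht i"
proof (rule order.antisym)
  have B: "separated (ball i y)" "finite (ball i y)" "ball i y \<noteq> {}"
    by (rule separated_subset[OF sep ball_subset], rule finite_subset[OF ball_subset finite_Zer[OF deg]])
      (use ball_centre[OF y, of i] in auto)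
  obtain z where z: "z \<in> Z" "contact z y = ht i" by (rule exists_contact[OF y i])
  have "z \<in> ball i y" using z by (simp add: ball_def)
  from bar_height_props(2)[OF B this ball_centre[OF y]] show "bar_height (ball i y) \<le> ht i" using z(2) by simp
  obtain u v where "u \<in> ball i y" "v \<in> ball i y" "bar_height (ball i y) = contact u v"
    using bar_height_props(1)[OF B] by (elim bexE) (rule that)
  thus "ht i \<le> bar_height (ball i y)" using ball_pairs[OF y] by simp
qed

lemma ht_not_Top: "i \<in> {1..length hs} \<Longrightarrow> ht i \<noteq> top.Top"
  by (simp add: char_height_def)

text \<open>No contact lies strictly between \<open>h\<^sub>i\<close> and \<open>h\<^sub>i\<^sub>+\<^sub>1\<close>.\<close>

lemma postbars_ball:
  assumes y: "y \<in> Z" and i: "i \<in> {1..length hs}"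
  shows "postbars (ball i y) = ball (i + 1) ` ball i y"
proof -
  have i1: "i \<in> {1..length hs + 1}" "i + 1 \<in> {1..length hs + 1}" using i by auto
  note h = bar_height_ball[OF y i1(1)]
  have "bar_class (ball i y) z = ball (i + 1) z" if z: "z \<in> ball i y" for z
  proof -
    have zZ: "z \<in> Z" using z by (simp add: ball_def)
    have step: "ht i < contact w z \<longleftrightarrow> ht (i + 1) \<le> contact w z" if w: "w \<in> Z" for w
    proof -
      obtain j where j: "j \<in> {1..length hs + 1}" "contact w z = ht j" by (rule contact_is_ht[OF zZ w])
      show ?thesis unfolding j(2) ht_less_iff[OF i1(1) j(1)] ht_le_iff[OF i1(2) j(1)] by auto
    qed
    have sub: "w \<in> ball i y" if w: "w \<in> Z" "ht i < contact w z" for w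
    proof -
      have "ball i z = ball i y" using ball_eq_iff[OF zZ y] z by (simp add: ball_def)
      moreover have "w \<in> ball i z" using w by (simp add: ball_def order.strict_implies_order)
      ultimately show ?thesis by simp
    qed
    show ?thesis
    proof (intro equalityI subsetI)
      fix w assume "w \<in> bar_class (ball i y) z"
      hence w: "w \<in> Z" "ht i < contact z w" unfolding bar_class_def h using ball_subset[of i y] by auto
      thus "w \<in> ball (i + 1) z" using step[OF w(1)] contact_sym[OF sep zZ w(1)] by (simp add: ball_def)
    next
      fix w assume "w \<in> ball (i + 1) z"
      hence w: "w \<in> Z" "ht i < contact w z" using step[of w] by (simp_all add: ball_def)
      thus "w \<in> bar_class (ball i y) z" using sub[OF w] contact_sym[OF sep w(1) zZ] by (simp add: bar_class_def h)
    qed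
  qed
  hence "bar_class (ball i y) ` ball i y = ball (i + 1) ` ball i y" by (rule image_cong[OF refl])
  moreover have "postbars (ball i y) = bar_class (ball i y) ` ball i y"
    by (rule postbars_eq) (unfold h, rule ht_not_Top[OF i])
  ultimately show ?thesis by (simp only:)
qed

lemma Zer_ball: "y \<in> Z \<Longrightarrow> Z = ball 1 y"
proof -
  assume y: "y \<in> Z"
  have "ht 1 \<le> contact z y" if z: "z \<in> Z" for z
  proof -
    obtain j where j: "j \<in> {1..length hs + 1}" "contact z y = ht j" by (rule contact_is_ht[OF y z])
    show ?thesis unfolding j(2) by (subst ht_le_iff) (use j(1) in auto)
  qed
  thus ?thesis unfolding ball_def by blast
qed

lemma bars_are_balls: "B \<in> bars f \<Longrightarrow> \<exists>i\<in>{1..length hs + 1}. \<exists>y\<in>Z. B = ball i y"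
proof (induction rule: bars.induct)
  case 1
  obtain y where y: "y \<in> Z" using ne by blast
  show ?case by (intro bexI[of _ 1] bexI[of _ y] Zer_ball[OF y] y) simp
next
  case (2 B C)
  obtain i y where iy: "i \<in> {1..length hs + 1}" "y \<in> Z" "B = ball i y" using 2(3) by (elim bexE) (rule that)
  have "ht i \<noteq> top.Top" using 2(2) bar_height_ball[OF iy(2,1)] unfolding iy(3) by (auto simp: postbars_def)
  hence i: "i \<in> {1..length hs}" using iy(1) by (auto simp: char_height_def split: if_splits)
  have "C \<in> ball (i + 1) ` ball i y" using 2(2) unfolding iy(3) postbars_ball[OF iy(2) i] .
  then obtain z where z: "C = ball (i + 1) z" "z \<in> ball i y" by (rule imageE)
  have "z \<in> Z" using z(2) by (simp add: ball_def)
  thus ?case using i by (intro bexI[of _ "i + 1"] bexI[of _ z] z(1)) simp_all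
qed

lemma balls_are_bars: "y \<in> Z \<Longrightarrow> n < length hs + 1 \<Longrightarrow> ball (Suc n) y \<in> bars f"
proof (induction n)
  case 0
  have "ball (Suc 0) y = Z" using Zer_ball[OF 0(1)] by simp
  thus ?case using bars.intros(1)[of f] by (simp only:)
next
  case (Suc n)
  have "ball (Suc (Suc n)) y \<in> postbars (ball (Suc n) y)"
    using postbars_ball[of y "Suc n"] Suc.prems ball_centre[of y "Suc n"] by simp
  moreover have "ball (Suc n) y \<in> bars f" by (rule Suc.IH) (use Suc.prems in simp_all)
  ultimately show ?case by (rule bars.intros(2)[rotated])
qed

text \<open>The characters fixing \<open>h\<^sub>1, \<dots>, h\<^sub>i\<^sub>-\<^sub>1\<close> act transitively on a bar of height \<open>h\<^sub>i\<close>, and the postbar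
  is determined by the value at \<open>h\<^sub>i\<close>, an \<open>r\<close>-th root of unity with \<open>r\<close> the order of \<open>h\<^sub>i\<close> modulo
  \<open>N\<^sub>i\<^sub>-\<^sub>1\<close>; every such root of unity occurs.\<close>

lemma card_postbars_ball:
  assumes y: "y \<in> Z" and i: "i \<in> {1..length hs}"
  shows "card (postbars (ball i y)) = add_index (char_lattice hs i) (char_lattice hs (i - 1))"
proof -
  let ?h = "hs ! (i - 1)" and ?N = "char_lattice hs (i - 1)"
  have i1: "i \<in> {1..length hs + 1}" "i + 1 \<in> {1..length hs + 1}" using i by auto
  define X where "X = {\<chi> :: ('d \<Rightarrow> rat) \<Rightarrow> 'k. galois_character \<chi> \<and> (\<forall>l\<in>{1..<i}. \<chi> (hs ! (l - 1)) = 1)}"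
  have X: "galois_character \<chi>" "\<And>l. l \<in> {1..<i} \<Longrightarrow> \<chi> (hs ! (l - 1)) = 1" if "\<chi> \<in> X" for \<chi>
    using that by (simp_all add: X_def)
  have "ball i y = (\<lambda>\<chi>. twist \<chi> y) ` X"
  proof (intro equalityI subsetI)
    fix z assume z: "z \<in> ball i y"
    hence zZ: "z \<in> Z" by (simp add: ball_def)
    obtain \<chi> where \<chi>: "galois_character \<chi>" "z = twist \<chi> y" using y zZ by (rule root_as_twist)
    have "\<chi> \<in> X" using z ht_le_contact_twist_iff[OF y \<chi>(1) i1(1)] \<chi> by (simp add: X_def ball_def)
    thus "z \<in> (\<lambda>\<chi>. twist \<chi> y) ` X" unfolding \<chi>(2) by (rule imageI)
  next
    fix z assume "z \<in> (\<lambda>\<chi>. twist \<chi> y) ` X"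
    then obtain \<chi> where \<chi>: "z = twist \<chi> y" "\<chi> \<in> X" by (rule imageE)
    show "z \<in> ball i y" unfolding \<chi>(1)
      using ht_le_contact_twist_iff[OF y X(1)[OF \<chi>(2)] i1(1)] twist_Zer[OF X(1)[OF \<chi>(2)] y] X(2)[OF \<chi>(2)]
      by (simp add: ball_def)
  qed
  hence "postbars (ball i y) = (\<lambda>\<chi>. ball (i + 1) (twist \<chi> y)) ` X"
    unfolding postbars_ball[OF y i] by (simp add: image_image)
  moreover have "card ((\<lambda>\<chi>. ball (i + 1) (twist \<chi> y)) ` X) = card ((\<lambda>\<chi>. \<chi> ?h) ` X)"
  proof (rule card_image_eq_if_same_kernel)
    fix \<chi> \<psi> assume \<chi>: "\<chi> \<in> X" and \<psi>: "\<psi> \<in> X"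
    note ty = twist_Zer[OF X(1)[OF \<chi>] y] and py = twist_Zer[OF X(1)[OF \<psi>] y]
    let ?\<rho> = "\<lambda>\<alpha>. \<chi> \<alpha> * inverse (\<psi> \<alpha>)"
    have nz: "\<psi> \<alpha> \<noteq> 0" for \<alpha>
      by (rule characterD(3)[of \<psi>]) (use X(1)[OF \<psi>] in \<open>simp add: galois_character_def\<close>)
    have \<rho>: "galois_character ?\<rho>" by (rule galois_character_mult[OF X(1)[OF \<chi>] galois_character_inverse[OF X(1)[OF \<psi>]]])
    have eq: "twist \<chi> y = twist ?\<rho> (twist \<psi> y)"
      by (rule pser_eqI) (simp add: pcoeff_twist nz)
    have "ball (i + 1) (twist \<chi> y) = ball (i + 1) (twist \<psi> y) \<longleftrightarrow> (\<forall>l\<in>{1..<i + 1}. ?\<rho> (hs ! (l - 1)) = 1)"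
      unfolding ball_eq_iff[OF ty py] unfolding eq by (rule ht_le_contact_twist_iff[OF py \<rho> i1(2)])
    also have "\<dots> \<longleftrightarrow> ?\<rho> ?h = 1"
    proof
      assume h1: "?\<rho> ?h = 1"
      show "\<forall>l\<in>{1..<i + 1}. ?\<rho> (hs ! (l - 1)) = 1"
      proof
        fix l assume "l \<in> {1..<i + 1}"
        hence "l = i \<or> l \<in> {1..<i}" by auto
        thus "?\<rho> (hs ! (l - 1)) = 1" using h1 X(2)[OF \<chi>] X(2)[OF \<psi>] by auto
      qed
    qed (use i in simp)
    also have "\<dots> \<longleftrightarrow> \<chi> ?h = \<psi> ?h" using nz[of ?h] by (simp add: field_simps)
    finally show "ball (i + 1) (twist \<chi> y) = ball (i + 1) (twist \<psi> y) \<longleftrightarrow> \<chi> ?h = \<psi> ?h" .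
  qed
  moreover obtain r where r: "r > 0" "of_nat r * ?h \<in> ?N"
    and least: "\<And>m. 0 < m \<Longrightarrow> of_nat m * ?h \<in> ?N \<Longrightarrow> r \<le> m"
  proof -
    obtain m where m: "m > 0" "of_nat m * ?h \<in> integral_exps"
      using multiple_in_integral_exps[OF fracps_supp_nonneg[OF pcoeff_char_exponent[OF y i]]] by (elim exE conjE) (rule that)
    have "integral_exps \<subseteq> ?N" using char_lattice_mono[of 0 "i - 1" hs] by (simp add: char_lattice_0)
    hence ex: "0 < m \<and> of_nat m * ?h \<in> ?N" using m by auto
    let ?P = "\<lambda>m. 0 < m \<and> of_nat m * ?h \<in> ?N"
    have "?P (LEAST m. ?P m)" by (rule LeastI[of ?P, OF ex])
    moreover have "(LEAST m. ?P m) \<le> m" if "0 < m" "of_nat m * ?h \<in> ?N" for m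
      by (rule Least_le[of ?P]) (use that in simp)
    ultimately show ?thesis using that[of "LEAST m. ?P m"] by simp
  qed
  have "(\<lambda>\<chi>. \<chi> ?h) ` X = {\<zeta>. \<zeta> ^ r = 1}"
  proof (intro equalityI image_subsetI subsetI CollectI)
    fix \<chi> assume \<chi>: "\<chi> \<in> X"
    have c: "character \<chi>" using X(1)[OF \<chi>] by (simp add: galois_character_def)
    have "\<chi> (of_nat r * ?h) = 1"
      by (rule character_trivial_on_char_lattice[OF X(1)[OF \<chi>] _ r(2)], rule X(2)[OF \<chi>]) (use i in auto)
    thus "\<chi> ?h ^ r = 1" using character_multiple[OF c, of "int r" ?h] by simp
  next
    fix \<zeta> :: 'k assume "\<zeta> \<in> {\<zeta>. \<zeta> ^ r = 1}"
    hence \<zeta>: "\<zeta> ^ r = 1" by simp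
    have "\<exists>\<chi>. character \<chi> \<and> (\<forall>\<alpha>\<in>?N. \<chi> \<alpha> = 1) \<and> \<chi> ?h = \<zeta>"
      by (rule character_with_value[OF char_lattice_zero _ _ r _ \<zeta>])
        (assumption | rule char_lattice_add char_lattice_minus least)+
    then obtain \<chi> :: "('d \<Rightarrow> rat) \<Rightarrow> 'k" where \<chi>: "character \<chi>" "\<forall>\<alpha>\<in>?N. \<chi> \<alpha> = 1" "\<chi> ?h = \<zeta>"
      by (elim exE conjE) (rule that)
    have "integral_exps \<subseteq> ?N" using char_lattice_mono[of 0 "i - 1" hs] by (simp add: char_lattice_0)
    hence "galois_character \<chi>" using \<chi>(1,2) by (auto simp: galois_character_def)
    moreover have "\<chi> (hs ! (l - 1)) = 1" if "l \<in> {1..<i}" for l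
      by (rule bspec[OF \<chi>(2) exponent_in_char_lattice]) (use that in auto)
    ultimately have "\<chi> \<in> X" by (simp add: X_def)
    thus "\<zeta> \<in> (\<lambda>\<chi>. \<chi> ?h) ` X" by (rule rev_image_eqI) (rule \<chi>(3)[symmetric])
  qed
  moreover have "add_index (char_lattice hs (Suc (i - 1))) ?N = r" by (rule add_index_char_lattice[OF r least])
  ultimately show ?thesis using i card_roots_of_unity[OF r(1), where 'a = 'k] by simp
qed

lemma tree_type: "has_tree_type f hs"
  unfolding has_tree_type_def
proof (intro conjI ballI impI)
  obtain y where y: "y \<in> Z" using ne by blast
  show "bar_height ` bars f = ht ` {1..length hs + 1}"
  proof (intro equalityI subsetI)
    fix h assume "h \<in> bar_height ` bars f"
    then obtain B where B: "h = bar_height B" "B \<in> bars f" by (rule imageE)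
    obtain i z where iz: "i \<in> {1..length hs + 1}" "z \<in> Z" "B = ball i z"
      using bars_are_balls[OF B(2)] by (elim bexE) (rule that)
    have "h = ht i" unfolding B(1) iz(3) by (rule bar_height_ball[OF iz(2,1)])
    thus "h \<in> ht ` {1..length hs + 1}" using iz(1) by (rule image_eqI)
  next
    fix h assume "h \<in> ht ` {1..length hs + 1}"
    then obtain i where i: "h = ht i" "i \<in> {1..length hs + 1}" by (rule imageE)
    have "h = bar_height (ball i y)" unfolding i(1) by (rule bar_height_ball[OF y i(2), symmetric])
    moreover have "i - 1 < length hs + 1" "Suc (i - 1) = i" using i(2) by auto
    hence "ball i y \<in> bars f" using balls_are_bars[OF y, of "i - 1"] by (simp only:)
    ultimately show "h \<in> bar_height ` bars f" by (rule image_eqI)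
  qed
next
  fix i B assume i: "i \<in> {1..length hs}" and B: "B \<in> bars f" "bar_height B = ht i"
  obtain j y where jy: "j \<in> {1..length hs + 1}" "y \<in> Z" "B = ball j y"
    using bars_are_balls[OF B(1)] by (elim bexE) (rule that)
  have "ht j = ht i" using B(2) unfolding jy(3) bar_height_ball[OF jy(2,1)] .
  hence "j = i" using char_height_inject[OF sorted_wrt_less_distinct[OF sorted_hs] jy(1), of i] i by simp
  hence Bi: "B = ball i y" using jy(3) by simp
  show "card (postbars B) = add_index (char_lattice hs i) (char_lattice hs (i - 1))"
    unfolding Bi by (rule card_postbars_ball[OF jy(2) i])
  fix C assume "C \<in> postbars B"
  hence "C \<in> ball (i + 1) ` ball i y" unfolding Bi postbars_ball[OF jy(2) i] .
  then obtain z where z: "C = ball (i + 1) z" "z \<in> ball i y" by (rule imageE)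
  have "z \<in> Z" using z(2) by (simp add: ball_def)
  thus "bar_height C = ht (i + 1)" unfolding z(1) by (rule bar_height_ball) (use i in auto)
qed

end

theorem theorem6p2:
  fixes f :: "('k::{alg_closed_field, field_char_0}, 'd::finite) mps poly"
  assumes "weierstrass_poly f" and "quasi_ordinary f" and "irreducible f"
  shows "has_tree_type f (char_exponents f) \<and>
    (\<forall>g :: ('k, 'd) mps poly. weierstrass_poly g \<and> quasi_ordinary g \<and>
       has_tree_type g (char_exponents f) \<longrightarrow> tree_iso f g)"
proof (intro conjI allI impI)
  have deg: "degree f > 0" and lc: "lead_coeff f = 1" using assms(1) by (simp_all add: weierstrass_poly_def)
  obtain z where "poly (map_poly embed f) z = 0"
    using quasi_ordinary_has_fractional_root[OF lc deg assms(2)] by (rule exE)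
  hence "z \<in> Zer f" by (simp add: Zer_def)
  hence ne: "Zer f \<noteq> {}" by auto
  interpret irreducible_quasi_ordinary f by unfold_locales (rule deg assms ne)+
  show type: "has_tree_type f (char_exponents f)" by (rule tree_type)
  fix g :: "('k, 'd) mps poly"
  assume g: "weierstrass_poly g \<and> quasi_ordinary g \<and> has_tree_type g (char_exponents f)"
  have "degree g > 0" using g by (simp add: weierstrass_poly_def)
  thus "tree_iso f g"
    using g by (intro tree_type_determines_tree[OF deg assms(2) ne _ _ type _ sorted_wrt_less_distinct[OF sorted_hs]]) simp_all
qed

end
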